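(* For any constant $\eta<0.5$ and any $2\le k<n/\log n$, there exists a randomized algorithm that solves the $(k,\eta)$-LSPN problem of dimension $n$ (with probability at least $0.9$) in $O\!\left(\frac{n}{k\log k}\right)^{k}$ time using $m=O\!\left(2^{O(k)}+k\log\frac{n}{k}\right)$ samples.
   Context: $(k,\eta)$-LSPN (learning sparse parity with noise) of dimension $n$: there is an unknown vector $s\in\mathbf{F}_2^n$ with at most $k$ nonzero entries. Each sample is an independent pair $(x,y)$, where $x$ is uniformly random in $\mathbf{F}_2^n$ and $y=\langle x,s\rangle+e\in\mathbf{F}_2$, with $e$ an independent Bernoulli noise bit equal to $1$ with probability $\eta$. The goal is to output $s$. Notation: $O(N)^{k}$ means $(C\cdot N)^{k}$ for a constant $C$; implied constants may depend on the constant $\eta$ but not on $n,k$. *)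

theory Defs
  imports
    "HOL-Probability.Probability_Mass_Function"
    "HOL-Library.Z2"
    "Jordan_Normal_Form.Matrix"
begin

section \<open>Sparse parity with noise\<close>

text \<open>The field with two elements is the type \<^typ>\<open>bit\<close>, and its \<open>n\<close>-dimensional vectors are the
  elements of \<open>carrier_vec n\<close>.\<close>

definition hamming_weight :: "bit Matrix.vec \<Rightarrow> nat" where
  "hamming_weight s = card {i. i < dim_vec s \<and> vec_index s i \<noteq> 0}"

definition lspn_sample :: "real \<Rightarrow> nat \<Rightarrow> bit Matrix.vec \<Rightarrow> (bit Matrix.vec \<times> bit) pmf" where
  "lspn_sample \<eta> n s =
     map_pmf (\<lambda>(x, e). (x, scalar_prod x s + of_bool e))
       (pair_pmf (pmf_of_set (carrier_vec n)) (bernoulli_pmf \<eta>))"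

section \<open>Randomized word RAM\<close>

text \<open>
  Running time refers to a randomized RAM with words of \<open>w\<close> bits, programmed in a small structured
  language. A program is a finite command, so it mentions finitely many variables (registers);
  the memory is addressed indirectly by words. Arithmetic is truncated to \<open>w\<close> bits, so no
  unbounded integer can be handled in unit time. Subtraction is cut off at \<open>0\<close>, and division and
  remainder by \<open>0\<close> follow the conventions of \<^typ>\<open>nat\<close>.
\<close>

datatype binop = Add | Sub | Mult | Div | Mod | And | Or | Xor | Shl | Shr | Less | Eq

datatype exp = Lit nat | Var nat | Mem exp | Bin binop exp exp

datatype com =
    Skip
  | Assign nat exp
  | Store exp exp
  | Coin nat
  | Draw exp
  | Seq com com
  | If exp com com
  | While exp com

record state =
  reg :: "nat \<Rightarrow> nat"
  mem :: "nat \<Rightarrow> nat"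
  time :: nat
  drawn :: nat

fun binop_val :: "binop \<Rightarrow> nat \<Rightarrow> nat \<Rightarrow> nat" where
  "binop_val Add a b = a + b"
| "binop_val Sub a b = a - b"
| "binop_val Mult a b = a * b"
| "binop_val Div a b = a div b"
| "binop_val Mod a b = a mod b"
| "binop_val And a b = and a b"
| "binop_val Or a b = or a b"
| "binop_val Xor a b = xor a b"
| "binop_val Shl a b = push_bit b a"
| "binop_val Shr a b = drop_bit b a"
| "binop_val Less a b = of_bool (a < b)"
| "binop_val Eq a b = of_bool (a = b)"

fun exp_val :: "nat \<Rightarrow> state \<Rightarrow> exp \<Rightarrow> nat" where
  "exp_val w \<sigma> (Lit a) = take_bit w a"
| "exp_val w \<sigma> (Var r) = reg \<sigma> r"
| "exp_val w \<sigma> (Mem e) = mem \<sigma> (exp_val w \<sigma> e)"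
| "exp_val w \<sigma> (Bin f e1 e2) = take_bit w (binop_val f (exp_val w \<sigma> e1) (exp_val w \<sigma> e2))"

fun exp_cost :: "exp \<Rightarrow> nat" where
  "exp_cost (Lit a) = 1"
| "exp_cost (Var r) = 1"
| "exp_cost (Mem e) = 1 + exp_cost e"
| "exp_cost (Bin f e1 e2) = 1 + exp_cost e1 + exp_cost e2"

definition tick :: "nat \<Rightarrow> state \<Rightarrow> state" where
  "tick t \<sigma> = \<sigma>\<lparr>time := time \<sigma> + t\<rparr>"

text \<open>A sample \<open>(x, y)\<close> is delivered as \<open>n + 1\<close> consecutive cells, one bit per cell, the last
  one holding \<open>y\<close>, and receiving it costs one unit of time per cell.\<close>

definition receive :: "nat \<Rightarrow> bit Matrix.vec \<times> bit \<Rightarrow> state \<Rightarrow> state" where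
  "receive a z \<sigma> =
     (case z of (x, y) \<Rightarrow>
        tick (dim_vec x + 1)
          (\<sigma>\<lparr>mem := (\<lambda>j. if a \<le> j \<and> j < a + dim_vec x then of_bool (vec_index x (j - a) = 1)
                       else if j = a + dim_vec x then of_bool (y = 1)
                       else mem \<sigma> j),
             drawn := drawn \<sigma> + 1\<rparr>))"

text \<open>
  Small-step semantics, with \<open>D\<close> the distribution of a fresh sample. A configuration with command
  \<^const>\<open>Skip\<close> has halted; every step from any other configuration increases \<^const>\<open>time\<close>.
\<close>

fun step :: "nat \<Rightarrow> (bit Matrix.vec \<times> bit) pmf \<Rightarrow> com \<Rightarrow> state \<Rightarrow> (com \<times> state) pmf" where
  "step w D Skip \<sigma> = return_pmf (Skip, \<sigma>)"
| "step w D (Assign r e) \<sigma> =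
     return_pmf (Skip, tick (1 + exp_cost e) (\<sigma>\<lparr>reg := (reg \<sigma>)(r := exp_val w \<sigma> e)\<rparr>))"
| "step w D (Store a e) \<sigma> =
     return_pmf (Skip, tick (1 + exp_cost a + exp_cost e)
       (\<sigma>\<lparr>mem := (mem \<sigma>)(exp_val w \<sigma> a := exp_val w \<sigma> e)\<rparr>))"
| "step w D (Coin r) \<sigma> =
     map_pmf (\<lambda>b. (Skip, tick 1 (\<sigma>\<lparr>reg := (reg \<sigma>)(r := take_bit w (of_bool b))\<rparr>)))
       (bernoulli_pmf (1 / 2))"
| "step w D (Draw a) \<sigma> =
     map_pmf (\<lambda>z. (Skip, tick (exp_cost a) (receive (exp_val w \<sigma> a) z \<sigma>))) D"
| "step w D (Seq c1 c2) \<sigma> =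
     (if c1 = Skip then return_pmf (c2, tick 1 \<sigma>)
      else map_pmf (\<lambda>(c, \<sigma>'). (Seq c c2, \<sigma>')) (step w D c1 \<sigma>))"
| "step w D (If e c1 c2) \<sigma> =
     return_pmf (if exp_val w \<sigma> e \<noteq> 0 then c1 else c2, tick (1 + exp_cost e) \<sigma>)"
| "step w D (While e c) \<sigma> =
     return_pmf (If e (Seq c (While e c)) Skip, tick 1 \<sigma>)"

fun run :: "nat \<Rightarrow> nat \<Rightarrow> (bit Matrix.vec \<times> bit) pmf \<Rightarrow> com \<Rightarrow> state \<Rightarrow> (com \<times> state) pmf" where
  "run 0 w D c \<sigma> = return_pmf (c, \<sigma>)"
| "run (Suc N) w D c \<sigma> = bind_pmf (step w D c \<sigma>) (\<lambda>(c', \<sigma>'). run N w D c' \<sigma>')"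

section \<open>Solving the problem within given resources\<close>

text \<open>The program receives \<open>n\<close> and \<open>k\<close> in its first two variables and leaves the answer in the
  memory cells \<open>0, \<dots>, n - 1\<close>.\<close>

definition init_state :: "nat \<Rightarrow> nat \<Rightarrow> nat \<Rightarrow> state" where
  "init_state w n k =
     \<lparr>reg = (\<lambda>_. 0)(0 := take_bit w n, 1 := take_bit w k), mem = (\<lambda>_. 0), time = 0, drawn = 0\<rparr>"

definition outputs :: "nat \<Rightarrow> state \<Rightarrow> bit Matrix.vec \<Rightarrow> bool" where
  "outputs n \<sigma> s \<longleftrightarrow> (\<forall>i < n. mem \<sigma> i = of_bool (vec_index s i = 1))"

text \<open>
  The bounds on time and samples are worst-case: they hold for every admissible secret and every
  outcome of the samples and coins. Halted configurations are fixed by \<^const>\<open>step\<close>, so the number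
  \<open>N\<close> of steps in the definition only has to be large enough for all runs to have halted.
\<close>

definition solves_lspn ::
  "com \<Rightarrow> nat \<Rightarrow> real \<Rightarrow> nat \<Rightarrow> nat \<Rightarrow> real \<Rightarrow> real \<Rightarrow> real \<Rightarrow> bool" where
  "solves_lspn P w \<eta> n k p T m \<longleftrightarrow>
     (\<forall>s \<in> carrier_vec n. hamming_weight s \<le> k \<longrightarrow>
       (\<exists>N. let R = run N w (lspn_sample \<eta> n s) P (init_state w n k) in
          (\<forall>(c, \<sigma>) \<in> set_pmf R. c = Skip \<and> real (time \<sigma>) \<le> T \<and> real (drawn \<sigma>) \<le> m) \<and>
          measure_pmf.prob R {(c, \<sigma>). outputs n \<sigma> s} \<ge> p))"

text \<open>Addressing an input consisting of exponentially many (in \<open>k\<close>) samples of dimension \<open>n\<close> takes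
  \<open>\<Theta>(k + log n)\<close> bits, and this is the word length of the machine.\<close>

definition word_size :: "nat \<Rightarrow> nat \<Rightarrow> nat \<Rightarrow> nat" where
  "word_size c n k = c * (k + nat \<lceil>log 2 (real n)\<rceil>)"

end

theory Submission
  imports Defs
begin

text \<open>Cut the coordinates into \<open>N \<approx> n / b\<close> blocks of \<open>b \<approx> log 4 k\<close> coordinates. The support of \<open>s\<close> lies in the
  union \<open>T\<close> of some \<open>k\<close> blocks, and there are only \<open>N choose k \<le> O(n / (k log k)) ^ k\<close> such unions, which are
  enumerated in colexicographic order. For every union \<open>T\<close> and every \<open>i \<in> T\<close>, elimination in the style of
  Blum, Kalai and Wasserman in \<open>b\<close> rounds, each of which cancels the \<open>k\<close> coordinates at one position in
  the blocks of \<open>T\<close> (with \<open>x\<^sub>i\<close> left out), merges disjoint pairs of samples. What survives are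
  disjoint sums of \<open>2 ^ b \<le> k\<close> samples that vanish on \<open>T\<close> outside \<open>i\<close>. If \<open>T\<close> contains the
  support, their labels have bias \<open>(1 - 2 \<eta>) ^ 2 ^ b \<ge> (1 - 2 \<eta>) ^ k\<close> when \<open>s\<^sub>i = 0\<close> and no bias
  when \<open>s\<^sub>i = 1\<close>, so by Chebyshev \<open>2 ^ O(k)\<close> samples decide every \<open>s\<^sub>i\<close>. The candidates obtained from all unions
  are compared on \<open>O(k log n)\<close> further samples, packed \<open>log n\<close> to a word so that one table lookup
  counts the errors in a word; a moment bound for each wrong candidate and a union bound show that
  \<open>s\<close> wins. Independence of a candidate from the scoring samples holds because it only
  depends on the samples used for elimination.\<close>

section \<open>Program logic and running time\<close>

text \<open>Two constraints shape the construction. First, the work per union may depend on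
  \<open>k\<close> only: for bounded \<open>k\<close> the time bound is \<open>n ^ k\<close> up to a
  constant, so a factor \<open>log n\<close> per union would already be too much. This is why the
  scoring samples are packed into \<open>r = k * A\<close> words, and why all loops inside the
  search are bounded by \<open>U\<close>, a function of \<open>k\<close> alone. Work of order
  \<open>n ^ 2\<close> outside the search is affordable because \<open>2 <= k\<close>. Second, the
  machine truncates to words. All stored values are kept below one bound \<open>H\<close> that is
  polynomial in \<open>n\<close> and exponential in \<open>k\<close>; expressions have degree at
  most 12, so \<open>H ^ 12 < 2 ^ w\<close> makes truncation invisible and the code can be verified
  over the natural numbers. No coins are tossed: the final state is a function of the list of
  samples. The constants all come from \<open>C ^ k = D\<close>: the threshold for a bias is
  \<open>1 / D\<close>, and \<open>M = D ^ 3\<close> samples enter the elimination, since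
  Chebyshev's inequality asks for order \<open>k ^ 2 * D ^ 2\<close> sums and the third factor
  \<open>D\<close> pays for the merging.\<close>

fun uval :: "(nat \<Rightarrow> nat) \<Rightarrow> (nat \<Rightarrow> nat) \<Rightarrow> exp \<Rightarrow> nat" where
  "uval R M (Lit a) = a"
| "uval R M (Var r) = R r"
| "uval R M (Mem e) = M (uval R M e)"
| "uval R M (Bin f e1 e2) = binop_val f (uval R M e1) (uval R M e2)"

text \<open>A value computed from entries bounded by \<open>H >= 2\<close> is at most
  \<open>H ^ deg e\<close>; the \<open>Suc\<close> for \<open>Add\<close> and \<open>Xor\<close>
  pays for a factor 2. \<open>Mem\<close> keeps the degree of its address, although its value is at
  most \<open>H\<close>, because the address must escape truncation too.\<close>

fun deg :: "exp \<Rightarrow> nat" where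
  "deg (Lit a) = 1"
| "deg (Var r) = 1"
| "deg (Mem e) = deg e"
| "deg (Bin f e1 e2) =
     (if f = Mult then deg e1 + deg e2
      else if f = Add \<or> f = Xor then Suc (max (deg e1) (deg e2)) else max (deg e1) (deg e2))"

text \<open>These are the operations of the program for which a degree makes sense; a left shift,
  for instance, has no polynomial bound. Literals obey the bound of the cells, so that they can
  count as degree 1.\<close>

fun supported :: "nat \<Rightarrow> exp \<Rightarrow> bool" where
  "supported H (Lit a) = (a \<le> H)"
| "supported H (Var r) = True"
| "supported H (Mem e) = supported H e"
| "supported H (Bin f e1 e2) =
     (f \<in> {Add, Sub, Mult, Div, Mod, Xor, Less, Eq} \<and> supported H e1 \<and> supported H e2)"

definition small :: "nat \<Rightarrow> (nat \<Rightarrow> nat) \<Rightarrow> (nat \<Rightarrow> nat) \<Rightarrow> bool" where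
  "small H R M \<longleftrightarrow> (\<forall>r. R r \<le> H) \<and> (\<forall>x. M x \<le> H)"

lemma xor_le_add: "xor a b \<le> a + (b::nat)"
proof (induction a arbitrary: b rule: less_induct)
  case (less a)
  show ?case
  proof (cases "a = 0")
    case False
    then have "xor (a div 2) (b div 2) \<le> a div 2 + b div 2" by (intro less.IH) auto
    moreover have "xor a b = of_bool (odd a \<noteq> odd b) + 2 * xor (a div 2) (b div 2)"
      by (simp add: xor_rec[of a b])
    moreover have "2 * (a div 2) + of_bool (odd a) = a" "2 * (b div 2) + of_bool (odd b) = b"
      by (auto elim!: oddE)
    moreover have "of_bool (odd a \<noteq> odd b) \<le> of_bool (odd a) + (of_bool (odd b) :: nat)"
      by auto
    ultimately show ?thesis by linarith
  qed simp
qed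

lemma deg_pos: "1 \<le> deg e"
  by (induction e) auto

lemma uval_le_power:
  assumes "small H R M" "2 \<le> H" "supported H e"
  shows "uval R M e \<le> H ^ deg e"
  using assms(3)
proof (induction e)
  case (Mem e)
  have "M (uval R M e) \<le> H ^ 1" using assms by (simp add: small_def)
  also have "\<dots> \<le> H ^ deg e" using deg_pos[of e] assms by (intro power_increasing) auto
  finally show ?case by simp
next
  case (Bin f e1 e2)
  let ?m = "max (deg e1) (deg e2)" and ?v1 = "uval R M e1" and ?v2 = "uval R M e2"
  have "?v1 \<le> H ^ deg e1" "?v2 \<le> H ^ deg e2" using Bin by auto
  moreover have "H ^ deg e1 \<le> H ^ ?m" "H ^ deg e2 \<le> H ^ ?m" "1 \<le> H ^ ?m"
    using assms by (auto intro: power_increasing)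
  ultimately have m: "?v1 \<le> H ^ ?m" "?v2 \<le> H ^ ?m" "1 \<le> H ^ ?m" by linarith+
  have "?v1 + ?v2 \<le> 2 * H ^ ?m" using m by linarith
  also have "\<dots> \<le> H ^ Suc ?m" using assms(2) by simp
  finally have add: "?v1 + ?v2 \<le> H ^ Suc ?m" .
  have mult: "?v1 * ?v2 \<le> H ^ (deg e1 + deg e2)"
    using Bin by (auto simp: power_add intro: mult_mono)
  show ?case
    using Bin.prems add mult m order.trans[OF xor_le_add[of ?v1 ?v2] add]
      order.trans[OF div_le_dividend[of ?v1 ?v2] m(1)] order.trans[OF mod_less_eq_dividend[of ?v1 ?v2] m(1)]
      order.trans[OF diff_le_self[of ?v1 ?v2] m(1)]
    by (cases f) (auto simp: of_bool_def simp del: max_def)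
qed (use assms in \<open>auto simp: small_def\<close>)

text \<open>Big-step semantics over the natural numbers for the deterministic commands. The side
  conditions at \<open>Assign\<close> and \<open>Store\<close> preserve \<open>small\<close>, which
  is what rules out truncation. The times copy the ticks of \<open>step\<close>: the 3 in
  \<open>WhileT\<close> stands for unfolding, branching and sequencing.\<close>

inductive ex :: "nat \<Rightarrow> com \<Rightarrow> (nat \<Rightarrow> nat) \<Rightarrow> (nat \<Rightarrow> nat) \<Rightarrow> nat \<Rightarrow>
    (nat \<Rightarrow> nat) \<Rightarrow> (nat \<Rightarrow> nat) \<Rightarrow> bool" for H where
  Skip: "ex H Skip R M 0 R M"
| Assign: "uval R M e \<le> H \<Longrightarrow> ex H (Assign r e) R M (1 + exp_cost e) (R(r := uval R M e)) M"
| Store: "uval R M e \<le> H \<Longrightarrow>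
    ex H (Store a e) R M (1 + exp_cost a + exp_cost e) R (M(uval R M a := uval R M e))"
| Seq: "ex H c1 R M t1 R1 M1 \<Longrightarrow> ex H c2 R1 M1 t2 R2 M2 \<Longrightarrow> ex H (Seq c1 c2) R M (t1 + t2 + 1) R2 M2"
| IfT: "uval R M e \<noteq> 0 \<Longrightarrow> ex H c1 R M t R1 M1 \<Longrightarrow> ex H (If e c1 c2) R M (1 + exp_cost e + t) R1 M1"
| IfF: "uval R M e = 0 \<Longrightarrow> ex H c2 R M t R1 M1 \<Longrightarrow> ex H (If e c1 c2) R M (1 + exp_cost e + t) R1 M1"
| WhileT: "uval R M e \<noteq> 0 \<Longrightarrow> ex H c R M t1 R1 M1 \<Longrightarrow> ex H (While e c) R1 M1 t2 R2 M2 \<Longrightarrow>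
    ex H (While e c) R M (3 + exp_cost e + t1 + t2) R2 M2"
| WhileF: "uval R M e = 0 \<Longrightarrow> ex H (While e c) R M (2 + exp_cost e) R M"

fun fits :: "nat \<Rightarrow> nat \<Rightarrow> com \<Rightarrow> bool" where
  "fits H d Skip = True"
| "fits H d (Assign r e) = (deg e \<le> d \<and> supported H e)"
| "fits H d (Store a e) = (deg a \<le> d \<and> supported H a \<and> deg e \<le> d \<and> supported H e)"
| "fits H d (Coin r) = False"
| "fits H d (Draw a) = False"
| "fits H d (Seq c1 c2) = (fits H d c1 \<and> fits H d c2)"
| "fits H d (If e c1 c2) = (deg e \<le> d \<and> supported H e \<and> fits H d c1 \<and> fits H d c2)"
| "fits H d (While e c) = (deg e \<le> d \<and> supported H e \<and> fits H d c)"

text \<open>All subexpressions are at most \<open>H ^ d\<close>, hence below \<open>2 ^ w\<close>,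
  so every \<open>take_bit\<close> acts as the identity.\<close>

lemma exp_val_eq_uval:
  assumes "small H R M" "2 \<le> H" "H ^ d < 2 ^ w" "supported H e" "deg e \<le> d"
    and "reg \<sigma> = R" "mem \<sigma> = M"
  shows "exp_val w \<sigma> e = uval R M e"
  using assms(4,5)
proof (induction e)
  case (Lit a)
  have "a \<le> H ^ 1" using Lit by simp
  also have "\<dots> \<le> H ^ d" using Lit assms(2) by (intro power_increasing) auto
  finally show ?case using assms(3) by (simp add: take_bit_nat_eq_self)
next
  case (Bin f e1 e2)
  have le: "deg e1 \<le> deg (Bin f e1 e2)" "deg e2 \<le> deg (Bin f e1 e2)" by auto
  have "uval R M (Bin f e1 e2) \<le> H ^ deg (Bin f e1 e2)"
    using uval_le_power[OF assms(1,2) Bin.prems(1)] .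
  also have "\<dots> \<le> H ^ d" using Bin.prems assms(2) by (intro power_increasing) auto
  finally have "uval R M (Bin f e1 e2) < 2 ^ w" using assms(3) by simp
  moreover have "exp_val w \<sigma> e1 = uval R M e1" "exp_val w \<sigma> e2 = uval R M e2"
    using Bin le by (auto simp del: deg.simps)
  ultimately show ?case by (simp add: take_bit_nat_eq_self)
qed (use assms in auto)

section \<open>Composition of small-step runs\<close>

declare run.simps(2) [simp del]

lemmas run_Suc = run.simps(2)

lemma run_add: "run (N + K) w D c \<sigma> = bind_pmf (run N w D c \<sigma>) (\<lambda>(c', \<sigma>'). run K w D c' \<sigma>')"
  by (induction N arbitrary: c \<sigma>) (simp_all add: run_Suc bind_return_pmf bind_assoc_pmf case_prod_beta')

lemma run_Skip: "run N w D Skip \<sigma> = return_pmf (Skip, \<sigma>)"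
  by (induction N) (simp_all add: run_Suc bind_return_pmf)

definition halted :: "(com \<times> state) pmf \<Rightarrow> bool" where
  "halted \<mu> \<longleftrightarrow> (\<forall>(c, \<sigma>) \<in> set_pmf \<mu>. c = Skip)"

lemma run_mono: "halted (run N w D c \<sigma>) \<Longrightarrow> N \<le> N' \<Longrightarrow> run N' w D c \<sigma> = run N w D c \<sigma>"
proof -
  assume h: "halted (run N w D c \<sigma>)" and "N \<le> N'"
  then obtain K where K: "N' = N + K" using le_Suc_ex by blast
  have "run N' w D c \<sigma> = bind_pmf (run N w D c \<sigma>) return_pmf"
    unfolding K run_add using h
    by (intro bind_pmf_cong refl) (auto simp: halted_def run_Skip)
  then show ?thesis by (simp add: bind_return_pmf')
qed

text \<open>Halted configurations are fixed, so one number of steps serves all outcomes of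
  \<open>c1\<close> although they may halt at different times. The extra step discards the finished
  \<open>Skip\<close>.\<close>

lemma run_Seq:
  assumes "halted (run N1 w D c1 \<sigma>)"
    and "\<And>\<sigma>'. (Skip, \<sigma>') \<in> set_pmf (run N1 w D c1 \<sigma>) \<Longrightarrow> halted (run N2 w D c2 (tick 1 \<sigma>'))"
  shows "run (N1 + N2 + 1) w D (Seq c1 c2) \<sigma> =
    bind_pmf (run N1 w D c1 \<sigma>) (\<lambda>(c', \<sigma>'). run N2 w D c2 (tick 1 \<sigma>'))"
  using assms
proof (induction N1 arbitrary: c1 \<sigma>)
  case 0
  then show ?case by (auto simp: halted_def run_Suc bind_return_pmf)
next
  case (Suc N1)
  show ?case
  proof (cases "c1 = Skip")
    case True
    then have "halted (run N2 w D c2 (tick 1 \<sigma>))"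
      using Suc.prems by (simp add: run_Skip)
    then have "run (Suc (N1 + N2)) w D c2 (tick 1 \<sigma>) = run N2 w D c2 (tick 1 \<sigma>)"
      by (rule run_mono) simp
    moreover have "run (Suc (Suc (N1 + N2))) w D (Seq Skip c2) \<sigma> = run (Suc (N1 + N2)) w D c2 (tick 1 \<sigma>)"
      by (simp add: run_Suc[of "Suc (N1 + N2)"] bind_return_pmf)
    ultimately show ?thesis
      using True by (simp add: run_Skip bind_return_pmf)
  next
    case False
    have IH: "run (N1 + N2 + 1) w D (Seq c' c2) \<sigma>' =
        bind_pmf (run N1 w D c' \<sigma>') (\<lambda>(c'', \<sigma>''). run N2 w D c2 (tick 1 \<sigma>''))"
      if "(c', \<sigma>') \<in> set_pmf (step w D c1 \<sigma>)" for c' \<sigma>'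
      using Suc.prems that by (intro Suc.IH) (force simp: halted_def run_Suc)+
    have "run (Suc N1 + N2 + 1) w D (Seq c1 c2) \<sigma> =
        bind_pmf (step w D c1 \<sigma>) (\<lambda>(c', \<sigma>'). run (N1 + N2 + 1) w D (Seq c' c2) \<sigma>')"
      using False by (simp add: run_Suc[of "Suc (N1 + N2)"] bind_map_pmf case_prod_beta')
    also have "\<dots> = bind_pmf (step w D c1 \<sigma>) (\<lambda>(c', \<sigma>').
        bind_pmf (run N1 w D c' \<sigma>') (\<lambda>(c'', \<sigma>''). run N2 w D c2 (tick 1 \<sigma>'')))"
      using IH by (intro bind_pmf_cong) auto
    also have "\<dots> = bind_pmf (run (Suc N1) w D c1 \<sigma>) (\<lambda>(c', \<sigma>'). run N2 w D c2 (tick 1 \<sigma>'))"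
      by (simp add: run_Suc bind_assoc_pmf case_prod_beta')
    finally show ?thesis .
  qed
qed

lemma run_If:
  "run (Suc N) w D (If e c1 c2) \<sigma> =
     run N w D (if exp_val w \<sigma> e \<noteq> 0 then c1 else c2) (tick (1 + exp_cost e) \<sigma>)"
  by (simp add: run_Suc bind_return_pmf)

lemma run_While:
  "run (Suc N) w D (While e c) \<sigma> = run N w D (If e (Seq c (While e c)) Skip) (tick 1 \<sigma>)"
  by (simp add: run_Suc bind_return_pmf)

lemma tick_simps [simp]:
  "reg (tick t \<sigma>) = reg \<sigma>" "mem (tick t \<sigma>) = mem \<sigma>" "drawn (tick t \<sigma>) = drawn \<sigma>"
  "time (tick t \<sigma>) = time \<sigma> + t"
  by (simp_all add: tick_def)

lemma tick_tick: "tick t (tick t' \<sigma>) = tick (t' + t) \<sigma>"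
  by (simp add: tick_def)

definition goto :: "nat \<Rightarrow> (nat \<Rightarrow> nat) \<Rightarrow> (nat \<Rightarrow> nat) \<Rightarrow> state \<Rightarrow> state" where
  "goto t R M \<sigma> = tick t (\<sigma>\<lparr>reg := R, mem := M\<rparr>)"

lemma goto_simps [simp]:
  "reg (goto t R M \<sigma>) = R" "mem (goto t R M \<sigma>) = M" "drawn (goto t R M \<sigma>) = drawn \<sigma>"
  "time (goto t R M \<sigma>) = time \<sigma> + t"
  by (simp_all add: goto_def)

lemma goto_goto [simp]: "goto t R M (goto t' R' M' \<sigma>) = goto (t' + t) R M \<sigma>"
  and tick_goto [simp]: "tick t (goto t' R M \<sigma>) = goto (t' + t) R M \<sigma>"
  and goto_tick [simp]: "goto t R M (tick t' \<sigma>) = goto (t' + t) R M \<sigma>"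
  by (simp_all add: goto_def tick_def)

lemma goto_self: "reg \<sigma> = R \<Longrightarrow> mem \<sigma> = M \<Longrightarrow> goto t R M \<sigma> = tick t \<sigma>"
  by (simp add: goto_def tick_def)

lemma goto_reg: "mem \<sigma> = M \<Longrightarrow> goto t R M \<sigma> = tick t (\<sigma>\<lparr>reg := R\<rparr>)"
  and goto_mem: "reg \<sigma> = R \<Longrightarrow> goto t R M \<sigma> = tick t (\<sigma>\<lparr>mem := M\<rparr>)"
  by (cases \<sigma>, simp add: goto_def tick_def)+

lemma halted_return [simp]: "halted (return_pmf (Skip, \<sigma>))"
  by (simp add: halted_def)

lemma ex_small: "ex H c R M t R' M' \<Longrightarrow> small H R M \<Longrightarrow> small H R' M'"
  by (induction rule: ex.induct) (auto simp: small_def)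

text \<open>The execution time itself serves as the number of steps: each step costs at least one
  unit, and surplus steps change nothing after halting.\<close>

lemma ex_run:
  assumes "ex H c R M t R' M'" "small H R M" "fits H d c" "2 \<le> H" "H ^ d < 2 ^ w"
    and "reg \<sigma> = R" "mem \<sigma> = M"
  shows "run t w D c \<sigma> = return_pmf (Skip, goto t R' M' \<sigma>)"
  using assms
proof (induction arbitrary: \<sigma> rule: ex.induct)
  case (Skip R M)
  then show ?case by (simp add: goto_self tick_def)
next
  case (Assign R M e r)
  then show ?case
    using exp_val_eq_uval[OF Assign.prems(1,3,4), of e \<sigma>]
    by (simp add: run_Skip run_Suc bind_return_pmf goto_reg fun_upd_def)
next
  case (Store R M e a)
  then show ?case
    using exp_val_eq_uval[OF Store.prems(1,3,4), of e \<sigma>] exp_val_eq_uval[OF Store.prems(1,3,4), of a \<sigma>]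
    by (simp add: run_Skip run_Suc bind_return_pmf goto_mem fun_upd_def)
next
  case (Seq c1 R M t1 R1 M1 c2 t2 R2 M2)
  have s: "small H R1 M1" using ex_small Seq by blast
  have 1: "run t1 w D c1 \<sigma> = return_pmf (Skip, goto t1 R1 M1 \<sigma>)"
    using Seq by auto
  have 2: "run t2 w D c2 (tick 1 (goto t1 R1 M1 \<sigma>)) = return_pmf (Skip, goto t2 R2 M2 (tick 1 (goto t1 R1 M1 \<sigma>)))"
    using Seq s by (intro Seq.IH(2)) auto
  show ?case
    using run_Seq[of t1 w D c1 \<sigma> t2 c2] 1 2 by (simp add: bind_return_pmf ac_simps)
next
  case (IfT R M e c1 t R1 M1 c2)
  have e: "exp_val w \<sigma> e \<noteq> 0" using exp_val_eq_uval[OF IfT.prems(1,3,4), of e \<sigma>] IfT by simp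
  have "run t w D c1 (tick (1 + exp_cost e) \<sigma>) = return_pmf (Skip, goto t R1 M1 (tick (1 + exp_cost e) \<sigma>))"
    using IfT by (intro IfT.IH) auto
  then have "run (Suc t) w D (If e c1 c2) \<sigma> = return_pmf (Skip, goto (1 + exp_cost e + t) R1 M1 \<sigma>)"
    unfolding run_If using e by simp
  then show ?case using run_mono[of "Suc t" w D _ \<sigma> "1 + exp_cost e + t"] by simp
next
  case (IfF R M e c2 t R1 M1 c1)
  have e: "exp_val w \<sigma> e = 0" using exp_val_eq_uval[OF IfF.prems(1,3,4), of e \<sigma>] IfF by simp
  have "run t w D c2 (tick (1 + exp_cost e) \<sigma>) = return_pmf (Skip, goto t R1 M1 (tick (1 + exp_cost e) \<sigma>))"
    using IfF by (intro IfF.IH) auto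
  then have "run (Suc t) w D (If e c1 c2) \<sigma> = return_pmf (Skip, goto (1 + exp_cost e + t) R1 M1 \<sigma>)"
    unfolding run_If using e by simp
  then show ?case using run_mono[of "Suc t" w D _ \<sigma> "1 + exp_cost e + t"] by simp
next
  case (WhileT R M e c t1 R1 M1 t2 R2 M2)
  have e: "exp_val w (tick 1 \<sigma>) e \<noteq> 0"
    using exp_val_eq_uval[OF WhileT.prems(1,3,4), of e "tick 1 \<sigma>"] WhileT by simp
  define \<sigma>1 where "\<sigma>1 = tick (2 + exp_cost e) \<sigma>"
  have s: "small H R1 M1" using ex_small WhileT by blast
  have 1: "run t1 w D c \<sigma>1 = return_pmf (Skip, goto t1 R1 M1 \<sigma>1)"
    using WhileT by (intro WhileT.IH) (auto simp: \<sigma>1_def)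
  have 2: "run t2 w D (While e c) (tick 1 (goto t1 R1 M1 \<sigma>1)) =
      return_pmf (Skip, goto t2 R2 M2 (tick 1 (goto t1 R1 M1 \<sigma>1)))"
    using WhileT s by (intro WhileT.IH(2)) auto
  have "run (t1 + t2 + 1) w D (Seq c (While e c)) \<sigma>1 = return_pmf (Skip, goto (t1 + t2 + 1) R2 M2 \<sigma>1)"
    using run_Seq[of t1 w D c \<sigma>1 t2 "While e c"] 1 2 by (simp add: bind_return_pmf ac_simps)
  then have "run (Suc (Suc (t1 + t2 + 1))) w D (While e c) \<sigma> =
      return_pmf (Skip, goto (3 + exp_cost e + t1 + t2) R2 M2 \<sigma>)"
    unfolding run_While run_If using e by (simp add: tick_tick \<sigma>1_def ac_simps)
  then show ?case
    using run_mono[of "Suc (Suc (t1 + t2 + 1))" w D _ \<sigma> "3 + exp_cost e + t1 + t2"] by simp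
next
  case (WhileF R M e c)
  have e: "exp_val w (tick 1 \<sigma>) e = 0"
    using exp_val_eq_uval[OF WhileF.prems(1,3,4), of e "tick 1 \<sigma>"] WhileF by simp
  have "run (Suc (Suc 0)) w D (While e c) \<sigma> = return_pmf (Skip, goto (2 + exp_cost e) R M \<sigma>)"
    unfolding run_While run_If using e WhileF by (simp add: tick_tick goto_self)
  then show ?case
    using run_mono[of "Suc (Suc 0)" w D _ \<sigma> "2 + exp_cost e"] by simp
qed

section \<open>Arrays, frames and weakest preconditions\<close>

fun wr :: "com \<Rightarrow> nat set" where
  "wr Skip = {}"
| "wr (Assign r e) = {r}"
| "wr (Store a e) = {}"
| "wr (Coin r) = {r}"
| "wr (Draw a) = {}"
| "wr (Seq c1 c2) = wr c1 \<union> wr c2"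
| "wr (If e c1 c2) = wr c1 \<union> wr c2"
| "wr (While e c) = wr c"

text \<open>Sixteen interleaved arrays live above the address in variable \<open>9\<close>; cell \<open>i\<close> of array \<open>a\<close> is
  \<open>ad B a i\<close>. Interleaving makes arrays disjoint without any bound on the indices.\<close>

definition ad :: "nat \<Rightarrow> nat \<Rightarrow> nat \<Rightarrow> nat" where
  "ad B a i = B + (16 * i + a)"

lemma ad_eq_iff [simp]: "a < 16 \<Longrightarrow> a' < 16 \<Longrightarrow> ad B a i = ad B a' i' \<longleftrightarrow> a = a' \<and> i = i'"
proof -
  assume "a < 16" "a' < 16"
  then have "(16 * i + a) div 16 = i" "(16 * i + a) mod 16 = a"
      "(16 * i' + a') div 16 = i'" "(16 * i' + a') mod 16 = a'"
    by auto
  then show ?thesis unfolding ad_def by (metis add_left_cancel)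
qed

lemma le_ad: "B \<le> ad B a i"
  by (simp add: ad_def)

lemma less_neq_ad [simp]: "x < B \<Longrightarrow> x \<noteq> ad B a i" "x < B \<Longrightarrow> ad B a i \<noteq> x"
  by (simp_all add: ad_def)

definition AD :: "nat \<Rightarrow> exp \<Rightarrow> exp" where
  "AD a e = Bin Add (Var 9) (Bin Add (Bin Mult (Lit 16) e) (Lit a))"

abbreviation "Rd a e \<equiv> Mem (AD a e)"

definition Wr :: "nat \<Rightarrow> exp \<Rightarrow> exp \<Rightarrow> com" where
  "Wr a i e = Store (AD a i) e"

lemma uval_AD [simp]: "uval R M (AD a e) = ad (R 9) a (uval R M e)"
  by (simp add: AD_def ad_def)

lemma AD_eq_iff [simp]: "AD a i = AD a' i' \<longleftrightarrow> a = a' \<and> i = i'"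
  by (auto simp: AD_def)

text \<open>The array is read off from the syntax of the address, so framing never evaluates an
  index.\<close>

fun sa :: "com \<Rightarrow> nat set" where
  "sa (Store x e) = {a. \<exists>i. x = AD a i}"
| "sa (Seq c1 c2) = sa c1 \<union> sa c2"
| "sa (If e c1 c2) = sa c1 \<union> sa c2"
| "sa (While e c) = sa c"
| "sa _ = {}"

text \<open>Variable 9 holds the base address; assigning to it would move all arrays at
  once.\<close>

fun array_only :: "com \<Rightarrow> bool" where
  "array_only (Store x e) = (\<exists>a i. x = AD a i)"
| "array_only (Seq c1 c2) = (array_only c1 \<and> array_only c2)"
| "array_only (If e c1 c2) = (array_only c1 \<and> array_only c2)"
| "array_only (While e c) = array_only c"
| "array_only (Assign r e) = (r \<noteq> 9)"
| "array_only (Coin r) = (r \<noteq> 9)"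
| "array_only _ = True"

lemma sa_Wr [simp]: "sa (Wr a i e) = {a}"
  and array_only_Wr [simp]: "array_only (Wr a i e)"
  and wr_Wr [simp]: "wr (Wr a i e) = {}"
  by (simp_all add: Wr_def)

definition frame :: "nat \<Rightarrow> nat set \<Rightarrow> nat set \<Rightarrow> (nat \<Rightarrow> nat) \<Rightarrow> (nat \<Rightarrow> nat) \<Rightarrow>
    (nat \<Rightarrow> nat) \<Rightarrow> (nat \<Rightarrow> nat) \<Rightarrow> bool" where
  "frame B V A R M R' M' \<longleftrightarrow>
     (\<forall>r. r \<notin> V \<longrightarrow> R' r = R r) \<and> (\<forall>x. (\<forall>a \<in> A. \<forall>i. x \<noteq> ad B a i) \<longrightarrow> M' x = M x)"

lemma frame_trans:
  assumes "frame B V A R M R' M'" "frame B V' A' R' M' R'' M''"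
  shows "frame B (V \<union> V') (A \<union> A') R M R'' M''"
  using assms by (simp add: frame_def)

lemma array_only_wr: "array_only c \<Longrightarrow> 9 \<notin> wr c"
  by (induction c rule: array_only.induct) auto

lemma ex_reg9: "ex H c R M t R' M' \<Longrightarrow> array_only c \<Longrightarrow> R' 9 = R 9"
  by (induction rule: ex.induct) auto

lemma ex_frame:
  assumes "ex H c R M t R' M'" "array_only c"
  shows "frame (R 9) (wr c) (sa c) R M R' M'"
  using assms
proof (induction rule: ex.induct)
  case (Store R M e a)
  then show ?case
    by (auto simp: frame_def)
next
  case (Seq c1 R M t1 R1 M1 c2 t2 R2 M2)
  then show ?case
    using frame_trans[of "R 9" "wr c1" "sa c1" R M R1 M1 "wr c2" "sa c2" R2 M2] ex_reg9[OF Seq.hyps(1)]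
    by simp
next
  case (WhileT R M e c t1 R1 M1 t2 R2 M2)
  then show ?case
    using frame_trans[of "R 9" "wr c" "sa c" R M R1 M1 "wr c" "sa c" R2 M2] ex_reg9[OF WhileT.hyps(2)]
    by simp
qed (auto simp: frame_def)

definition wp :: "nat \<Rightarrow> nat \<Rightarrow> com \<Rightarrow> ((nat \<Rightarrow> nat) \<Rightarrow> (nat \<Rightarrow> nat) \<Rightarrow> bool) \<Rightarrow>
    (nat \<Rightarrow> nat) \<Rightarrow> (nat \<Rightarrow> nat) \<Rightarrow> bool" where
  "wp H t c Q R M \<longleftrightarrow> (\<exists>t' R' M'. ex H c R M t' R' M' \<and> t' \<le> t \<and> Q R' M')"

lemma wp_mono:
  assumes "wp H t c Q R M" "t \<le> t'" "\<And>R' M'. Q R' M' \<Longrightarrow> Q' R' M'"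
  shows "wp H t' c Q' R M"
  using assms unfolding wp_def by (meson order.trans)

lemma wp_frame:
  assumes "wp H t c Q R M" "array_only c"
  shows "wp H t c (\<lambda>R' M'. Q R' M' \<and> frame (R 9) (wr c) (sa c) R M R' M') R M"
  using assms ex_frame unfolding wp_def by blast

lemma wp_Skip: "Q R M \<Longrightarrow> wp H t Skip Q R M"
  unfolding wp_def using ex.Skip by blast

lemma wp_Assign:
  "uval R M e \<le> H \<Longrightarrow> Q (R(r := uval R M e)) M \<Longrightarrow> 1 + exp_cost e \<le> t \<Longrightarrow> wp H t (Assign r e) Q R M"
  unfolding wp_def using ex.Assign by blast

lemma wp_Store:
  "uval R M e \<le> H \<Longrightarrow> Q R (M(uval R M a := uval R M e)) \<Longrightarrow> 1 + exp_cost a + exp_cost e \<le> t \<Longrightarrow>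
    wp H t (Store a e) Q R M"
  unfolding wp_def using ex.Store by blast

lemma wp_Seq:
  assumes "wp H t1 c1 (wp H t2 c2 Q) R M" "t1 + t2 + 1 \<le> t"
  shows "wp H t (Seq c1 c2) Q R M"
proof -
  obtain t1' R1 M1 t2' R2 M2 where "ex H c1 R M t1' R1 M1" "t1' \<le> t1"
      "ex H c2 R1 M1 t2' R2 M2" "t2' \<le> t2" "Q R2 M2"
    using assms(1) unfolding wp_def by blast
  moreover have "t1' + t2' + 1 \<le> t" using calculation assms(2) by linarith
  ultimately show ?thesis unfolding wp_def using ex.Seq by blast
qed

lemma wp_If:
  assumes "uval R M e \<noteq> 0 \<Longrightarrow> wp H t1 c1 Q R M" "uval R M e = 0 \<Longrightarrow> wp H t1 c2 Q R M"
    and "1 + exp_cost e + t1 \<le> t"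
  shows "wp H t (If e c1 c2) Q R M"
proof (cases "uval R M e = 0")
  case True
  then obtain t' R' M' where "ex H c2 R M t' R' M'" "t' \<le> t1" "Q R' M'"
    using assms(2) unfolding wp_def by blast
  moreover have "1 + exp_cost e + t' \<le> t" using calculation assms(3) by linarith
  ultimately show ?thesis unfolding wp_def using ex.IfF[OF True] by blast
next
  case False
  then obtain t' R' M' where "ex H c1 R M t' R' M'" "t' \<le> t1" "Q R' M'"
    using assms(1) unfolding wp_def by blast
  moreover have "1 + exp_cost e + t' \<le> t" using calculation assms(3) by linarith
  ultimately show ?thesis unfolding wp_def using ex.IfT[OF False] by blast
qed

lemma wp_While:
  assumes "I 0 R M"
    and step: "\<And>i R' M'. i < m \<Longrightarrow> I i R' M' \<Longrightarrow> uval R' M' e \<noteq> 0 \<and> wp H t c (I (Suc i)) R' M'"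
    and exit: "\<And>R' M'. I m R' M' \<Longrightarrow> uval R' M' e = 0"
    and time: "m * (3 + exp_cost e + t) + 2 + exp_cost e \<le> T"
  shows "wp H T (While e c) (I m) R M"
proof -
  \<comment> \<open>Induction on the number \<open>d\<close> of rounds still to come.\<close>
  have "wp H (d * (3 + exp_cost e + t) + 2 + exp_cost e) (While e c) (I m) R' M'"
    if "d \<le> m" "I (m - d) R' M'" for d R' M'
    using that
  proof (induction d arbitrary: R' M')
    case 0
    then have "ex H (While e c) R' M' (2 + exp_cost e) R' M'" using exit ex.WhileF by simp
    then show ?case using 0 unfolding wp_def by auto
  next
    case (Suc d)
    then have s: "Suc (m - Suc d) = m - d" by simp
    obtain t1 R1 M1 where 1: "uval R' M' e \<noteq> 0" "ex H c R' M' t1 R1 M1" "t1 \<le> t" "I (m - d) R1 M1"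
      using step[of "m - Suc d" R' M'] Suc.prems unfolding wp_def s by auto
    then obtain t2 R2 M2 where 2: "ex H (While e c) R1 M1 t2 R2 M2"
        "t2 \<le> d * (3 + exp_cost e + t) + 2 + exp_cost e" "I m R2 M2"
      using Suc.IH[of R1 M1] Suc.prems unfolding wp_def by auto
    have "3 + exp_cost e + t1 + t2 \<le> Suc d * (3 + exp_cost e + t) + 2 + exp_cost e"
      using 1 2 by simp
    then show ?case using ex.WhileT[OF 1(1,2) 2(1)] 2(3) unfolding wp_def by blast
  qed
  from this[of m R M] show ?thesis using assms(1) time
    by (auto elim: wp_mono)
qed

definition For :: "nat \<Rightarrow> exp \<Rightarrow> com \<Rightarrow> com" where
  "For r e c = Seq (Assign r (Lit 0))
     (While (Bin Less (Var r) e) (Seq c (Assign r (Bin Add (Var r) (Lit 1)))))"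

lemma wr_For [simp]: "wr (For r e c) = insert r (wr c)"
  and sa_For [simp]: "sa (For r e c) = sa c"
  and array_only_For [simp]: "array_only (For r e c) \<longleftrightarrow> r \<noteq> 9 \<and> array_only c"
  by (auto simp: For_def)

text \<open>The frame of the body travels along with \<open>I\<close>, so an invariant only mentions
  what the body really changes. The bound \<open>e\<close> is evaluated anew in each round, hence
  \<open>bd\<close> for every intermediate state.\<close>

lemma wp_For_time:
  assumes ao: "array_only (For r e c)" and r: "r \<notin> wr c"
    and I0: "I 0 (R(r := 0)) M"
    and step: "\<And>i R' M'. i < m \<Longrightarrow> frame (R 9) (insert r (wr c)) (sa c) R M R' M' \<Longrightarrow> R' r = i \<Longrightarrow>
      I i R' M' \<Longrightarrow> wp H t c (\<lambda>R'' M''. I (Suc i) (R''(r := Suc i)) M'') R' M'"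
    and bd: "\<And>i R' M'. i \<le> m \<Longrightarrow> frame (R 9) (insert r (wr c)) (sa c) R M R' M' \<Longrightarrow> R' r = i \<Longrightarrow>
      I i R' M' \<Longrightarrow> uval R' M' e = m"
    and m: "m \<le> H"
    and Q: "\<And>R' M'. frame (R 9) (insert r (wr c)) (sa c) R M R' M' \<Longrightarrow> R' r = m \<Longrightarrow> I m R' M' \<Longrightarrow> Q R' M'"
    and time: "m * (10 + exp_cost e + t) + 7 + exp_cost e \<le> T"
  shows "wp H T (For r e c) Q R M"
proof -
  let ?F = "frame (R 9) (insert r (wr c)) (sa c) R M"
  define J where "J i R' M' \<longleftrightarrow> ?F R' M' \<and> R' r = i \<and> I i R' M'" for i R' M'
  have "wp H (t + 5) (Seq c (Assign r (Bin Add (Var r) (Lit 1)))) (J (Suc i)) R' M'"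
    if "i < m" and J: "J i R' M'" for i R' M'
  proof (rule wp_Seq)
    have eq: "R' 9 = R 9" using J ao array_only_wr by (auto simp: J_def frame_def)
    have "wp H t c (\<lambda>R'' M''. I (Suc i) (R''(r := Suc i)) M'' \<and> frame (R' 9) (wr c) (sa c) R' M' R'' M'') R' M'"
      using that ao by (intro wp_frame step) (auto simp: J_def)
    then show "wp H t c (wp H 4 (Assign r (Bin Add (Var r) (Lit 1))) (J (Suc i))) R' M'"
    proof (rule wp_mono)
      fix R'' M''
      assume *: "I (Suc i) (R''(r := Suc i)) M'' \<and> frame (R' 9) (wr c) (sa c) R' M' R'' M''"
      then have "R'' r = i" using J r by (auto simp: frame_def J_def)
      moreover have "?F (R''(r := Suc i)) M''" using * J unfolding frame_def J_def eq by auto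
      ultimately show "wp H 4 (Assign r (Bin Add (Var r) (Lit 1))) (J (Suc i)) R'' M''"
        using that m * by (intro wp_Assign) (auto simp: J_def)
    qed simp
  qed simp
  moreover have "uval R' M' (Bin Less (Var r) e) = of_bool (i < m)" if "J i R' M'" "i \<le> m" for i R' M'
    using bd[of i R' M'] that by (auto simp: J_def)
  moreover have "J 0 (R(r := 0)) M"
    using I0 by (auto simp: J_def frame_def)
  moreover have "m * (3 + exp_cost (Bin Less (Var r) e) + (t + 5)) + 2 + exp_cost (Bin Less (Var r) e)
      \<le> m * (10 + exp_cost e + t) + 4 + exp_cost e"
    by (simp add: algebra_simps)
  ultimately have "wp H (m * (10 + exp_cost e + t) + 4 + exp_cost e)
      (While (Bin Less (Var r) e) (Seq c (Assign r (Bin Add (Var r) (Lit 1))))) (J m) (R(r := 0)) M"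
    by (intro wp_While[where I = J]) (auto simp del: uval.simps)
  then have "wp H (m * (10 + exp_cost e + t) + 4 + exp_cost e)
      (While (Bin Less (Var r) e) (Seq c (Assign r (Bin Add (Var r) (Lit 1))))) Q (R(r := 0)) M"
    by (rule wp_mono) (auto simp: J_def Q)
  then show ?thesis
    unfolding For_def using time
    by (intro wp_Seq[where ?t1.0 = 2] wp_Assign) auto
qed

text \<open>A time bound under the promise that no loop makes more than \<open>U\<close> rounds.
  Adding the branches of \<open>If\<close> instead of taking their maximum keeps the bound a simple
  polynomial in \<open>U\<close>.\<close>

fun cost :: "nat \<Rightarrow> com \<Rightarrow> nat" where
  "cost U Skip = 0"
| "cost U (Assign r e) = 1 + exp_cost e"
| "cost U (Store a e) = 1 + exp_cost a + exp_cost e"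
| "cost U (Coin r) = 0"
| "cost U (Draw e) = 0"
| "cost U (Seq c1 c2) = cost U c1 + cost U c2 + 1"
| "cost U (If e c1 c2) = 1 + exp_cost e + (cost U c1 + cost U c2)"
| "cost U (While e c) = (U + 1) * (3 + exp_cost e + cost U c)"

fun loop_depth :: "com \<Rightarrow> nat" where
  "loop_depth (Seq c1 c2) = max (loop_depth c1) (loop_depth c2)"
| "loop_depth (If e c1 c2) = max (loop_depth c1) (loop_depth c2)"
| "loop_depth (While e c) = Suc (loop_depth c)"
| "loop_depth _ = 0"

text \<open>For a fixed command and \<open>U\<close> exponential in \<open>k\<close> this yields
  time \<open>2 ^ O(k)\<close> without evaluating any constant of the body of the search
  loop.\<close>

lemma cost_le: "cost U c \<le> cost 0 c * (U + 1) ^ loop_depth c"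
proof (induction c)
  case (Seq c1 c2)
  let ?m = "max (loop_depth c1) (loop_depth c2)"
  have "cost 0 c1 * (U + 1) ^ loop_depth c1 \<le> cost 0 c1 * (U + 1) ^ ?m"
       "cost 0 c2 * (U + 1) ^ loop_depth c2 \<le> cost 0 c2 * (U + 1) ^ ?m"
    by (auto intro!: mult_left_mono power_increasing simp del: max_def)
  moreover have "1 \<le> (U + 1) ^ ?m" by simp
  ultimately show ?case using Seq
    unfolding cost.simps loop_depth.simps add_mult_distrib by linarith
next
  case (If e c1 c2)
  let ?m = "max (loop_depth c1) (loop_depth c2)"
  have "cost 0 c1 * (U + 1) ^ loop_depth c1 \<le> cost 0 c1 * (U + 1) ^ ?m"
       "cost 0 c2 * (U + 1) ^ loop_depth c2 \<le> cost 0 c2 * (U + 1) ^ ?m"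
    by (auto intro!: mult_left_mono power_increasing simp del: max_def)
  moreover have "(1 + exp_cost e) * 1 \<le> (1 + exp_cost e) * (U + 1) ^ ?m" by (intro mult_left_mono) auto
  ultimately show ?case using If
    unfolding cost.simps loop_depth.simps add_mult_distrib by linarith
next
  case (While e c)
  have "(3 + exp_cost e) * 1 \<le> (3 + exp_cost e) * (U + 1) ^ loop_depth c" by (intro mult_left_mono) auto
  then have "3 + exp_cost e + cost U c \<le> (3 + exp_cost e + cost 0 c) * (U + 1) ^ loop_depth c"
    using While by (simp add: add_mult_distrib)
  then have "(U + 1) * (3 + exp_cost e + cost U c) \<le>
      (U + 1) * ((3 + exp_cost e + cost 0 c) * (U + 1) ^ loop_depth c)"
    by (rule mult_left_mono) simp
  then show ?case by (simp add: algebra_simps)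
qed auto

abbreviation "wpc U H c \<equiv> wp H (cost U c) c"

lemma wp_For:
  assumes "array_only (For r e c)" "r \<notin> wr c"
    and "I 0 (R(r := 0)) M"
    and "\<And>i R' M'. i < m \<Longrightarrow> frame (R 9) (insert r (wr c)) (sa c) R M R' M' \<Longrightarrow> R' r = i \<Longrightarrow>
      I i R' M' \<Longrightarrow> wpc U H c (\<lambda>R'' M''. I (Suc i) (R''(r := Suc i)) M'') R' M'"
    and "\<And>i R' M'. i \<le> m \<Longrightarrow> frame (R 9) (insert r (wr c)) (sa c) R M R' M' \<Longrightarrow> R' r = i \<Longrightarrow>
      I i R' M' \<Longrightarrow> uval R' M' e = m"
    and "m \<le> H" "m \<le> U"
    and "\<And>R' M'. frame (R 9) (insert r (wr c)) (sa c) R M R' M' \<Longrightarrow> R' r = m \<Longrightarrow> I m R' M' \<Longrightarrow> Q R' M'"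
  shows "wpc U H (For r e c) Q R M"
proof (rule wp_For_time[where m = m and t = "cost U c" and I = I])
  have "m * (10 + exp_cost e + cost U c) \<le> U * (10 + exp_cost e + cost U c)"
    using assms by (intro mult_right_mono) auto
  moreover have "cost U (For r e c) = U * (10 + exp_cost e + cost U c) + 13 + cost U c + exp_cost e"
    unfolding For_def by (simp add: algebra_simps)
  ultimately show "m * (10 + exp_cost e + cost U c) + 7 + exp_cost e \<le> cost U (For r e c)"
    by linarith
qed (use assms in auto)

lemma wpc_Seq: "wpc U H c1 (wpc U H c2 Q) R M \<Longrightarrow> wpc U H (Seq c1 c2) Q R M"
  by (rule wp_Seq) auto

lemma wpc_Assign:
  "uval R M e \<le> H \<Longrightarrow> Q (R(r := uval R M e)) M \<Longrightarrow> wpc U H (Assign r e) Q R M"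
  by (rule wp_Assign) auto

lemma wpc_Wr:
  "uval R M e \<le> H \<Longrightarrow> Q R (M(ad (R 9) a (uval R M i) := uval R M e)) \<Longrightarrow> wpc U H (Wr a i e) Q R M"
  unfolding Wr_def by (rule wp_Store) auto

lemma wpc_If:
  assumes "uval R M e \<noteq> 0 \<Longrightarrow> wpc U H c1 Q R M" "uval R M e = 0 \<Longrightarrow> wpc U H c2 Q R M"
  shows "wpc U H (If e c1 c2) Q R M"
  by (rule wp_If[where ?t1.0 = "cost U c1 + cost U c2"]) (auto intro: wp_mono assms)

lemma wpc_Skip: "Q R M \<Longrightarrow> wpc U H Skip Q R M"
  by (rule wp_Skip)

lemma wpc_mono:
  assumes "wpc U H c Q R M" "\<And>R' M'. Q R' M' \<Longrightarrow> Q' R' M'"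
  shows "wpc U H c Q' R M"
  using wp_mono[OF assms(1) order_refl assms(2)] .

text \<open>The standard way to compose specifications below: what a command establishes, together
  with what its syntax shows it cannot touch.\<close>

lemma wpc_use:
  assumes "wpc U H c Q R M" "array_only c"
    and "\<And>R' M'. Q R' M' \<Longrightarrow> frame (R 9) (wr c) (sa c) R M R' M' \<Longrightarrow> Q' R' M'"
  shows "wpc U H c Q' R M"
  using wp_mono[OF wp_frame[OF assms(1,2)] order_refl] assms(3) by blast

lemmas wpc_rules = wpc_Seq wpc_Assign wpc_Wr wpc_If wpc_Skip

section \<open>The program and the function it computes\<close>

text \<open>The binary number with digits \<open>f 0\<close>, ..., \<open>f (l - 1)\<close>, most
  significant digit first; with 0/1 digits it is a packed bit vector.\<close>

primrec horner :: "(nat \<Rightarrow> nat) \<Rightarrow> nat \<Rightarrow> nat" where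
  "horner f 0 = 0"
| "horner f (Suc l) = 2 * horner f l + f l"

definition xor_list :: "('a \<Rightarrow> nat) \<Rightarrow> 'a list \<Rightarrow> nat" where
  "xor_list f js = foldr (\<lambda>j. xor (f j)) js 0"

lemma xor_list_simps [simp]:
  "xor_list f [] = 0" "xor_list f (j # js) = xor (f j) (xor_list f js)"
  by (simp_all add: xor_list_def)

lemma xor_list_append [simp]: "xor_list f (js @ js') = xor (xor_list f js) (xor_list f js')"
  by (induction js) (simp_all add: xor.assoc)

type_synonym buckets = "nat \<Rightarrow> nat \<Rightarrow> nat list"

text \<open>The flag says that the list is still on its way. A merge takes the stored list out of
  its bucket, so no sample is ever used twice; this is what keeps the surviving sums
  disjoint.\<close>

definition insert_step :: "(nat \<Rightarrow> nat \<Rightarrow> nat) \<Rightarrow> nat \<Rightarrow>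
    buckets \<times> nat list \<times> bool \<Rightarrow> buckets \<times> nat list \<times> bool" where
  "insert_step val g s = (case s of (t, c, fl) \<Rightarrow>
     if fl then
       (let v = xor_list (\<lambda>j. val j g) c in
        if t g v = [] then (t(g := (t g)(v := c)), c, False)
        else (t(g := (t g)(v := [])), t g v @ c, True))
     else s)"

primrec inserted :: "(nat \<Rightarrow> nat \<Rightarrow> nat) \<Rightarrow> nat \<Rightarrow>
    buckets \<times> nat list \<times> bool \<Rightarrow> buckets \<times> nat list \<times> bool" where
  "inserted val 0 s = s"
| "inserted val (Suc g) s = insert_step val g (inserted val g s)"

text \<open>Streaming form of the elimination of Blum, Kalai and Wasserman: \<open>val j g\<close> is the \<open>g\<close>-th group of
  coordinates of sample \<open>j\<close>; a stored list stands for the sum of its samples, and two sums that agree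
  in group \<open>g\<close> (and vanish in the earlier groups) are merged and passed on to group \<open>g + 1\<close>.\<close>

primrec eliminated :: "nat \<Rightarrow> (nat \<Rightarrow> nat \<Rightarrow> nat) \<Rightarrow> nat \<Rightarrow> buckets \<times> nat list list" where
  "eliminated b val 0 = ((\<lambda>_ _. []), [])"
| "eliminated b val (Suc j) =
     (case inserted val b (fst (eliminated b val j), [j], True) of (t, c, fl) \<Rightarrow>
        (t, if fl then c # snd (eliminated b val j) else snd (eliminated b val j)))"

fun popcount :: "nat \<Rightarrow> nat" where
  "popcount v = (if v = 0 then 0 else popcount (v div 2) + v mod 2)"

declare popcount.simps [simp del]

abbreviation plus_exp (infixl "\<^bold>+" 65) where "a \<^bold>+ b \<equiv> Bin Add a b"
abbreviation minus_exp (infixl "\<^bold>-" 65) where "a \<^bold>- b \<equiv> Bin Sub a b"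
abbreviation times_exp (infixl "\<^bold>*" 70) where "a \<^bold>* b \<equiv> Bin Mult a b"
abbreviation less_exp (infix "\<^bold><" 50) where "a \<^bold>< b \<equiv> Bin Less a b"
abbreviation eq_exp (infix "\<^bold>=" 50) where "a \<^bold>= b \<equiv> Bin Eq a b"
abbreviation seq_com (infixr "\<^bold>;" 40) where "c \<^bold>; d \<equiv> Seq c d"
abbreviation assign_com (infix "\<^bold>:=" 45) where "r \<^bold>:= e \<equiv> Assign r e"

text \<open>Use of the arrays: 0 holds the table of population counts, 2 the indices of the selected blocks, 3 the
  packed labels corrected by the current candidate, 4 and 5 the current and the best candidate (entry
  \<open>i + 1\<close> for coordinate \<open>i\<close>, and \<open>0\<close> for none), 6 to 8 the occupancy, groups and labels of the buckets of the
  elimination, 9 the groups of the sum being inserted, and 10 the scoring samples packed by columns.\<close>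

definition PACK :: com where "PACK =
  (36 \<^bold>:= Lit 0 \<^bold>;
   For 35 (Var 1)
     (37 \<^bold>:= Rd 2 (Var 35) \<^bold>* Var 2 \<^bold>+ Var 34 \<^bold>;
      36 \<^bold>:= Var 36 \<^bold>+ Var 36 \<^bold>;
      If (Var 37 \<^bold>< Var 0)
        (If (Var 37 \<^bold>= Var 15) Skip
          (36 \<^bold>:= Var 36 \<^bold>+ Mem (Var 0 \<^bold>+ Var 33 \<^bold>* (Var 0 \<^bold>+ Lit 1) \<^bold>+ Var 37)))
        Skip))"

definition LOAD :: com where "LOAD =
  (For 34 (Var 2) (PACK \<^bold>; Wr 9 (Var 34) (Var 36)) \<^bold>;
   38 \<^bold>:= Mem (Var 0 \<^bold>+ Var 33 \<^bold>* (Var 0 \<^bold>+ Lit 1) \<^bold>+ Var 0))"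

text \<open>Variable 39 is the flag, 38 the label of the current sum, 41 the round and 40 the number
  \<open>g * 2 ^ k + v\<close> of the bucket. A bucket is emptied by clearing its occupancy
  alone.\<close>

definition INSERT_STEP :: com where "INSERT_STEP =
  If (Var 39)
    (40 \<^bold>:= Var 41 \<^bold>* Var 7 \<^bold>+ Rd 9 (Var 41) \<^bold>;
     If (Rd 6 (Var 40))
       (Wr 6 (Var 40) (Lit 0) \<^bold>;
        38 \<^bold>:= Bin Xor (Var 38) (Rd 8 (Var 40)) \<^bold>;
        For 42 (Var 2)
          (Wr 9 (Var 42) (Bin Xor (Rd 9 (Var 42)) (Rd 7 (Var 40 \<^bold>* Var 2 \<^bold>+ Var 42)))))
       (Wr 6 (Var 40) (Lit 1) \<^bold>;
        Wr 8 (Var 40) (Var 38) \<^bold>;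
        For 42 (Var 2) (Wr 7 (Var 40 \<^bold>* Var 2 \<^bold>+ Var 42) (Rd 9 (Var 42))) \<^bold>;
        39 \<^bold>:= Lit 0))
    Skip"

definition ELIM :: com where "ELIM =
  (For 30 (Var 2 \<^bold>* Var 7) (Wr 6 (Var 30) (Lit 0)) \<^bold>;
   31 \<^bold>:= Lit 0 \<^bold>;
   32 \<^bold>:= Lit 0 \<^bold>;
   For 33 (Var 5)
     (LOAD \<^bold>;
      39 \<^bold>:= Lit 1 \<^bold>;
      For 41 (Var 2) INSERT_STEP \<^bold>;
      If (Var 39) (31 \<^bold>:= Var 31 \<^bold>+ Lit 1 \<^bold>; 32 \<^bold>:= Var 32 \<^bold>+ Var 38) Skip))"

section \<open>Correctness of the code for the elimination\<close>

lemma frame_no_array: "frame B V {} R M R' M' \<Longrightarrow> M' = M"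
  by (auto simp: frame_def)

lemma horner_less: "(\<And>l. f l \<le> 1) \<Longrightarrow> horner f l < 2 ^ l"
proof (induction l)
  case (Suc l)
  have "f l \<le> 1" "horner f l < 2 ^ l" using Suc by auto
  then show ?case by simp
qed simp

lemma xor_less_power: "a < 2 ^ m \<Longrightarrow> b < 2 ^ m \<Longrightarrow> xor a b < (2::nat) ^ m"
  by (metis take_bit_nat_eq_self_iff take_bit_xor)

lemma xor_list_less_power: "(\<And>j. f j < 2 ^ m) \<Longrightarrow> xor_list f js < 2 ^ m"
  by (induction js) (auto intro: xor_less_power)

lemma xor_list_le1: "(\<And>j. f j \<le> 1) \<Longrightarrow> xor_list f js \<le> 1"
  using xor_list_less_power[of f 1 js] by (auto simp: less_2_cases_iff le_Suc_eq)

text \<open>The empty list encodes a free bucket, so the list on its way must never be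
  empty.\<close>

lemma inserted_nonempty:
  "fst (snd s) \<noteq> [] \<Longrightarrow> fst (snd (inserted val g s)) \<noteq> []"
proof (induction g)
  case (Suc g)
  then show ?case
    by (cases "inserted val g s") (auto simp: insert_step_def Let_def split: prod.splits if_splits)
qed simp

lemma length_eliminated: "length (snd (eliminated b val j)) \<le> j"
  by (induction j) (auto split: prod.splits)

lemma sum_list_le_length: "(\<And>x. f x \<le> 1) \<Longrightarrow> sum_list (map f xs) \<le> length (xs :: 'c list)"
  for f :: "'c \<Rightarrow> nat"
proof (induction xs)
  case (Cons x xs)
  then have "f x \<le> 1" "sum_list (map f xs) \<le> length xs" by auto
  then show ?case by simp
qed simp

text \<open>\<open>M\<close> samples are eliminated, \<open>r\<close> words of \<open>q\<close>
  samples each serve for scoring, and \<open>1 / D\<close> is the threshold for a bias.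
  \<open>H\<close> bounds the values and \<open>U\<close> the rounds of the loops inside the search.
  Neither \<open>n\<close> nor \<open>N\<close> is compared with \<open>U\<close>, which keeps the
  work per union independent of \<open>n\<close>.\<close>

locale lspn =
  fixes n k b N q r D M H U :: nat
  assumes b1: "1 \<le> b"
    and H2: "2 \<le> H" and nH: "n + 1 \<le> H" and NbH: "N * b \<le> H" and NH: "N \<le> H" and kH: "k \<le> H"
    and kpH: "b * 2 ^ k \<le> H" and rqH: "r * q + 1 \<le> H" and qpH: "2 ^ q \<le> H" and kbH: "k * b \<le> H"
    and BH: "n + (M + r * q) * (n + 1) \<le> H" and DH: "D \<le> H" and rH: "r \<le> H"
    and kU: "k \<le> U" and kpU: "b * 2 ^ k \<le> U" and MU: "M \<le> U" and rU: "r \<le> U" and kbU: "k * b \<le> U"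
begin

definition B :: nat where "B = n + (M + r * q) * (n + 1)"

lemma bH: "b \<le> H" and kp0H: "2 ^ k \<le> H" and bU: "b \<le> U"
proof -
  have "b * 1 \<le> b * 2 ^ k" by (intro mult_left_mono) auto
  then show "b \<le> H" "b \<le> U" using kpH kpU by linarith+
  have "1 * 2 ^ k \<le> b * 2 ^ k" using b1 by (intro mult_right_mono) auto
  then show "2 ^ k \<le> H" using kpH by linarith
qed

lemma MH: "M \<le> H"
proof -
  have "M * 1 \<le> (M + r * q) * (n + 1)" by (intro mult_mono) auto
  then show ?thesis using BH by linarith
qed

lemma addr_less: "j < M + r * q \<Longrightarrow> i \<le> n \<Longrightarrow> n + j * (n + 1) + i < B"
proof -
  assume "j < M + r * q" "i \<le> n"
  then have "Suc j * (n + 1) \<le> (M + r * q) * (n + 1)" by (intro mult_right_mono) auto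
  then show ?thesis using \<open>i \<le> n\<close> by (simp add: B_def)
qed

text \<open>Variables 0 to 9 stay constant after the setup. The first \<open>n\<close> cells are
  reserved for the answer; the samples follow in records of \<open>n + 1\<close> cells, and the
  arrays begin at \<open>B\<close>.\<close>

definition env :: "(nat \<Rightarrow> nat \<Rightarrow> nat) \<Rightarrow> (nat \<Rightarrow> nat) \<Rightarrow> (nat \<Rightarrow> nat) \<Rightarrow> bool" where
  "env X R m \<longleftrightarrow> (\<forall>j i. X j i \<le> 1) \<and>
     R 0 = n \<and> R 1 = k \<and> R 2 = b \<and> R 3 = N \<and> R 4 = q \<and> R 5 = M \<and> R 6 = D \<and> R 7 = 2 ^ k \<and>
     R 8 = r \<and> R 9 = B \<and> (\<forall>j < M + r * q. \<forall>i \<le> n. m (n + j * (n + 1) + i) = X j i)"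

lemma env_bit: "env X R m \<Longrightarrow> X j i \<le> 1"
  by (simp add: env_def)

lemma env_regs:
  assumes "env X R m"
  shows "R 0 = n" "R (Suc 0) = k" "R 1 = k" "R 2 = b" "R 3 = N" "R 4 = q" "R 5 = M" "R 6 = D" "R 7 = 2 ^ k"
    "R 8 = r" "R 9 = B"
  using assms by (auto simp: env_def)

lemma env_mem:
  "env X R m \<Longrightarrow> j < M + r * q \<Longrightarrow> i \<le> n \<Longrightarrow> m (n + j * (n + 1) + i) = X j i"
  by (simp add: env_def)

lemma env_frame:
  assumes "env X R m" "frame (R 9) V A R m R' m'" "V \<inter> {..9} = {}"
  shows "env X R' m'"
proof -
  have "R' x = R x" if "x \<le> 9" for x using assms that by (auto simp: frame_def)
  moreover have "m' x = m x" if "x < B" for x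
    using assms that by (auto simp: frame_def env_regs)
  ultimately show ?thesis
    using assms(1) addr_less unfolding env_def by auto
qed

lemma env_upd [simp]: "10 \<le> x \<Longrightarrow> env X (R(x := v)) m = env X R m"
  by (auto simp: env_def)

lemma env_upd_if [simp]: "10 \<le> x \<Longrightarrow> env X (\<lambda>y. if y = x then v else R y) m = env X R m"
  by (auto simp: env_def)

lemma env_upd_mem [simp]: "env X R (m(ad B a i := v)) = env X R m"
proof -
  have "n + j * (n + 1) + i' \<noteq> ad B a i" if "j < M + r * q" "i' \<le> n" for i' j
    using addr_less[OF that] by simp
  then show ?thesis by (auto simp: env_def)
qed

text \<open>The group by which round \<open>h\<close> buckets a sample: digit \<open>l\<close> is
  the coordinate at offset \<open>h\<close> of the \<open>l\<close>-th selected block. The last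
  block may stick out beyond \<open>n\<close>, and coordinate \<open>i\<close> is hidden from the
  elimination; both count as 0.\<close>

definition pk :: "(nat \<Rightarrow> nat) \<Rightarrow> nat \<Rightarrow> (nat \<Rightarrow> nat) \<Rightarrow> nat \<Rightarrow> nat" where
  "pk u i x h =
     horner (\<lambda>l. if u l * b + h < n \<and> u l * b + h \<noteq> i then x (u l * b + h) else 0) k"

lemma pk_less: "(\<And>i. x i \<le> 1) \<Longrightarrow> pk u i x h < 2 ^ k"
  unfolding pk_def by (rule horner_less) auto

definition sel :: "(nat \<Rightarrow> nat) \<Rightarrow> (nat \<Rightarrow> nat) \<Rightarrow> bool" where
  "sel u m \<longleftrightarrow> (\<forall>l < k. m (ad B 2 l) = u l \<and> u l < N)"

lemma sel_frame:
  "sel u m \<Longrightarrow> frame (R 9) V A R m R' m' \<Longrightarrow> env X R m \<Longrightarrow> A \<subseteq> {0..<16} - {2} \<Longrightarrow> sel u m'"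
  by (auto simp: sel_def frame_def subset_eq env_regs)

lemma sel_upd [simp]: "a < 16 \<Longrightarrow> a \<noteq> 2 \<Longrightarrow> sel u (m(ad B a i := v)) = sel u m"
  by (auto simp: sel_def)

lemma crd_less: "v < N \<Longrightarrow> h < b \<Longrightarrow> v * b + h < N * b"
proof -
  assume "v < N" "h < b"
  then have "Suc v * b \<le> N * b" by (intro mult_right_mono) auto
  then show ?thesis using \<open>h < b\<close> by simp
qed

lemma wp_PACK:
  assumes e: "env X R m" and s: "sel u m" and "R 15 = i" "R 33 = j" "j < M" "R 34 = h" "h < b"
  shows "wpc U H PACK (\<lambda>R' m'. R' 36 = pk u i (X j) h) R m"
proof -
  let ?f = "\<lambda>l. if u l * b + h < n \<and> u l * b + h \<noteq> i then X j (u l * b + h) else 0"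
  have less: "horner ?f l < 2 ^ l" for l
    using env_bit[OF e] by (intro horner_less) auto
  have lek: "2 * horner ?f l + ?f l \<le> H" if "l < k" for l
  proof -
    have "horner ?f (Suc l) < 2 ^ Suc l" by (rule less)
    also have "\<dots> \<le> 2 ^ k" using that by (intro power_increasing) auto
    finally show ?thesis using kp0H by simp
  qed
  show ?thesis
    unfolding PACK_def
  proof (intro wpc_Seq wpc_Assign,
      simp, rule wp_For[where m = k and I = "\<lambda>l R' m'. m' = m \<and> R' 36 = horner ?f l"], goal_cases)
    case (4 l R' m')
    have e': "env X R' m'" by (rule env_frame[OF _ 4(2)]) (use e in auto)
    have R': "R' 15 = i" "R' 33 = j" "R' 34 = h" "m' = m" "R' 36 = horner ?f l" "R' 35 = l"
      using 4 assms by (auto simp: frame_def)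
    have m: "m (ad B 2 l) = u l" "u l < N" using s 4(1) by (auto simp: sel_def)
    have c: "u l * b + h \<le> H" using crd_less[OF m(2) \<open>h < b\<close>] NbH by simp
    show ?case
      using lek[OF 4(1)] c env_mem[OF e', of j "u l * b + h"] \<open>j < M\<close>
      by (intro wpc_rules) (auto simp: env_regs[OF e'] R' m split: if_splits)
  qed (use env_regs[OF e] kH kU in \<open>auto simp: frame_def pk_def\<close>)
qed

lemma wp_LOAD:
  assumes e: "env X R m" and s: "sel u m" and "R 15 = i" "R 33 = j" "j < M"
  shows "wpc U H LOAD (\<lambda>R' m'. (\<forall>h < b. m' (ad B 9 h) = pk u i (X j) h) \<and> R' 38 = X j n) R m"
proof -
  have pkH: "pk u i (X j) h \<le> H" for h
    using pk_less[of "X j" u i h] env_bit[OF e] kp0H by (auto intro: order.trans less_imp_le)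
  show ?thesis
    unfolding LOAD_def
  proof (rule wpc_Seq, rule wp_For[where m = b and I = "\<lambda>x R' m'. \<forall>h < x. m' (ad B 9 h) = pk u i (X j) h"],
      goal_cases)
    case (4 h R' m')
    have e': "env X R' m'" by (rule env_frame[OF _ 4(2)]) (use e in \<open>auto simp: PACK_def\<close>)
    have s': "sel u m'" by (rule sel_frame[OF _ 4(2)]) (use e s in \<open>auto simp: PACK_def\<close>)
    have R': "R' 15 = i" "R' 33 = j" "R' 34 = h"
      using 4 assms by (auto simp: frame_def PACK_def)
    show ?case
    proof (rule wpc_Seq, rule wpc_use[OF wp_PACK[OF e' s' R'(1,2) \<open>j < M\<close> R'(3)]], goal_cases)
      case (3 R'' m'')
      have e'': "env X R'' m''" by (rule env_frame[OF _ 3(2)]) (use e' in \<open>auto simp: PACK_def\<close>)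
      have m'': "m'' = m'" and h: "R'' 34 = h" using 3(2) R' by (auto simp: PACK_def frame_def)
      show ?case
        by (intro wpc_rules) (use 4 3 pkH in \<open>auto simp: env_regs[OF e''] h m'' less_Suc_eq\<close>)
    qed (use 4 in \<open>auto simp: PACK_def\<close>)
  next
    case (8 R' m')
    have e': "env X R' m'" by (rule env_frame[OF _ 8(1)]) (use e in \<open>auto simp: PACK_def\<close>)
    have j: "R' 33 = j" using 8 assms by (auto simp: frame_def PACK_def)
    show ?case using env_mem[OF e', of j n] env_bit[OF e, of j n] H2 8 \<open>j < M\<close>
      by (intro wpc_rules) (auto simp: env_regs[OF e'] j)
  qed (use env_regs[OF e] bH bU in \<open>auto simp: frame_def PACK_def\<close>)
qed

text \<open>Labels and groups are prescribed for occupied buckets only, so clearing array 6 resets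
  the whole table.\<close>

definition table :: "(nat \<Rightarrow> nat \<Rightarrow> nat) \<Rightarrow> (nat \<Rightarrow> nat) \<Rightarrow> buckets \<Rightarrow> (nat \<Rightarrow> nat) \<Rightarrow> bool" where
  "table val lab t m \<longleftrightarrow> (\<forall>g < b. \<forall>v < 2 ^ k.
     m (ad B 6 (g * 2 ^ k + v)) = of_bool (t g v \<noteq> []) \<and>
     (t g v \<noteq> [] \<longrightarrow> m (ad B 8 (g * 2 ^ k + v)) = xor_list lab (t g v) \<and>
       (\<forall>h < b. m (ad B 7 ((g * 2 ^ k + v) * b + h)) = xor_list (\<lambda>j. val j h) (t g v))))"

lemma idx_eq [simp]:
  assumes "v < (K::nat)" "v' < K"
  shows "g * K + v = g' * K + v' \<longleftrightarrow> g = g' \<and> v = v'"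
proof -
  have "(g * K + v) div K = g" "(g' * K + v') div K = g'"
       "(g * K + v) mod K = v" "(g' * K + v') mod K = v'"
    using assms by auto
  then show ?thesis by metis
qed

lemma table_frame:
  "table val lab t m \<Longrightarrow> frame (R 9) V A R m R' m' \<Longrightarrow> env X R m \<Longrightarrow> A \<subseteq> {0..<16} - {6, 7, 8} \<Longrightarrow>
    table val lab t m'"
  by (auto simp: table_def frame_def subset_eq env_regs)

lemma idx_less: "g < b \<Longrightarrow> v < 2 ^ k \<Longrightarrow> g * 2 ^ k + v < b * 2 ^ k"
proof -
  assume "g < b" "v < 2 ^ k"
  then have "Suc g * 2 ^ k \<le> b * 2 ^ k" by (intro mult_right_mono) auto
  then show ?thesis using \<open>v < 2 ^ k\<close> by simp
qed

definition current :: "(nat \<Rightarrow> nat \<Rightarrow> nat) \<Rightarrow> (nat \<Rightarrow> nat) \<Rightarrow> nat list \<Rightarrow> bool \<Rightarrow>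
    (nat \<Rightarrow> nat) \<Rightarrow> (nat \<Rightarrow> nat) \<Rightarrow> bool" where
  "current val lab c fl R m \<longleftrightarrow> R 39 = of_bool fl \<and>
     (fl \<longrightarrow> R 38 = xor_list lab c \<and> (\<forall>h < b. m (ad B 9 h) = xor_list (\<lambda>j. val j h) c))"

lemma wp_SAVE:
  assumes e: "env X R m" and "R 40 = x" and w: "\<And>h. h < b \<Longrightarrow> m (ad B 9 h) = w h" "\<And>h. w h \<le> H"
  shows "wpc U H (For 42 (Var 2) (Wr 7 (Var 40 \<^bold>* Var 2 \<^bold>+ Var 42) (Rd 9 (Var 42))))
    (\<lambda>R' m'. \<forall>h < b. \<forall>y. m' (ad B 7 (y * b + h)) = (if y = x then w h else m (ad B 7 (y * b + h)))) R m"
proof (rule wp_For[where m = b and I = "\<lambda>a R' m'. \<forall>h < b. \<forall>y.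
    m' (ad B 7 (y * b + h)) = (if y = x \<and> h < a then w h else m (ad B 7 (y * b + h)))"], goal_cases)
  case (4 h R' m')
  have e': "env X R' m'" by (rule env_frame[OF _ 4(2)]) (use e in auto)
  have R': "R' 40 = x" "m' (ad B 9 h) = w h"
    using 4 assms by (auto simp: frame_def env_regs[OF e])
  show ?case
    by (intro wpc_rules) (use 4 w in \<open>auto simp: env_regs[OF e'] R'\<close>)
qed (use env_regs[OF e] bH bU in \<open>auto simp: frame_def\<close>)

lemma wp_MERGE:
  assumes e: "env X R m" and "R 40 = x" and w: "\<And>h. h < b \<Longrightarrow> m (ad B 9 h) = w h"
    "\<And>h. h < b \<Longrightarrow> m (ad B 7 (x * b + h)) = w' h" "\<And>h. xor (w h) (w' h) \<le> H"
  shows "wpc U H (For 42 (Var 2) (Wr 9 (Var 42) (Bin Xor (Rd 9 (Var 42)) (Rd 7 (Var 40 \<^bold>* Var 2 \<^bold>+ Var 42)))))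
    (\<lambda>R' m'. \<forall>h < b. m' (ad B 9 h) = xor (w h) (w' h)) R m"
proof (rule wp_For[where m = b and I = "\<lambda>a R' m'. \<forall>h < b.
    m' (ad B 9 h) = (if h < a then xor (w h) (w' h) else w h)"], goal_cases)
  case (4 h R' m')
  have e': "env X R' m'" by (rule env_frame[OF _ 4(2)]) (use e in auto)
  have R': "R' 40 = x" "m' (ad B 7 (x * b + h)) = w' h"
    using 4 assms by (auto simp: frame_def env_regs[OF e])
  show ?case
    by (intro wpc_rules) (use 4 w in \<open>auto simp: env_regs[OF e'] R'\<close>)
qed (use env_regs[OF e] bH bU w in \<open>auto simp: frame_def\<close>)

lemma wp_INSERT_STEP:
  assumes e: "env X R m"
    and val: "\<And>j g. val j g < 2 ^ k" and lab: "\<And>j. lab j \<le> 1"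
    and t: "table val lab t m" and c: "current val lab c fl R m" and g: "R 41 = g" "g < b"
    and cne: "c \<noteq> []" and st: "insert_step val g (t, c, fl) = (t', c', fl')"
  shows "wpc U H INSERT_STEP (\<lambda>R' m'. table val lab t' m' \<and> current val lab c' fl' R' m') R m"
proof (cases fl)
  case False
  then show ?thesis
    unfolding INSERT_STEP_def using t c st
    by (intro wpc_If wpc_Skip) (auto simp: current_def insert_step_def)
next
  case True
  define v where "v = xor_list (\<lambda>j. val j g) c"
  define x where "x = g * 2 ^ k + v"
  have xv: "xor_list (\<lambda>j. val j h) l < 2 ^ k" for h l using val by (rule xor_list_less_power)
  have v: "v < 2 ^ k" by (simp add: v_def xv)
  have xvH: "xor_list (\<lambda>j. val j h) l \<le> H" for h l using xv[of h l] kp0H by linarith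
  have xlH: "xor_list lab l \<le> 1" "xor_list lab l \<le> H" for l
    using xor_list_le1[of lab l] lab H2 by auto
  have xH: "x \<le> H" using idx_less[OF g(2) v] kpH by (simp add: x_def)
  have m9: "m (ad B 9 h) = xor_list (\<lambda>j. val j h) c" if "h < b" for h
    using c True that by (simp add: current_def)
  have R38: "R 38 = xor_list lab c" and R39: "R 39 = 1" using c True by (simp_all add: current_def)
  have m6: "m (ad B 6 x) = of_bool (t g v \<noteq> [])" using t g v by (auto simp: table_def x_def)
  let ?R = "R(40 := x)"
  have e0: "env X ?R m" using e by simp
  show ?thesis
  proof (cases "t g v = []")
    case empty: True
    have st': "t' = t(g := (t g)(v := c))" "c' = c" "fl' = False"
      using st True empty by (auto simp: insert_step_def v_def)
    let ?m = "m(ad B 6 x := 1, ad B 8 x := R 38)"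
    have em: "env X ?R ?m" using e by simp
    have tab: "table val lab t' m'"
      if post: "\<forall>h < b. \<forall>y. m' (ad B 7 (y * b + h)) =
          (if y = x then xor_list (\<lambda>j. val j h) c else ?m (ad B 7 (y * b + h)))"
        and F: "frame (?R 9) {42} {7} ?R ?m R' m'" for R' m'
    proof -
      have "m' (ad B a y) = ?m (ad B a y)" if "a = 6 \<or> a = 8" for a y
        using F that by (auto simp: frame_def env_regs[OF e])
      then show ?thesis
        using t post v cne unfolding table_def st' by (auto simp: x_def R38)
    qed
    have "wpc U H (Wr 6 (Var 40) (Lit 1) \<^bold>; Wr 8 (Var 40) (Var 38) \<^bold>;
        For 42 (Var 2) (Wr 7 (Var 40 \<^bold>* Var 2 \<^bold>+ Var 42) (Rd 9 (Var 42))) \<^bold>; 39 \<^bold>:= Lit 0)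
      (\<lambda>R' m'. table val lab t' m' \<and> current val lab c' fl' R' m') ?R m"
    proof (rule wpc_Seq, rule wpc_Wr, goal_cases)
      case 2
      show ?case
      proof (rule wpc_Seq, rule wpc_Wr, goal_cases)
        case 2
        have eq: "(m(ad (?R 9) 6 (uval ?R m (Var 40)) := uval ?R m (Lit 1)))
           (ad (?R 9) 8 (uval ?R (m(ad (?R 9) 6 (uval ?R m (Var 40)) := uval ?R m (Lit 1))) (Var 40)) :=
            uval ?R (m(ad (?R 9) 6 (uval ?R m (Var 40)) := uval ?R m (Lit 1))) (Var 38)) = ?m"
          by (simp add: env_regs[OF e])
        show ?case unfolding eq
        proof (rule wpc_Seq, rule wpc_use[OF wp_SAVE[OF em, where x = x and w = "\<lambda>h. xor_list (\<lambda>j. val j h) c"]],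
            goal_cases)
          case (5 R' m')
          have "table val lab t' m'" using 5 by (intro tab) auto
          then show ?case
            by (intro wpc_rules) (simp_all add: current_def st')
        qed (use m9 xvH in auto)
      qed (use R38 xlH H2 in auto)
    qed (use H2 in auto)
    then show ?thesis
      unfolding INSERT_STEP_def using R39 m6 empty xH
      by (intro wpc_If wpc_Seq[where ?c1.0 = "40 \<^bold>:= e" for e] wpc_Assign)
        (auto simp: env_regs[OF e] g m9 x_def v_def)
  next
    case ne: False
    have st': "t' = t(g := (t g)(v := []))" "c' = t g v @ c" "fl' = True"
      using st True ne by (auto simp: insert_step_def v_def Let_def)
    let ?R' = "?R(38 := xor (R 38) (xor_list lab (t g v)))" and ?m = "m(ad B 6 x := 0)"
    have em: "env X ?R' ?m" using e by simp
    have m7: "m (ad B 7 (x * b + h)) = xor_list (\<lambda>j. val j h) (t g v)" if "h < b" for h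
      using t g v that ne by (auto simp: table_def x_def)
    have m8: "m (ad B 8 x) = xor_list lab (t g v)"
      using t g v ne by (auto simp: table_def x_def)
    have xx: "xor (xor_list (\<lambda>j. val j h) c) (xor_list (\<lambda>j. val j h) l) \<le> H" for h l
      using xvH[of h "c @ l"] by simp
    have xl: "xor (xor_list lab c) (xor_list lab l) \<le> H" for l
      using xlH[of "c @ l"] by simp
    have res: "table val lab t' m' \<and> current val lab c' fl' R' m'"
      if post: "\<forall>h < b. m' (ad B 9 h) = xor (xor_list (\<lambda>j. val j h) c) (xor_list (\<lambda>j. val j h) (t g v))"
        and F: "frame (?R' 9) {42} {9} ?R' ?m R' m'" for R' m'
    proof -
      have "m' (ad B a y) = ?m (ad B a y)" if "a = 6 \<or> a = 7 \<or> a = 8" for a y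
        using F that by (auto simp: frame_def env_regs[OF e])
      moreover have "R' 38 = xor (xor_list lab c) (xor_list lab (t g v))" "R' 39 = 1"
        using F R38 R39 by (auto simp: frame_def)
      ultimately show ?thesis
        using t post v unfolding table_def current_def st' by (auto simp: x_def R38 xor.commute)
    qed
    have "wpc U H (Wr 6 (Var 40) (Lit 0) \<^bold>; 38 \<^bold>:= Bin Xor (Var 38) (Rd 8 (Var 40)) \<^bold>;
        For 42 (Var 2) (Wr 9 (Var 42) (Bin Xor (Rd 9 (Var 42)) (Rd 7 (Var 40 \<^bold>* Var 2 \<^bold>+ Var 42)))))
      (\<lambda>R' m'. table val lab t' m' \<and> current val lab c' fl' R' m') ?R m"
    proof (rule wpc_Seq, rule wpc_Wr, goal_cases)
      case 2
      show ?case
      proof (rule wpc_Seq, rule wpc_Assign, goal_cases)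
        case 2
        have eq: "m(ad (?R 9) 6 (uval ?R m (Var 40)) := uval ?R m (Lit 0)) = ?m"
            "?R(38 := uval ?R ?m (Bin Xor (Var 38) (Rd 8 (Var 40)))) = ?R'"
          by (simp_all add: env_regs[OF e] m8)
        show ?case unfolding eq
        proof (rule wpc_use[OF wp_MERGE[OF em, where x = x and w = "\<lambda>h. xor_list (\<lambda>j. val j h) c"
              and w' = "\<lambda>h. xor_list (\<lambda>j. val j h) (t g v)"]], goal_cases)
          case (6 R' m')
          then show ?case by (intro res) auto
        qed (use m9 m7 xx in auto)
      qed (use R38 xl in \<open>auto simp: env_regs[OF e] m8\<close>)
    qed (use H2 in auto)
    then show ?thesis
      unfolding INSERT_STEP_def using R39 m6 ne xH
      by (intro wpc_If wpc_Seq[where ?c1.0 = "40 \<^bold>:= e" for e] wpc_Assign)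
        (auto simp: env_regs[OF e] g m9 x_def v_def)
  qed
qed

lemma wp_INSERT:
  assumes e: "env X R m"
    and val: "\<And>j g. val j g < 2 ^ k" and lab: "\<And>j. lab j \<le> 1"
    and t: "table val lab t m" and c: "current val lab [j] True R m"
    and st: "inserted val b (t, [j], True) = (t', c', fl')"
  shows "wpc U H (For 41 (Var 2) INSERT_STEP)
    (\<lambda>R' m'. table val lab t' m' \<and> current val lab c' fl' R' m') R m"
proof (rule wp_For[where m = b and I = "\<lambda>g R' m'. case inserted val g (t, [j], True) of (t', c', fl') \<Rightarrow>
     table val lab t' m' \<and> current val lab c' fl' R' m'"], goal_cases)
  case (4 g R' m')
  have e': "env X R' m'" by (rule env_frame[OF _ 4(2)]) (use e in \<open>auto simp: INSERT_STEP_def\<close>)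
  obtain t1 c1 fl1 where 1: "inserted val g (t, [j], True) = (t1, c1, fl1)" by (metis prod_cases3)
  obtain t2 c2 fl2 where 2: "insert_step val g (t1, c1, fl1) = (t2, c2, fl2)" by (metis prod_cases3)
  have ne: "c1 \<noteq> []" using inserted_nonempty[of "(t, [j], True)" val g] 1 by simp
  have tc: "table val lab t1 m'" "current val lab c1 fl1 R' m'" using 4(4) by (simp_all add: 1)
  show ?case
    by (rule wpc_mono[OF wp_INSERT_STEP[OF e' val lab tc 4(3,1) ne 2]])
      (simp add: 1 2 current_def)
qed (use t c st in \<open>auto simp: INSERT_STEP_def current_def env_regs[OF e] bU bH frame_def\<close>)

lemma wp_ELIM:
  assumes e: "env X R m" and s: "sel u m" and i: "R 15 = i"
    and val: "val = (\<lambda>j. pk u i (X j))" and lab: "lab = (\<lambda>j. X j n)"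
  shows "wpc U H ELIM (\<lambda>R' m'. R' 31 = length (snd (eliminated b val M)) \<and>
     R' 32 = sum_list (map (xor_list lab) (snd (eliminated b val M)))) R m"
proof -
  let ?CLEAR = "For 30 (Var 2 \<^bold>* Var 7) (Wr 6 (Var 30) (Lit 0))"
  have vless: "\<And>j g. val j g < 2 ^ k" and lab1: "\<And>j. lab j \<le> 1"
    using env_bit[OF e] by (auto simp: val lab intro: pk_less)
  let ?cnt = "\<lambda>j. length (snd (eliminated b val j))"
  let ?z = "\<lambda>j. sum_list (map (xor_list lab) (snd (eliminated b val j)))"
  have z_le: "?z j \<le> ?cnt j" for j
    using xor_list_le1[of lab] lab1 by (intro sum_list_le_length) auto
  have clear: "wpc U H ?CLEAR (\<lambda>R' m'. \<forall>y < b * 2 ^ k. m' (ad B 6 y) = 0) R m"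
  proof (rule wp_For[where m = "b * 2 ^ k" and I = "\<lambda>x R' m'. \<forall>y < x. m' (ad B 6 y) = 0"], goal_cases)
    case (4 x R' m')
    have e': "env X R' m'" by (rule env_frame[OF _ 4(2)]) (use e in auto)
    show ?case by (intro wpc_rules) (use 4 in \<open>auto simp: env_regs[OF e'] less_Suc_eq\<close>)
  qed (use env_regs[OF e] kpH kpU in \<open>auto simp: frame_def\<close>)
  have main: "wpc U H (For 33 (Var 5)
     (LOAD \<^bold>; 39 \<^bold>:= Lit 1 \<^bold>; For 41 (Var 2) INSERT_STEP \<^bold>;
      If (Var 39) (31 \<^bold>:= Var 31 \<^bold>+ Lit 1 \<^bold>; 32 \<^bold>:= Var 32 \<^bold>+ Var 38) Skip))
      (\<lambda>R' m'. R' 31 = ?cnt M \<and> R' 32 = ?z M) R1 m1"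
    if e: "env X R1 m1" and s: "sel u m1" and i: "R1 15 = i"
      and t: "table val lab (\<lambda>_ _. []) m1" and R1: "R1 31 = 0" "R1 32 = 0" for R1 m1
  proof (rule wp_For[where m = M and I = "\<lambda>j R' m'. table val lab (fst (eliminated b val j)) m' \<and>
      R' 31 = ?cnt j \<and> R' 32 = ?z j"], goal_cases)
    case (4 j R' m')
    note defs = LOAD_def PACK_def INSERT_STEP_def
    have e': "env X R' m'" by (rule env_frame[OF _ 4(2)]) (use e in \<open>auto simp: defs\<close>)
    have s': "sel u m'" by (rule sel_frame[OF _ 4(2)]) (use e s in \<open>auto simp: defs\<close>)
    have R': "R' 15 = i" "R' 33 = j" using 4 i by (auto simp: frame_def defs)
    let ?t = "fst (eliminated b val j)"
    obtain t2 c2 fl2 where 2: "inserted val b (?t, [j], True) = (t2, c2, fl2)" by (metis prod_cases3)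
    show ?case
    proof (rule wpc_Seq, rule wpc_use[OF wp_LOAD[OF e' s' R' 4(1)]], goal_cases)
      case (2 R2 m2)
      have e2: "env X R2 m2" by (rule env_frame[OF _ 2(2)]) (use e' in \<open>auto simp: defs\<close>)
      have tab2: "table val lab ?t m2" by (rule table_frame[OF _ 2(2) e']) (use 4 in \<open>auto simp: defs\<close>)
      have R2: "R2 31 = ?cnt j" "R2 32 = ?z j" "R2 33 = j"
        using 2(2) 4 by (auto simp: frame_def defs)
      let ?R2 = "R2(39 := 1)"
      have cur: "current val lab [j] True ?R2 m2"
        using 2(1) by (auto simp: current_def val lab)
      show ?case
      proof (rule wpc_Seq, rule wpc_Assign, goal_cases)
        case 2
        have "env X ?R2 m2" using e2 by simp
        then have "wpc U H (For 41 (Var 2) INSERT_STEP)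
            (\<lambda>R' m'. table val lab t2 m' \<and> current val lab c2 fl2 R' m') ?R2 m2"
          using vless lab1 tab2 cur \<open>inserted val b (?t, [j], True) = (t2, c2, fl2)\<close> by (rule wp_INSERT)
        then have "wpc U H (For 41 (Var 2) INSERT_STEP) (wpc U H
            (If (Var 39) (31 \<^bold>:= Var 31 \<^bold>+ Lit 1 \<^bold>; 32 \<^bold>:= Var 32 \<^bold>+ Var 38) Skip)
              (\<lambda>R'' m''. table val lab (fst (eliminated b val (Suc j))) m'' \<and>
                (R''(33 := Suc j)) 31 = ?cnt (Suc j) \<and> (R''(33 := Suc j)) 32 = ?z (Suc j))) ?R2 m2"
        proof (rule wpc_use, goal_cases)
          case (2 R3 m3)
          have R3: "R3 31 = ?cnt j" "R3 32 = ?z j"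
            using 2(2) R2 by (auto simp: frame_def defs)
          have el: "eliminated b val (Suc j) =
              (t2, if fl2 then c2 # snd (eliminated b val j) else snd (eliminated b val j))"
            using \<open>inserted val b (?t, [j], True) = (t2, c2, fl2)\<close> by simp
          have "?cnt (Suc j) \<le> H" "?z (Suc j) \<le> H"
            using length_eliminated[of b val "Suc j"] z_le[of "Suc j"] 4(1) MH by linarith+
          then show ?case
            using 2(1) unfolding el
            by (intro wpc_rules) (auto simp: current_def R3)
        qed (simp add: defs)
        from wpc_Seq[OF this] show ?case by (simp del: eliminated.simps cost.simps)
      qed (use H2 in auto)
    qed (simp add: defs)
  qed (use t R1 MH MU env_regs[OF e] in \<open>auto simp: frame_def LOAD_def PACK_def INSERT_STEP_def\<close>)
  show ?thesis
    unfolding ELIM_def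
  proof (rule wpc_Seq, rule wpc_use[OF clear], goal_cases)
    case (2 R1 m1)
    have e1: "env X R1 m1" by (rule env_frame[OF _ 2(2)]) (use e in auto)
    have s1: "sel u m1" by (rule sel_frame[OF _ 2(2)]) (use e s in auto)
    have "R1 15 = i" using 2(2) i by (auto simp: frame_def)
    moreover have "table val lab (\<lambda>_ _. []) m1"
      using 2(1) idx_less by (auto simp: table_def)
    ultimately have "wpc U H (For 33 (Var 5)
     (LOAD \<^bold>; 39 \<^bold>:= Lit 1 \<^bold>; For 41 (Var 2) INSERT_STEP \<^bold>;
      If (Var 39) (31 \<^bold>:= Var 31 \<^bold>+ Lit 1 \<^bold>; 32 \<^bold>:= Var 32 \<^bold>+ Var 38) Skip))
      (\<lambda>R' m'. R' 31 = ?cnt M \<and> R' 32 = ?z M) (R1(31 := 0, 32 := 0)) m1"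
      using e1 s1 by (intro main) auto
    then show ?case by (intro wpc_Seq wpc_Assign) auto
  qed simp
qed

end

section \<open>Building a candidate, scoring it and moving to the next union\<close>

lemma if_eq_fun_upd [simp]: "(\<lambda>x. if x = a then b else f x) = f(a := b)"
  by (simp add: fun_upd_def)

text \<open>A chosen coordinate is added to the error words at once, so scoring need not traverse
  the candidate again.\<close>

definition POS :: com where "POS =
  (15 \<^bold>:= Rd 2 (Var 16) \<^bold>* Var 2 \<^bold>+ Var 17 \<^bold>;
   Wr 4 (Var 16 \<^bold>* Var 2 \<^bold>+ Var 17) (Lit 0) \<^bold>;
   If (Var 15 \<^bold>< Var 0)
     (ELIM \<^bold>;
      If (Var 31 \<^bold>< (Var 31 \<^bold>- (Var 32 \<^bold>+ Var 32)) \<^bold>* Var 6) Skip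
        (Wr 4 (Var 16 \<^bold>* Var 2 \<^bold>+ Var 17) (Var 15 \<^bold>+ Lit 1) \<^bold>;
         For 18 (Var 8)
           (Wr 3 (Var 18) (Bin Xor (Rd 3 (Var 18)) (Rd 10 (Var 15 \<^bold>* Var 8 \<^bold>+ Var 18))))))
     Skip)"

definition SCAN :: com where "SCAN =
  (For 18 (Var 8) (Wr 3 (Var 18) (Rd 10 (Var 0 \<^bold>* Var 8 \<^bold>+ Var 18))) \<^bold>;
   For 16 (Var 1) (For 17 (Var 2) POS))"

definition SCORE :: com where "SCORE =
  (19 \<^bold>:= Lit 0 \<^bold>;
   For 18 (Var 8) (19 \<^bold>:= Var 19 \<^bold>+ Rd 0 (Rd 3 (Var 18))) \<^bold>;
   If (Var 19 \<^bold>< Var 14)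
     (14 \<^bold>:= Var 19 \<^bold>; For 20 (Var 1 \<^bold>* Var 2) (Wr 5 (Var 20) (Rd 4 (Var 20))))
     Skip)"

text \<open>Successor in colexicographic order, with \<open>N\<close> as sentinel after the last
  index: the lowest run of consecutive indices falls back to \<open>0, 1, ...\<close> and the index
  that stopped the carry advances. Variable 22 is the carry; if it survives all indices, every union
  has been seen.\<close>

definition NEXT :: com where "NEXT =
  (22 \<^bold>:= Lit 1 \<^bold>;
   For 21 (Var 1)
     (If (Var 22)
       (If (Rd 2 (Var 21) \<^bold>+ Lit 1 \<^bold>= Rd 2 (Var 21 \<^bold>+ Lit 1))
         (Wr 2 (Var 21) (Var 21))
         (Wr 2 (Var 21) (Rd 2 (Var 21) \<^bold>+ Lit 1) \<^bold>; 22 \<^bold>:= Lit 0))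
       Skip) \<^bold>;
   13 \<^bold>:= Lit 1 \<^bold>- Var 22)"

definition BODY :: com where "BODY = (SCAN \<^bold>; SCORE \<^bold>; NEXT)"

definition succ_step :: "nat \<Rightarrow> (nat \<Rightarrow> nat) \<times> bool \<Rightarrow> (nat \<Rightarrow> nat) \<times> bool" where
  "succ_step l s = (case s of (u, fl) \<Rightarrow>
     if fl then (if Suc (u l) = u (Suc l) then (u(l := l), True) else (u(l := Suc (u l)), False)) else s)"

primrec succ :: "nat \<Rightarrow> (nat \<Rightarrow> nat) \<times> bool \<Rightarrow> (nat \<Rightarrow> nat) \<times> bool" where
  "succ 0 s = s"
| "succ (Suc l) s = succ_step l (succ l s)"

lemma popcount_le: "v < 2 ^ q \<Longrightarrow> popcount v \<le> q"
proof (induction q arbitrary: v)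
  case (Suc q)
  then have "popcount (v div 2) \<le> q" by (intro Suc.IH) auto
  moreover have "v mod 2 \<le> 1" by auto
  ultimately show ?case by (subst popcount.simps) auto
qed (simp add: popcount.simps)

context lspn
begin

text \<open>A coordinate is put into the candidate unless the labels of the eliminated sums have bias above
  \<open>1 / D\<close> towards \<open>0\<close>; a negative bias is truncated to \<open>0\<close>.\<close>

definition dec :: "(nat \<Rightarrow> nat) \<Rightarrow> (nat \<Rightarrow> nat \<Rightarrow> nat) \<Rightarrow> nat \<Rightarrow> bool" where
  "dec u X i \<longleftrightarrow>
     (let os = snd (eliminated b (\<lambda>j. pk u i (X j)) M); z = sum_list (map (xor_list (\<lambda>j. X j n)) os)
      in \<not> length os < (length os - (z + z)) * D)"

definition chosen :: "(nat \<Rightarrow> nat) \<Rightarrow> (nat \<Rightarrow> nat \<Rightarrow> nat) \<Rightarrow> nat \<Rightarrow> nat \<Rightarrow> nat list" where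
  "chosen u X l x = filter (\<lambda>i. i < n \<and> dec u X i) (map (\<lambda>h. u l * b + h) [0..<x])"

definition candidate :: "(nat \<Rightarrow> nat) \<Rightarrow> (nat \<Rightarrow> nat \<Rightarrow> nat) \<Rightarrow> nat \<Rightarrow> nat list" where
  "candidate u X x = concat (map (\<lambda>l. chosen u X l b) [0..<x])"

definition col :: "(nat \<Rightarrow> nat \<Rightarrow> nat) \<Rightarrow> nat \<Rightarrow> nat \<Rightarrow> nat" where
  "col X i a = horner (\<lambda>h. X (M + (a * q + h)) i) q"

definition mark :: "(nat \<Rightarrow> nat) \<Rightarrow> (nat \<Rightarrow> nat \<Rightarrow> nat) \<Rightarrow> nat \<Rightarrow> nat" where
  "mark u X i = (if i < n \<and> dec u X i then i + 1 else 0)"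

definition prepared :: "(nat \<Rightarrow> nat \<Rightarrow> nat) \<Rightarrow> (nat \<Rightarrow> nat) \<Rightarrow> bool" where
  "prepared X m \<longleftrightarrow> (\<forall>v < 2 ^ q. m (ad B 0 v) = popcount v) \<and>
     (\<forall>i \<le> n. \<forall>a < r. m (ad B 10 (i * r + a)) = col X i a)"

definition errors :: "(nat \<Rightarrow> nat) \<Rightarrow> (nat \<Rightarrow> nat \<Rightarrow> nat) \<Rightarrow> nat" where
  "errors u X = (\<Sum>a < r. popcount (xor (col X n a) (xor_list (\<lambda>i. col X i a) (candidate u X k))))"

lemma prepared_frame:
  "prepared X m \<Longrightarrow> frame (R 9) V A R m R' m' \<Longrightarrow> env X R m \<Longrightarrow> A \<subseteq> {2..<10} \<Longrightarrow> prepared X m'"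
proof -
  assume *: "prepared X m" "frame (R 9) V A R m R' m'" "env X R m" "A \<subseteq> {2..<10}"
  have "m' (ad B a i) = m (ad B a i)" if "a = 0 \<or> a = 10" for a i
  proof -
    have "ad B a i \<noteq> ad B a' i'" if "a' \<in> A" for a' i'
      using *(4) that \<open>a = 0 \<or> a = 10\<close> by auto
    then show ?thesis using * by (auto simp: frame_def env_regs)
  qed
  then show ?thesis using *(1) by (simp add: prepared_def)
qed

lemma prepared_upd [simp]: "2 \<le> a \<Longrightarrow> a < 10 \<Longrightarrow> prepared X (m(ad B a i := v)) = prepared X m"
  by (auto simp: prepared_def)

lemma col_less: "(\<And>j i. X j i \<le> 1) \<Longrightarrow> col X i a < 2 ^ q"
  unfolding col_def by (rule horner_less) auto

lemma acc_less:
  assumes "\<And>j i. X j i \<le> 1"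
  shows "xor (col X n a) (xor_list (\<lambda>i. col X i a) c) < 2 ^ q"
  using col_less[OF assms] by (intro xor_less_power xor_list_less_power) auto

lemma wp_POS:
  assumes e: "env X R m" and s: "sel u m" and p: "prepared X m"
    and "R 16 = l" "l < k" "R 17 = h" "h < b"
    and acc: "\<And>a. a < r \<Longrightarrow> m (ad B 3 a) = xor (col X n a) (xor_list (\<lambda>i. col X i a) c)"
  shows "wpc U H POS (\<lambda>R' m'.
      (\<forall>a < r. m' (ad B 3 a) = xor (col X n a) (xor_list (\<lambda>i. col X i a)
        (c @ filter (\<lambda>i. i < n \<and> dec u X i) [u l * b + h]))) \<and>
      (\<forall>y. m' (ad B 4 y) = (if y = l * b + h then mark u X (u l * b + h) else m (ad B 4 y)))) R m"
proof -
  let ?i = "u l * b + h"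
  have ul: "m (ad B 2 l) = u l" "u l < N" using s \<open>l < k\<close> by (auto simp: sel_def)
  have iH: "?i \<le> H" using crd_less[OF ul(2) \<open>h < b\<close>] NbH by simp
  let ?R = "R(15 := ?i)" and ?m = "m(ad B 4 (l * b + h) := 0)"
  have e0: "env X ?R ?m" "sel u ?m" "prepared X ?m" using e s p by auto
  have eb: "\<And>j i. X j i \<le> 1" using env_bit[OF e] .
  let ?Q = "\<lambda>R' m'.
      (\<forall>a < r. m' (ad B 3 a) = xor (col X n a) (xor_list (\<lambda>i. col X i a)
        (c @ filter (\<lambda>i. i < n \<and> dec u X i) [?i]))) \<and>
      (\<forall>y. m' (ad B 4 y) = (if y = l * b + h then mark u X ?i else m (ad B 4 y)))"
  have add: "wpc U H (For 18 (Var 8)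
        (Wr 3 (Var 18) (Bin Xor (Rd 3 (Var 18)) (Rd 10 (Var 15 \<^bold>* Var 8 \<^bold>+ Var 18)))))
      (\<lambda>R' m'. \<forall>a < r. m' (ad B 3 a) = xor (col X n a) (xor_list (\<lambda>i. col X i a) (c @ [?i]))) R' m'"
    if e: "env X R' m'" and p: "prepared X m'" and i: "R' 15 = ?i" "?i < n"
      and acc: "\<And>a. a < r \<Longrightarrow> m' (ad B 3 a) = xor (col X n a) (xor_list (\<lambda>i. col X i a) c)" for R' m'
  proof (rule wp_For[where m = r and I = "\<lambda>x R' m'. \<forall>a < r. m' (ad B 3 a) =
      xor (col X n a) (xor_list (\<lambda>i. col X i a) (if a < x then c @ [?i] else c))"], goal_cases)
    case (4 a R2 m2)
    have e2: "env X R2 m2" by (rule env_frame[OF _ 4(2)]) (use e in auto)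
    have p2: "prepared X m2" by (rule prepared_frame[OF _ 4(2)]) (use e p in auto)
    have col: "m2 (ad B 10 (?i * r + a)) = col X ?i a" using p2 i 4(1) by (auto simp: prepared_def)
    have 15: "R2 15 = ?i" using 4(2) i by (auto simp: frame_def)
    have "xor (col X n a) (xor_list (\<lambda>i. col X i a) (c @ [?i])) \<le> H"
      using acc_less[of X a "c @ [?i]"] eb qpH by (auto intro: order.trans less_imp_le)
    then show ?case
      by (intro wpc_rules) (use 4 in \<open>auto simp: env_regs[OF e2] col 15 xor.assoc less_Suc_eq\<close>)
  qed (use acc env_regs[OF e] rU rH in \<open>auto simp: frame_def\<close>)
  have el: "wpc U H (ELIM \<^bold>;
      If (Var 31 \<^bold>< (Var 31 \<^bold>- (Var 32 \<^bold>+ Var 32)) \<^bold>* Var 6) Skip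
        (Wr 4 (Var 16 \<^bold>* Var 2 \<^bold>+ Var 17) (Var 15 \<^bold>+ Lit 1) \<^bold>;
         For 18 (Var 8)
           (Wr 3 (Var 18) (Bin Xor (Rd 3 (Var 18)) (Rd 10 (Var 15 \<^bold>* Var 8 \<^bold>+ Var 18)))))) ?Q ?R ?m"
    if i: "?i < n"
  proof (rule wpc_Seq, rule wpc_use[OF wp_ELIM[OF e0(1,2) _ refl refl, where i = ?i]], goal_cases)
    case (3 R1 m1)
    note defs = ELIM_def LOAD_def PACK_def INSERT_STEP_def
    have e1: "env X R1 m1" by (rule env_frame[OF _ 3(2)]) (use e0 in \<open>auto simp: defs\<close>)
    have p1: "prepared X m1" by (rule prepared_frame[OF _ 3(2)]) (use e0 in \<open>auto simp: defs\<close>)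
    have R1: "R1 15 = ?i" "R1 16 = l" "R1 17 = h" using 3(2) assms by (auto simp: frame_def defs)
    have "m1 (ad B a y) = ?m (ad B a y)" if "a = 3 \<or> a = 4" for a y
      using 3(2) that by (auto simp: frame_def env_regs[OF e] defs)
    then have m1: "m1 (ad B 3 y) = m (ad B 3 y)" "m1 (ad B 4 y) = (if y = l * b + h then 0 else m (ad B 4 y))" for y
      by simp_all
    have dec: "dec u X ?i \<longleftrightarrow> \<not> R1 31 < (R1 31 - (R1 32 + R1 32)) * D"
      using 3(1) by (simp add: dec_def Let_def)
    let ?m1 = "m1(ad B 4 (l * b + h) := Suc ?i)"
    show ?case
    proof (rule wpc_If, goal_cases)
      case 1
      then have "\<not> dec u X ?i" using dec by (auto simp: env_regs[OF e1])
      then show ?case using m1 acc by (intro wpc_Skip) (auto simp: mark_def)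
    next
      case 2
      then have d: "dec u X ?i" using dec by (auto simp: env_regs[OF e1] split: if_splits)
      have "wpc U H (For 18 (Var 8)
           (Wr 3 (Var 18) (Bin Xor (Rd 3 (Var 18)) (Rd 10 (Var 15 \<^bold>* Var 8 \<^bold>+ Var 18))))) ?Q R1 ?m1"
      proof (rule wpc_use[OF add], goal_cases)
        case (7 R2 m2)
        have "m2 (ad B 4 y) = ?m1 (ad B 4 y)" for y
          using 7(2) by (auto simp: frame_def env_regs[OF e1])
        then show ?case using 7(1) m1 d i by (auto simp: mark_def)
      qed (use e1 p1 R1 i acc m1 in auto)
      then show ?case
        using i nH by (intro wpc_Seq wpc_Wr) (auto simp: env_regs[OF e1] R1)
    qed
  qed (auto simp: ELIM_def LOAD_def PACK_def INSERT_STEP_def)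
  show ?thesis
    unfolding POS_def
  proof (rule wpc_Seq, rule wpc_Assign, goal_cases)
    case 2
    have eq: "R(15 := uval R m (Rd 2 (Var 16) \<^bold>* Var 2 \<^bold>+ Var 17)) = ?R"
      using assms by (simp add: env_regs[OF e] ul)
    show ?case unfolding eq
    proof (rule wpc_Seq, rule wpc_Wr, goal_cases)
      case 2
      have eq: "m(ad (?R 9) 4 (uval ?R m (Var 16 \<^bold>* Var 2 \<^bold>+ Var 17)) := uval ?R m (Lit 0)) = ?m"
        using assms by (simp add: env_regs[OF e])
      show ?case unfolding eq
      proof (rule wpc_If, goal_cases)
        case 1
        then show ?case by (intro el) (auto simp: env_regs[OF e] split: if_splits)
      next
        case 2
        then have "\<not> ?i < n" by (auto simp: env_regs[OF e])
        then show ?case using acc by (intro wpc_Skip) (auto simp: mark_def)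
      qed
    qed simp
  qed (use iH assms in \<open>auto simp: env_regs[OF e] ul\<close>)
qed

lemma wp_SCAN:
  assumes e: "env X R m" and s: "sel u m" and p: "prepared X m"
  shows "wpc U H SCAN (\<lambda>R' m'.
      (\<forall>a < r. m' (ad B 3 a) = xor (col X n a) (xor_list (\<lambda>i. col X i a) (candidate u X k))) \<and>
      (\<forall>l < k. \<forall>h < b. m' (ad B 4 (l * b + h)) = mark u X (u l * b + h))) R m"
proof -
  note defs = POS_def ELIM_def LOAD_def PACK_def INSERT_STEP_def
  have row: "wpc U H (For 17 (Var 2) POS) (\<lambda>R' m'.
      (\<forall>a < r. m' (ad B 3 a) = xor (col X n a) (xor_list (\<lambda>i. col X i a) (candidate u X (Suc l)))) \<and>
      (\<forall>l' < Suc l. \<forall>h < b. m' (ad B 4 (l' * b + h)) = mark u X (u l' * b + h))) R m"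
    if e: "env X R m" and s: "sel u m" and p: "prepared X m" and l: "R 16 = l" "l < k"
      and acc: "\<And>a. a < r \<Longrightarrow> m (ad B 3 a) = xor (col X n a) (xor_list (\<lambda>i. col X i a) (candidate u X l))"
      and cb: "\<And>l' h. l' < l \<Longrightarrow> h < b \<Longrightarrow> m (ad B 4 (l' * b + h)) = mark u X (u l' * b + h)" for R m l
  proof (rule wp_For[where m = b and I = "\<lambda>x R' m'.
      (\<forall>a < r. m' (ad B 3 a) = xor (col X n a) (xor_list (\<lambda>i. col X i a) (candidate u X l @ chosen u X l x))) \<and>
      (\<forall>l' \<le> l. \<forall>h < b. l' < l \<or> h < x \<longrightarrow> m' (ad B 4 (l' * b + h)) = mark u X (u l' * b + h))"], goal_cases)
    case (4 h R' m')
    have e': "env X R' m'" by (rule env_frame[OF _ 4(2)]) (use e in \<open>auto simp: defs\<close>)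
    have s': "sel u m'" by (rule sel_frame[OF _ 4(2)]) (use e s in \<open>auto simp: defs\<close>)
    have p': "prepared X m'" by (rule prepared_frame[OF _ 4(2)]) (use e p in \<open>auto simp: defs\<close>)
    have l': "R' 16 = l" using 4(2) l by (auto simp: frame_def defs)
    show ?case
      by (rule wpc_mono[OF wp_POS[OF e' s' p' l' l(2) 4(3,1), where c = "candidate u X l @ chosen u X l h"]])
        (use 4 in \<open>auto simp: chosen_def less_Suc_eq\<close>)
  qed (use acc cb env_regs[OF e] bH bU in \<open>auto simp: frame_def defs chosen_def candidate_def less_Suc_eq\<close>)
  show ?thesis
    unfolding SCAN_def
  proof (rule wpc_Seq, rule wp_For[where m = r and I = "\<lambda>x R' m'. \<forall>a < x. m' (ad B 3 a) = col X n a"], goal_cases)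
    case (4 a R' m')
    have e': "env X R' m'" by (rule env_frame[OF _ 4(2)]) (use e in auto)
    have p': "prepared X m'" by (rule prepared_frame[OF _ 4(2)]) (use e p in auto)
    have "m' (ad B 10 (n * r + a)) = col X n a" "col X n a \<le> H"
      using p' 4(1) col_less[of X n a] env_bit[OF e] qpH by (auto simp: prepared_def intro: order.trans less_imp_le)
    then show ?case
      by (intro wpc_rules) (use 4 in \<open>auto simp: env_regs[OF e'] less_Suc_eq\<close>)
  next
    case (8 R1 m1)
    have e1: "env X R1 m1" by (rule env_frame[OF _ 8(1)]) (use e in auto)
    have s1: "sel u m1" by (rule sel_frame[OF _ 8(1)]) (use e s in auto)
    have p1: "prepared X m1" by (rule prepared_frame[OF _ 8(1)]) (use e p in auto)
    show ?case
    proof (rule wp_For[where m = k and I = "\<lambda>x R' m'.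
      (\<forall>a < r. m' (ad B 3 a) = xor (col X n a) (xor_list (\<lambda>i. col X i a) (candidate u X x))) \<and>
      (\<forall>l < x. \<forall>h < b. m' (ad B 4 (l * b + h)) = mark u X (u l * b + h))"], goal_cases)
      case (4 l R' m')
      have e': "env X R' m'" by (rule env_frame[OF _ 4(2)]) (use e1 in \<open>auto simp: defs\<close>)
      have s': "sel u m'" by (rule sel_frame[OF _ 4(2)]) (use e1 s1 in \<open>auto simp: defs\<close>)
      have p': "prepared X m'" by (rule prepared_frame[OF _ 4(2)]) (use e1 p1 in \<open>auto simp: defs\<close>)
      show ?case
        by (rule wpc_mono[OF row[OF e' s' p' 4(3,1)]]) (use 4 in auto)
    qed (use 8 env_regs[OF e1] kH kU in \<open>auto simp: frame_def defs candidate_def\<close>)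
  qed (use env_regs[OF e] rH rU in \<open>auto simp: frame_def\<close>)
qed

end

section \<open>Colexicographic enumeration of the unions\<close>

lemma sum_binomial_diagonal: "(\<Sum>l<m. (a + l) choose Suc l) + 1 = (a + m) choose m"
  by (induction m) simp_all

text \<open>The sum is the rank of \<open>u\<close> in the combinatorial number system. By induction
  the lower terms stay below \<open>u k choose k\<close>, and Pascal's rule joins this with the new
  term to \<open>Suc (u k) choose Suc k\<close>.\<close>

lemma colex_rank_less:
  fixes u :: "nat \<Rightarrow> nat"
  assumes "\<And>l. l < k \<Longrightarrow> u l < u (Suc l)"
  shows "(\<Sum>l<k. u l choose Suc l) < u k choose k"
  using assms
proof (induction k)
  case (Suc k)
  have "(\<Sum>l<Suc k. u l choose Suc l) < (u k choose k) + (u k choose Suc k)" using Suc by simp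
  also have "\<dots> = Suc (u k) choose Suc k" by simp
  also have "\<dots> \<le> u (Suc k) choose Suc k" using Suc.prems[of k] by (intro binomial_right_mono) auto
  finally show ?case .
qed simp

text \<open>The largest index decides the comparison of ranks; peeling it off repeatedly shows that
  ranks are injective.\<close>

lemma colex_rank_less':
  fixes u v :: "nat \<Rightarrow> nat"
  assumes "\<And>l. l < k \<Longrightarrow> u l < u (Suc l)" "u k < v k"
  shows "(\<Sum>l<Suc k. u l choose Suc l) < (\<Sum>l<Suc k. v l choose Suc l)"
proof -
  have "(\<Sum>l<Suc k. u l choose Suc l) < (u k choose k) + (u k choose Suc k)"
    using colex_rank_less[of k u] assms by simp
  also have "\<dots> = Suc (u k) choose Suc k" by simp
  also have "\<dots> \<le> v k choose Suc k" using assms by (intro binomial_right_mono) auto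
  also have "\<dots> \<le> (\<Sum>l<Suc k. v l choose Suc l)" by simp
  finally show ?thesis .
qed

lemma colex_rank_inj:
  fixes u v :: "nat \<Rightarrow> nat"
  assumes "\<And>l. l < k \<Longrightarrow> u l < u (Suc l)" "\<And>l. l < k \<Longrightarrow> v l < v (Suc l)"
    and "(\<Sum>l<k. u l choose Suc l) = (\<Sum>l<k. v l choose Suc l)" "l < k"
  shows "u l = v l"
  using assms
proof (induction k arbitrary: l)
  case (Suc k)
  have "u k = v k"
    using colex_rank_less'[of k u v] colex_rank_less'[of k v u] Suc.prems
    by (cases "u k" "v k" rule: linorder_cases) auto
  then show ?case using Suc.IH[of l] Suc.prems by (cases "l = k") auto
qed simp

lemma succ_cases:
  assumes "succ x (u, True) = (u', fl)"
  shows "fl \<and> (\<forall>l < x. Suc (u l) = u (Suc l)) \<and> (\<forall>l. u' l = (if l < x then l else u l)) \<or>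
    \<not> fl \<and> (\<exists>y < x. (\<forall>l < y. Suc (u l) = u (Suc l)) \<and> Suc (u y) \<noteq> u (Suc y) \<and>
      (\<forall>l. u' l = (if l < y then l else if l = y then Suc (u y) else u l)))"
  using assms
proof (induction x arbitrary: u' fl)
  case (Suc x)
  obtain u1 fl1 where 1: "succ x (u, True) = (u1, fl1)" by fastforce
  show ?case
  proof (cases fl1)
    case True
    with Suc.IH[OF 1] have "\<forall>l < x. Suc (u l) = u (Suc l)" "\<forall>l. u1 l = (if l < x then l else u l)"
      by auto
    note u1 = this
    show ?thesis
    proof (cases "Suc (u x) = u (Suc x)")
      case eq: True
      then have "fl" "u' = u1(x := x)"
        using Suc.prems True u1(2) unfolding succ.simps 1 by (auto simp: succ_step_def)
      then show ?thesis using eq u1 by (auto simp: less_Suc_eq)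
    next
      case False
      then have "\<not> fl" "u' = u1(x := Suc (u x))"
        using Suc.prems True u1(2) unfolding succ.simps 1 by (auto simp: succ_step_def)
      then show ?thesis using False u1 by (intro disjI2 conjI exI[of _ x]) auto
    qed
  next
    case False
    then show ?thesis using Suc.IH[OF 1] Suc.prems unfolding succ.simps 1
      by (auto simp: succ_step_def less_Suc_eq)
  qed
qed auto

text \<open>The sentinel \<open>u k = N\<close> lets the largest index obey the same rule as all
  others.\<close>

definition increasing :: "nat \<Rightarrow> nat \<Rightarrow> (nat \<Rightarrow> nat) \<Rightarrow> bool" where
  "increasing k N u \<longleftrightarrow> (\<forall>l < k. u l < u (Suc l)) \<and> u k = N"

lemma increasing_less: "increasing k N u \<Longrightarrow> l < k \<Longrightarrow> u l < N"
proof (induction "k - l" arbitrary: l)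
  case (Suc d)
  then have "u l < u (Suc l)" by (simp add: increasing_def)
  moreover have "u (Suc l) < N \<or> Suc l = k" using Suc by (cases "Suc l < k") auto
  ultimately show ?case using Suc.prems by (auto simp: increasing_def)
qed simp

text \<open>Up to the stopping place \<open>y\<close> the indices are consecutive, so their part of
  the rank is a diagonal of Pascal's triangle, one short of \<open>Suc (u y) choose Suc y\<close>.
  After the step exactly this binomial remains, because the reset indices contribute
  \<open>l choose Suc l = 0\<close>.\<close>

lemma succ_increasing:
  assumes u: "increasing k N u" and s: "succ k (u, True) = (u', False)"
  shows "increasing k N u' \<and> (\<Sum>l<k. u' l choose Suc l) = Suc (\<Sum>l<k. u l choose Suc l)"
proof -
  obtain y where y: "y < k" "\<And>l. l < y \<Longrightarrow> Suc (u l) = u (Suc l)" "Suc (u y) \<noteq> u (Suc y)"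
      "\<And>l. u' l = (if l < y then l else if l = y then Suc (u y) else u l)"
    using succ_cases[OF s] by auto
  have u0: "u l = u 0 + l" if "l \<le> y" for l
    using that
  proof (induction l)
    case (Suc l)
    then show ?case using y(2)[of l] by simp
  qed simp
  have inc: "increasing k N u'"
    unfolding increasing_def
  proof (intro conjI allI impI)
    fix l assume "l < k"
    then have less: "u l < u (Suc l)" using u by (simp add: increasing_def)
    have le: "y \<le> u y" using u0[of y] by simp
    consider "Suc l < y" | "Suc l = y" | "l = y" | "y < l" by linarith
    then show "u' l < u' (Suc l)"
    proof cases
      case 1
      then have "u' l = l" "u' (Suc l) = Suc l" unfolding y(4) by simp_all
      then show ?thesis by simp
    next
      case 2
      then have "u' l = l" "u' (Suc l) = Suc (u y)" unfolding y(4) by auto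
      then show ?thesis using 2 le by linarith
    next
      case 3
      then have "u' l = Suc (u y)" "u' (Suc l) = u (Suc y)" unfolding y(4) by simp_all
      moreover have "u y < u (Suc y)" using less 3 by simp
      ultimately show ?thesis using y(3) by linarith
    next
      case 4
      then have "u' l = u l" "u' (Suc l) = u (Suc l)" unfolding y(4) by simp_all
      then show ?thesis using less by simp
    qed
  next
    show "u' k = N" using y u by (simp add: increasing_def)
  qed
  have split: "(\<Sum>l<k. f l) = (\<Sum>l<Suc y. f l) + (\<Sum>l\<in>{Suc y..<k}. f l)" for f :: "nat \<Rightarrow> nat"
    using sum.atLeastLessThan_concat[of 0 "Suc y" k f] Suc_leI[OF y(1)]
    by (simp only: lessThan_atLeast0 zero_le simp_thms)
  have "(\<Sum>l<Suc y. u' l choose Suc l) = Suc (u y) choose Suc y"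
  proof -
    have "(\<Sum>l<y. u' l choose Suc l) = 0"
      by (rule sum.neutral) (simp add: y(4) binomial_eq_0)
    moreover have "u' y = Suc (u y)" by (simp add: y(4))
    ultimately show ?thesis by (simp only: sum.lessThan_Suc add_0)
  qed
  also have "\<dots> = (u 0 + Suc y) choose Suc y" using u0[of y] by simp
  also have "\<dots> = Suc (\<Sum>l<Suc y. (u 0 + l) choose Suc l)"
    using sum_binomial_diagonal[of "u 0" "Suc y"] by simp
  also have "(\<Sum>l<Suc y. (u 0 + l) choose Suc l) = (\<Sum>l<Suc y. u l choose Suc l)"
  proof (rule sum.cong)
    fix l assume "l \<in> {..<Suc y}"
    then have "u l = u 0 + l" by (intro u0) simp
    then show "(u 0 + l) choose Suc l = u l choose Suc l" by (rule arg_cong[OF sym])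
  qed simp
  finally have "(\<Sum>l<Suc y. u' l choose Suc l) = Suc (\<Sum>l<Suc y. u l choose Suc l)" .
  moreover have "(\<Sum>l\<in>{Suc y..<k}. u' l choose Suc l) = (\<Sum>l\<in>{Suc y..<k}. u l choose Suc l)"
    using y(4) by (intro sum.cong) auto
  ultimately show ?thesis using inc unfolding split by simp
qed

text \<open>A surviving carry means that the indices are the last \<open>k\<close> numbers below
  \<open>N\<close>, and their rank is again a diagonal sum.\<close>

lemma succ_exhausted:
  assumes u: "increasing k N u" and s: "succ k (u, True) = (u', True)"
  shows "Suc (\<Sum>l<k. u l choose Suc l) = N choose k"
proof -
  have c: "Suc (u l) = u (Suc l)" if "l < k" for l using succ_cases[OF s] that by blast
  have u0: "u l = u 0 + l" if "l \<le> k" for l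
    using that
  proof (induction l)
    case (Suc l)
    then show ?case using c[of l] by simp
  qed simp
  have "(\<Sum>l<k. u l choose Suc l) = (\<Sum>l<k. (u 0 + l) choose Suc l)"
  proof (rule sum.cong)
    fix l assume "l \<in> {..<k}"
    then have "u l = u 0 + l" by (intro u0) simp
    then show "u l choose Suc l = (u 0 + l) choose Suc l" by (rule arg_cong)
  qed simp
  moreover have "u 0 + k = N" using u0[of k] u by (simp add: increasing_def)
  ultimately show ?thesis using sum_binomial_diagonal[of "u 0" k] by simp
qed

primrec comb :: "nat \<Rightarrow> nat \<Rightarrow> nat \<Rightarrow> nat \<Rightarrow> nat" where
  "comb k N 0 = (\<lambda>l. if l < k then l else N)"
| "comb k N (Suc i) = fst (succ k (comb k N i, True))"

text \<open>Each step raises the rank by one, and by \<open>succ_exhausted\<close> the successor can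
  only fail at the last rank.\<close>

lemma comb_rank:
  assumes "k \<le> N"
  shows "i < N choose k \<Longrightarrow> increasing k N (comb k N i) \<and> (\<Sum>l<k. comb k N i l choose Suc l) = i"
proof (induction i)
  case 0
  have "(\<Sum>l<k. comb k N 0 l choose Suc l) = 0" by (rule sum.neutral) (simp add: binomial_eq_0)
  moreover have "increasing k N (comb k N 0)" using assms by (auto simp: increasing_def)
  ultimately show ?case by blast
next
  case (Suc i)
  then have IH: "increasing k N (comb k N i)" "(\<Sum>l<k. comb k N i l choose Suc l) = i" by auto
  obtain u' fl where s: "succ k (comb k N i, True) = (u', fl)" by fastforce
  have "\<not> fl" using succ_exhausted[OF IH(1), of u'] IH(2) Suc.prems s by (cases fl) auto
  then have "succ k (comb k N i, True) = (u', False)" using s by simp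
  from succ_increasing[OF IH(1) this] show ?case unfolding IH(2) by (simp add: s)
qed

lemma succ_comb_flag:
  assumes "k \<le> N" "i < N choose k"
  shows "snd (succ k (comb k N i, True)) \<longleftrightarrow> Suc i = N choose k"
proof -
  note r = comb_rank[OF assms]
  obtain u' fl where s: "succ k (comb k N i, True) = (u', fl)" by fastforce
  show ?thesis
  proof (cases fl)
    case True
    then show ?thesis using succ_exhausted[of k N "comb k N i" u'] r s by simp
  next
    case False
    then have u': "increasing k N u'" "(\<Sum>l<k. u' l choose Suc l) = Suc i"
      using succ_increasing[of k N "comb k N i" u'] r s by auto
    then have "Suc i < N choose k" using colex_rank_less[of k u'] by (auto simp: increasing_def)
    then show ?thesis using s False by simp
  qed
qed

text \<open>The rank of \<open>u\<close> is the position at which \<open>u\<close> occurs, by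
  injectivity of ranks. No union is missed.\<close>

lemma comb_surj:
  assumes "k \<le> N" "increasing k N u"
  shows "\<exists>i < N choose k. \<forall>l < k. comb k N i l = u l"
proof -
  define i where "i = (\<Sum>l<k. u l choose Suc l)"
  have i: "i < N choose k" using colex_rank_less[of k u] assms(2) by (auto simp: increasing_def i_def)
  then have "increasing k N (comb k N i)" "(\<Sum>l<k. comb k N i l choose Suc l) = i"
    using comb_rank[OF assms(1)] by auto
  have "comb k N i l = u l" if "l < k" for l
  proof (rule colex_rank_inj[of k "comb k N i" u])
    show "(\<Sum>l<k. comb k N i l choose Suc l) = (\<Sum>l<k. u l choose Suc l)"
      using \<open>(\<Sum>l<k. comb k N i l choose Suc l) = i\<close> by (simp only: i_def[symmetric])
  qed (use assms(2) \<open>increasing k N (comb k N i)\<close> that in \<open>simp_all add: increasing_def\<close>)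
  then show ?thesis using i by blast
qed

text \<open>The best score starts at \<open>r * q + 1\<close>, more than any number of errors, so
  the first candidate is always accepted.\<close>

definition MAIN :: com where "MAIN =
  (For 16 (Var 1) (Wr 2 (Var 16) (Var 16)) \<^bold>;
   Wr 2 (Var 1) (Var 3) \<^bold>;
   14 \<^bold>:= Var 8 \<^bold>* Var 4 \<^bold>+ Lit 1 \<^bold>;
   13 \<^bold>:= Lit 1 \<^bold>;
   While (Var 13) BODY)"

context lspn
begin

lemma wp_SCORE:
  assumes e: "env X R m" and p: "prepared X m" and acc: "\<And>a. a < r \<Longrightarrow> m (ad B 3 a) = w a"
    and w: "\<And>a. w a < 2 ^ q" and e0: "R 14 = e0" and mH: "\<And>y. y < k * b \<Longrightarrow> m (ad B 4 y) \<le> H" and err: "err = (\<Sum>a<r. popcount (w a))"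
  shows "wpc U H SCORE (\<lambda>R' m'.
      R' 14 = min err e0 \<and>
      (\<forall>y < k * b. m' (ad B 5 y) = (if err < e0 then m (ad B 4 y) else m (ad B 5 y)))) R m"
proof -
  have sum_le: "(\<Sum>a<x. popcount (w a)) \<le> H" if "x \<le> r" for x
  proof -
    have "(\<Sum>a<x. popcount (w a)) \<le> (\<Sum>a<x. q)" using w by (intro sum_mono popcount_le)
    also have "\<dots> = x * q" by simp
    also have "\<dots> \<le> r * q" using that by (intro mult_right_mono) auto
    finally show ?thesis using rqH by simp
  qed
  show ?thesis
    unfolding SCORE_def
  proof (rule wpc_Seq, rule wpc_Assign, simp, rule wpc_Seq,
      rule wp_For[where m = r and I = "\<lambda>x R' m'. R' 19 = (\<Sum>a<x. popcount (w a))"], goal_cases)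
    case (4 a R' m')
    have e': "env X R' m'" by (rule env_frame[OF _ 4(2)]) (use e in auto)
    have "m' = m" using 4(2) by (auto intro: frame_no_array)
    moreover have "m (ad B 0 (w a)) = popcount (w a)" using p w by (simp add: prepared_def)
    ultimately show ?case using 4 acc sum_le[of "Suc a"]
      by (intro wpc_rules) (auto simp: env_regs[OF e'])
  next
    case (8 R1 m1)
    have e1: "env X R1 m1" by (rule env_frame[OF _ 8(1)]) (use e in auto)
    have m1: "m1 = m" using 8(1) by (auto intro: frame_no_array)
    have R1: "R1 14 = e0" "R1 19 = err" using 8 e0 by (auto simp: frame_def err)
    let ?R1 = "R1(14 := err)"
    have copy: "wpc U H (For 20 (Var 1 \<^bold>* Var 2) (Wr 5 (Var 20) (Rd 4 (Var 20))))
       (\<lambda>R' m'. R' 14 = err \<and> (\<forall>y < k * b. m' (ad B 5 y) = m (ad B 4 y))) ?R1 m1"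
    proof (rule wp_For[where m = "k * b" and I = "\<lambda>x R' m'. \<forall>y < x. m' (ad B 5 y) = m (ad B 4 y)"], goal_cases)
      case (4 y R' m')
      have e': "env X R' m'" by (rule env_frame[OF _ 4(2)]) (use e1 in auto)
      have "m' (ad B 4 y) = m (ad B 4 y)" using 4(2) m1 by (auto simp: frame_def env_regs[OF e1])
      moreover have "m (ad B 4 y) \<le> H" using mH 4(1) by simp
      ultimately show ?case
        by (intro wpc_rules) (use 4 in \<open>auto simp: env_regs[OF e'] less_Suc_eq\<close>)
    qed (use R1 env_regs[OF e1] kbH kbU in \<open>auto simp: frame_def\<close>)
    show ?case
    proof (rule wpc_If, goal_cases)
      case 1
      then have "err < e0" using R1 by (auto split: if_splits)
      then have "wpc U H (For 20 (Var 1 \<^bold>* Var 2) (Wr 5 (Var 20) (Rd 4 (Var 20))))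
        (\<lambda>R' m'. R' 14 = min err e0 \<and>
      (\<forall>y < k * b. m' (ad B 5 y) = (if err < e0 then m (ad B 4 y) else m (ad B 5 y)))) ?R1 m1"
        using copy by (auto elim: wpc_mono)
      then show ?case using R1 sum_le[of r] by (intro wpc_Seq wpc_Assign) (auto simp: err)
    next
      case 2
      then have "\<not> err < e0" using R1 by auto
      then show ?case using R1 m1 by (intro wpc_Skip) auto
    qed
  qed (use env_regs[OF e] rH rU in \<open>auto simp: frame_def\<close>)
qed

lemma wp_NEXT:
  assumes e: "env X R m" and u: "increasing k N u" and m: "\<And>l. l \<le> k \<Longrightarrow> m (ad B 2 l) = u l"
    and s: "succ k (u, True) = (u', fl)"
  shows "wpc U H NEXT (\<lambda>R' m'. R' 13 = of_bool (\<not> fl) \<and> (\<forall>l \<le> k. m' (ad B 2 l) = u' l)) R m"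
  unfolding NEXT_def
proof (rule wpc_Seq, rule wpc_Assign, use H2 in simp, rule wpc_Seq,
    rule wp_For[where m = k and I = "\<lambda>x R' m'. R' 22 = of_bool (snd (succ x (u, True))) \<and>
      (\<forall>l \<le> k. m' (ad B 2 l) = fst (succ x (u, True)) l)"], goal_cases)
  case (4 x R' m')
  have e': "env X R' m'" by (rule env_frame[OF _ 4(2)]) (use e in auto)
  obtain u1 fl1 where 1: "succ x (u, True) = (u1, fl1)" by fastforce
  have m': "m' (ad B 2 x) = u1 x" "m' (ad B 2 (Suc x)) = u1 (Suc x)" "R' 22 = of_bool fl1"
    using 4 1 by auto
  have fl1: "u1 x = u x" "u1 (Suc x) = u (Suc x)" if fl1 using succ_cases[OF 1] that by auto
  have "Suc (u x) \<le> H" "x \<le> H"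
    using increasing_less[OF u 4(1)] NH kH 4(1) by linarith+
  then show ?case
    using 4(1,3,4) fl1 m'
    by (intro wpc_rules) (auto simp: env_regs[OF e'] 1 succ_step_def)
next
  case (8 R' m')
  then show ?case using H2 s
    by (intro wpc_rules) auto
qed (use env_regs[OF e] kH kU m s in \<open>auto simp: frame_def\<close>)

text \<open>Before the first round array 5 has no meaning yet, hence the separate case
  \<open>i = 0\<close>.\<close>

definition best_so_far :: "(nat \<Rightarrow> nat \<Rightarrow> nat) \<Rightarrow> nat \<Rightarrow> (nat \<Rightarrow> nat) \<Rightarrow> (nat \<Rightarrow> nat) \<Rightarrow> bool" where
  "best_so_far X i R m \<longleftrightarrow> (if i = 0 then R 14 = r * q + 1 else
     (\<exists>i0 < i. R 14 = errors (comb k N i0) X \<and> (\<forall>i' < i. errors (comb k N i0) X \<le> errors (comb k N i') X) \<and>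
       (\<forall>l < k. \<forall>h < b. m (ad B 5 (l * b + h)) = mark (comb k N i0) X (comb k N i0 l * b + h))))"

lemma errors_le:
  assumes "\<And>j i. X j i \<le> 1"
  shows "errors u X \<le> r * q"
proof -
  have "errors u X \<le> (\<Sum>a<r. q)"
    unfolding errors_def using acc_less[OF assms] by (intro sum_mono popcount_le)
  then show ?thesis by simp
qed

lemma pos_less: "l < k \<Longrightarrow> h < b \<Longrightarrow> l * b + h < k * b"
proof -
  assume "l < k" "h < b"
  then have "Suc l * b \<le> k * b" by (intro mult_right_mono) auto
  then show ?thesis using \<open>h < b\<close> by simp
qed

lemma wp_BODY:
  assumes e: "env X R m" and u: "increasing k N u" and m: "\<And>l. l \<le> k \<Longrightarrow> m (ad B 2 l) = u l"
    and p: "prepared X m" and e0: "R 14 = e0" and s: "succ k (u, True) = (u', fl)"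
  shows "wpc U H BODY (\<lambda>R' m'. env X R' m' \<and> prepared X m' \<and> R' 14 = min (errors u X) e0 \<and>
      (\<forall>l < k. \<forall>h < b. m' (ad B 5 (l * b + h)) =
         (if errors u X < e0 then mark u X (u l * b + h) else m (ad B 5 (l * b + h)))) \<and>
      R' 13 = of_bool (\<not> fl) \<and> (\<forall>l \<le> k. m' (ad B 2 l) = u' l)) R m"
proof -
  note defs = SCAN_def POS_def ELIM_def LOAD_def PACK_def INSERT_STEP_def
  have sel: "sel u m" using m increasing_less[OF u] by (simp add: sel_def)
  show ?thesis
    unfolding BODY_def
  proof (rule wpc_Seq, rule wpc_use[OF wp_SCAN[OF e sel p]], goal_cases)
    case (2 R1 m1)
    have e1: "env X R1 m1" by (rule env_frame[OF _ 2(2)]) (use e in \<open>auto simp: defs\<close>)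
    have p1: "prepared X m1" by (rule prepared_frame[OF _ 2(2)]) (use e p in \<open>auto simp: defs\<close>)
    have R1: "R1 14 = e0" using 2(2) e0 by (auto simp: frame_def defs)
    have m1: "m1 (ad B a y) = m (ad B a y)" if "a = 2 \<or> a = 5" for a y
      using 2(2) that by (auto simp: frame_def defs env_regs[OF e])
    have mH: "m1 (ad B 4 y) \<le> H" if "y < k * b" for y
    proof -
      have "y div b < k" "y mod b < b" using that b1 by (auto simp: less_mult_imp_div_less)
      then have "m1 (ad B 4 (y div b * b + y mod b)) = mark u X (u (y div b) * b + y mod b)"
        using 2(1) by blast
      then show ?thesis using nH by (auto simp: mark_def)
    qed
    show ?case
    proof (rule wpc_Seq, rule wpc_use[OF wp_SCORE[OF e1 p1 _ _ R1 mH refl,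
          where w = "\<lambda>a. xor (col X n a) (xor_list (\<lambda>i. col X i a) (candidate u X k))"]], goal_cases)
      case (5 R2 m2)
      have e2: "env X R2 m2" by (rule env_frame[OF _ 5(2)]) (use e1 in \<open>auto simp: SCORE_def\<close>)
      have p2: "prepared X m2" by (rule prepared_frame[OF _ 5(2)]) (use e1 p1 in \<open>auto simp: SCORE_def\<close>)
      have "m2 (ad B 2 y) = m1 (ad B 2 y)" for y
        using 5(2) by (auto simp: frame_def SCORE_def env_regs[OF e1])
      then have u2: "m2 (ad B 2 l) = u l" if "l \<le> k" for l
        using m m1[of 2 l] that by simp
      show ?case
      proof (rule wpc_use[OF wp_NEXT[OF e2 u u2 s]], goal_cases)
        case (3 R3 m3)
        have e3: "env X R3 m3" by (rule env_frame[OF _ 3(2)]) (use e2 in \<open>auto simp: NEXT_def\<close>)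
        have "m3 (ad B a y) = m2 (ad B a y)" if "a \<noteq> 2" "a < 16" for a y
          using 3(2) that by (auto simp: frame_def NEXT_def env_regs[OF e2])
        moreover from this have "prepared X m3" using p2 by (simp add: prepared_def)
        moreover have "R3 14 = R2 14" using 3(2) by (auto simp: frame_def NEXT_def)
        moreover have "m2 (ad B 5 (l * b + h)) =
           (if errors u X < e0 then mark u X (u l * b + h) else m (ad B 5 (l * b + h)))"
          if "l < k" "h < b" for l h
          using 5(1) 2(1) that m1[of 5] pos_less[OF that] by (simp add: errors_def)
        ultimately show ?case using 3(1) 5(1) e3 by (simp add: errors_def)
      qed (auto simp: NEXT_def)
    qed (use 2(1) acc_less env_bit[OF e] in \<open>auto simp: SCORE_def\<close>)
  qed (auto simp: defs)
qed

lemma best_so_far_step: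
  assumes best: "best_so_far X i R m" and X: "\<And>j i. X j i \<le> 1"
    and R': "R' 14 = min (errors (comb k N i) X) (R 14)"
    and m': "\<forall>l < k. \<forall>h < b. m' (ad B 5 (l * b + h)) =
         (if errors (comb k N i) X < R 14 then mark (comb k N i) X (comb k N i l * b + h) else m (ad B 5 (l * b + h)))"
  shows "best_so_far X (Suc i) R' m'"
proof (cases "errors (comb k N i) X < R 14")
  case True
  have "errors (comb k N i) X \<le> errors (comb k N i') X" if "i' < Suc i" for i'
  proof (cases "i' = i")
    case False
    then have "i' < i" "i \<noteq> 0" using that by auto
    then show ?thesis using best True by (fastforce simp: best_so_far_def)
  qed simp
  then show ?thesis using True R' m' unfolding best_so_far_def by (auto intro!: exI[of _ i])
next
  case False
  have "i \<noteq> 0"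
  proof
    assume "i = 0"
    then have "R 14 = r * q + 1" using best by (simp add: best_so_far_def)
    then show False using False errors_le[of X, OF X, of "comb k N i"] by simp
  qed
  then obtain i0 where i0: "i0 < i" "R 14 = errors (comb k N i0) X"
      "\<forall>i' < i. errors (comb k N i0) X \<le> errors (comb k N i') X"
      "\<forall>l < k. \<forall>h < b. m (ad B 5 (l * b + h)) = mark (comb k N i0) X (comb k N i0 l * b + h)"
    using best by (auto simp: best_so_far_def)
  then show ?thesis using False R' m' unfolding best_so_far_def
    by (auto intro!: exI[of _ i0] simp: less_Suc_eq)
qed

text \<open>The outer loop is timed by hand instead of through \<open>cost\<close>, because its
  \<open>N choose k\<close> rounds are not bounded by \<open>U\<close>.\<close>

lemma wp_MAIN:
  assumes e: "env X R m" and p: "prepared X m" and kN: "k \<le> N"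
  shows "wp H ((N choose k) * (4 + cost U BODY) + k * 20 + 40) MAIN
    (\<lambda>R' m'. env X R' m' \<and> best_so_far X (N choose k) R' m') R m"
proof -
  let ?T = "N choose k"
  have T: "0 < ?T" using kN by simp
  define J where "J i R' m' \<longleftrightarrow> env X R' m' \<and> prepared X m' \<and> best_so_far X i R' m' \<and> R' 13 = of_bool (i < ?T) \<and>
    (i < ?T \<longrightarrow> (\<forall>l \<le> k. m' (ad B 2 l) = comb k N i l))" for i R' m'
  have loop: "wp H (?T * (4 + cost U BODY) + 3) (While (Var 13) BODY)
      (\<lambda>R' m'. env X R' m' \<and> best_so_far X ?T R' m') R0 m0" if "J 0 R0 m0" for R0 m0
  proof -
    have "wp H (?T * (4 + cost U BODY) + 3) (While (Var 13) BODY) (J ?T) R0 m0"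
    proof (rule wp_While[where I = J and t = "cost U BODY", OF that], goal_cases)
      case (1 i R' m')
      then have J: "env X R' m'" "prepared X m'" "best_so_far X i R' m'" "R' 13 = 1"
          "\<And>l. l \<le> k \<Longrightarrow> m' (ad B 2 l) = comb k N i l"
        by (auto simp: J_def)
      have inc: "increasing k N (comb k N i)" using comb_rank[OF kN 1(1)] by simp
      obtain u' fl where s: "succ k (comb k N i, True) = (u', fl)" by fastforce
      then have fl: "fl \<longleftrightarrow> Suc i = ?T" using succ_comb_flag[OF kN 1(1)] by simp
      have "wpc U H BODY (J (Suc i)) R' m'"
      proof (rule wpc_mono[OF wp_BODY[OF J(1) inc J(5) J(2) refl s]], goal_cases)
        case (2 R2 m2)
        then have "best_so_far X (Suc i) R2 m2"
          by (intro best_so_far_step[OF J(3)]) (use env_bit[OF J(1)] in auto)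
        then show ?case using 2 s fl 1(1) by (auto simp: J_def)
      qed
      then show ?case using J(4) by simp
    qed (auto simp: J_def)
    then show ?thesis by (rule wp_mono) (auto simp: J_def)
  qed
  show ?thesis
    unfolding MAIN_def
  proof (rule wp_Seq[where ?t1.0 = "k * 20 + 10" and ?t2.0 = "?T * (4 + cost U BODY) + 29"],
      rule wp_For_time[where m = k and t = 9 and I = "\<lambda>x R' m'. \<forall>l < x. m' (ad B 2 l) = l"], goal_cases)
    case (4 x R' m')
    have e': "env X R' m'" by (rule env_frame[OF _ 4(2)]) (use e in auto)
    have "wpc U H (Wr 2 (Var 16) (Var 16)) (\<lambda>R'' m''. \<forall>l < Suc x. m'' (ad B 2 l) = l) R' m'"
      using 4 kH by (intro wpc_Wr) (auto simp: env_regs[OF e'] less_Suc_eq)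
    then show ?case by (rule wp_mono) (auto simp: Wr_def AD_def)
  next
    case (7 R1 m1)
    have e1: "env X R1 m1" by (rule env_frame[OF _ 7(1)]) (use e in auto)
    have p1: "prepared X m1" by (rule prepared_frame[OF _ 7(1)]) (use e p in auto)
    let ?m = "m1(ad B 2 k := N)" and ?R = "R1(14 := r * q + 1, 13 := 1)"
    have "J 0 ?R ?m" using e1 p1 T 7(3) by (auto simp: J_def best_so_far_def)
    from loop[OF this] have l: "wp H (?T * (4 + cost U BODY) + 3) (While (Var 13) BODY)
        (\<lambda>R' m'. env X R' m' \<and> best_so_far X ?T R' m') ?R ?m" .
    have l2: "wp H (?T * (4 + cost U BODY) + 6) (13 \<^bold>:= Lit 1 \<^bold>; While (Var 13) BODY)
        (\<lambda>R' m'. env X R' m' \<and> best_so_far X ?T R' m') (R1(14 := r * q + 1)) ?m"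
      by (rule wp_Seq[OF wp_Assign]) (use l H2 in auto)
    have l3: "wp H (?T * (4 + cost U BODY) + 13)
        (14 \<^bold>:= Var 8 \<^bold>* Var 4 \<^bold>+ Lit 1 \<^bold>; 13 \<^bold>:= Lit 1 \<^bold>; While (Var 13) BODY)
        (\<lambda>R' m'. env X R' m' \<and> best_so_far X ?T R' m') R1 ?m"
      by (rule wp_Seq[OF wp_Assign[where t = 6], where ?t2.0 = "?T * (4 + cost U BODY) + 6"]) (use l2 rqH in \<open>auto simp: env_regs[OF e1]\<close>)
    show ?case
      unfolding Wr_def
      by (rule wp_Seq[OF wp_Store[where t = 10], where ?t2.0 = "?T * (4 + cost U BODY) + 13"]) (use l3 NH in \<open>auto simp: AD_def ad_def env_regs[OF e1]\<close>)
  qed (use env_regs[OF e] kH in \<open>auto simp: frame_def\<close>)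
qed

end

section \<open>Runs that draw samples\<close>

text \<open>The final state is a function \<open>F\<close> of the list of samples, so statements
  about the run become statements about independent samples. \<open>T\<close> is both the number of
  steps and the time allowed, and all outcomes consume the same number \<open>m\<close> of
  samples.\<close>

definition srun :: "nat \<Rightarrow> (bit Matrix.vec \<times> bit) pmf \<Rightarrow> nat \<Rightarrow> nat \<Rightarrow> com \<Rightarrow> state \<Rightarrow>
    ((bit Matrix.vec \<times> bit) list \<Rightarrow> state \<Rightarrow> bool) \<Rightarrow> bool" where
  "srun w D m T c \<sigma> Q \<longleftrightarrow> (\<exists>F. run T w D c \<sigma> = map_pmf (\<lambda>zs. (Skip, F zs)) (replicate_pmf m D) \<and>
     (\<forall>zs \<in> set_pmf (replicate_pmf m D). time (F zs) \<le> time \<sigma> + T \<and> Q zs (F zs)))"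

lemma halted_map [simp]: "halted (map_pmf (\<lambda>z. (Skip, F z)) \<mu>)"
  by (auto simp: halted_def)

lemma srun_mono:
  assumes "srun w D m T c \<sigma> Q" "T \<le> T'"
    and "\<And>zs \<sigma>'. zs \<in> set_pmf (replicate_pmf m D) \<Longrightarrow> Q zs \<sigma>' \<Longrightarrow> Q' zs \<sigma>'"
  shows "srun w D m T' c \<sigma> Q'"
proof -
  obtain F where F: "run T w D c \<sigma> = map_pmf (\<lambda>zs. (Skip, F zs)) (replicate_pmf m D)"
      "\<forall>zs \<in> set_pmf (replicate_pmf m D). time (F zs) \<le> time \<sigma> + T \<and> Q zs (F zs)"
    using assms(1) by (auto simp: srun_def)
  have "run T' w D c \<sigma> = run T w D c \<sigma>" using assms(2) by (intro run_mono) (auto simp: F)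
  then show ?thesis unfolding srun_def using F assms(2,3) by (intro exI[of _ F]) fastforce
qed

text \<open>The second part depends on the state left by the first, so its final-state function is
  chosen separately for each list \<open>zs\<close>; the composed function splits its list after
  \<open>m1\<close> samples.\<close>

lemma srun_Seq:
  assumes 1: "srun w D m1 T1 c1 \<sigma> Q1"
    and 2: "\<And>zs \<sigma>'. zs \<in> set_pmf (replicate_pmf m1 D) \<Longrightarrow> Q1 zs \<sigma>' \<Longrightarrow>
      srun w D m2 T2 c2 (tick 1 \<sigma>') (\<lambda>zs'. Q (zs @ zs'))"
  shows "srun w D (m1 + m2) (T1 + T2 + 1) (Seq c1 c2) \<sigma> Q"
proof -
  let ?S1 = "set_pmf (replicate_pmf m1 D)" and ?S2 = "set_pmf (replicate_pmf m2 D)"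
  obtain F1 where F1: "run T1 w D c1 \<sigma> = map_pmf (\<lambda>zs. (Skip, F1 zs)) (replicate_pmf m1 D)"
      "\<And>zs. zs \<in> ?S1 \<Longrightarrow> time (F1 zs) \<le> time \<sigma> + T1" "\<And>zs. zs \<in> ?S1 \<Longrightarrow> Q1 zs (F1 zs)"
    using 1 by (auto simp: srun_def)
  have "\<forall>zs. \<exists>G. zs \<in> ?S1 \<longrightarrow>
      run T2 w D c2 (tick 1 (F1 zs)) = map_pmf (\<lambda>zs'. (Skip, G zs')) (replicate_pmf m2 D) \<and>
      (\<forall>zs' \<in> ?S2. time (G zs') \<le> time (F1 zs) + 1 + T2 \<and> Q (zs @ zs') (G zs'))"
    using 2 F1(3) unfolding srun_def by fastforce
  then obtain F2 where F2: "\<And>zs. zs \<in> ?S1 \<Longrightarrow>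
      run T2 w D c2 (tick 1 (F1 zs)) = map_pmf (\<lambda>zs'. (Skip, F2 zs zs')) (replicate_pmf m2 D)"
      "\<And>zs zs'. zs \<in> ?S1 \<Longrightarrow> zs' \<in> ?S2 \<Longrightarrow> time (F2 zs zs') \<le> time (F1 zs) + 1 + T2"
      "\<And>zs zs'. zs \<in> ?S1 \<Longrightarrow> zs' \<in> ?S2 \<Longrightarrow> Q (zs @ zs') (F2 zs zs')"
    by metis
  define F where "F zs = F2 (take m1 zs) (drop m1 zs)" for zs
  have len: "length zs = m1" if "zs \<in> ?S1" for zs using that by (auto simp: set_replicate_pmf)
  have "run (T1 + T2 + 1) w D (Seq c1 c2) \<sigma> =
      bind_pmf (run T1 w D c1 \<sigma>) (\<lambda>(c', \<sigma>'). run T2 w D c2 (tick 1 \<sigma>'))"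
    using F2(1) by (intro run_Seq) (auto simp: F1(1))
  also have "\<dots> = bind_pmf (replicate_pmf m1 D) (\<lambda>zs. run T2 w D c2 (tick 1 (F1 zs)))"
    by (simp add: F1(1) bind_map_pmf)
  also have "\<dots> = bind_pmf (replicate_pmf m1 D) (\<lambda>zs. map_pmf (\<lambda>zs'. (Skip, F (zs @ zs'))) (replicate_pmf m2 D))"
    using F2(1) len by (intro bind_pmf_cong refl) (simp add: F_def)
  also have "\<dots> = map_pmf (\<lambda>zs. (Skip, F zs)) (replicate_pmf (m1 + m2) D)"
    by (simp add: replicate_pmf_distrib map_bind_pmf map_pmf_def bind_assoc_pmf bind_return_pmf)
  finally have "run (T1 + T2 + 1) w D (Seq c1 c2) \<sigma> = map_pmf (\<lambda>zs. (Skip, F zs)) (replicate_pmf (m1 + m2) D)" .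
  moreover have "time (F zs) \<le> time \<sigma> + (T1 + T2 + 1) \<and> Q zs (F zs)"
    if "zs \<in> set_pmf (replicate_pmf (m1 + m2) D)" for zs
  proof -
    have t: "take m1 zs \<in> ?S1" "drop m1 zs \<in> ?S2"
      using that by (auto simp: set_replicate_pmf in_lists_conv_set dest: in_set_takeD in_set_dropD)
    have "time (F zs) \<le> time (F1 (take m1 zs)) + 1 + T2" using F2(2)[OF t] by (simp add: F_def)
    then show ?thesis using F2(3)[OF t] F1(2)[OF t(1)] by (simp add: F_def)
  qed
  ultimately show ?thesis unfolding srun_def by blast
qed

lemma srun_wp:
  assumes "wp H T c Q (reg \<sigma>) (mem \<sigma>)" "small H (reg \<sigma>) (mem \<sigma>)" "fits H d c" "2 \<le> H" "H ^ d < 2 ^ w"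
  shows "srun w D 0 T c \<sigma> (\<lambda>zs \<sigma>'. Q (reg \<sigma>') (mem \<sigma>') \<and> drawn \<sigma>' = drawn \<sigma> \<and> small H (reg \<sigma>') (mem \<sigma>'))"
proof -
  obtain t R' M' where t: "ex H c (reg \<sigma>) (mem \<sigma>) t R' M'" "t \<le> T" "Q R' M'"
    using assms(1) by (auto simp: wp_def)
  have r: "run t w D c \<sigma> = return_pmf (Skip, goto t R' M' \<sigma>)"
    by (rule ex_run[OF t(1) assms(2-5)]) auto
  then have "run T w D c \<sigma> = run t w D c \<sigma>" using t(2) by (intro run_mono) auto
  then show ?thesis
    using t r ex_small[OF t(1) assms(2)] unfolding srun_def
    by (intro exI[of _ "\<lambda>_. goto t R' M' \<sigma>"]) auto
qed

lemma srun_Draw: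
  assumes "\<And>z. z \<in> set_pmf D \<Longrightarrow> dim_vec (fst z) = n"
  shows "srun w D 1 (exp_cost e + n + 1) (Draw e) \<sigma>
    (\<lambda>zs \<sigma>'. \<sigma>' = tick (exp_cost e) (receive (exp_val w \<sigma> e) (hd zs) \<sigma>))"
proof -
  let ?F = "\<lambda>zs. tick (exp_cost e) (receive (exp_val w \<sigma> e) (hd zs) \<sigma>)"
  have r: "run 1 w D (Draw e) \<sigma> = map_pmf (\<lambda>zs. (Skip, ?F zs)) (replicate_pmf 1 D)"
    by (simp add: run_Suc replicate_pmf_1[simplified] map_pmf_comp bind_map_pmf map_pmf_def bind_assoc_pmf bind_return_pmf)
  have "run (exp_cost e + n + 1) w D (Draw e) \<sigma> = run 1 w D (Draw e) \<sigma>"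
    by (rule run_mono) (simp_all only: r halted_map)
  moreover have "time (?F zs) \<le> time \<sigma> + (exp_cost e + n + 1)"
    if "zs \<in> set_pmf (replicate_pmf 1 D)" for zs
  proof -
    have "dim_vec (fst (hd zs)) = n"
      using that assms by (auto simp: set_replicate_pmf length_Suc_conv)
    then show ?thesis by (auto simp: receive_def split: prod.splits)
  qed
  ultimately show ?thesis unfolding srun_def using r by (intro exI[of _ ?F]) auto
qed

lemma srun_While:
  assumes "exp_val w (tick 1 \<sigma>) e \<noteq> 0" "srun w D m T (Seq c (While e c)) (tick (2 + exp_cost e) \<sigma>) Q"
  shows "srun w D m (T + 2 + exp_cost e) (While e c) \<sigma> Q"
proof -
  obtain F where F: "run T w D (Seq c (While e c)) (tick (2 + exp_cost e) \<sigma>) =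
        map_pmf (\<lambda>zs. (Skip, F zs)) (replicate_pmf m D)"
      "\<forall>zs \<in> set_pmf (replicate_pmf m D). time (F zs) \<le> time \<sigma> + (2 + exp_cost e) + T \<and> Q zs (F zs)"
    using assms(2) by (auto simp: srun_def)
  have *: "run (Suc (Suc T)) w D (While e c) \<sigma> = map_pmf (\<lambda>zs. (Skip, F zs)) (replicate_pmf m D)"
    unfolding run_While run_If using assms(1) F(1) by (simp add: tick_tick)
  then have "run (T + 2 + exp_cost e) w D (While e c) \<sigma> = map_pmf (\<lambda>zs. (Skip, F zs)) (replicate_pmf m D)"
    using run_mono[of "Suc (Suc T)" w D "While e c" \<sigma> "T + 2 + exp_cost e"] by simp
  then show ?thesis unfolding srun_def using F(2) by (intro exI[of _ F]) auto
qed

lemma srun_While_exit: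
  assumes "exp_val w (tick 1 \<sigma>) e = 0"
  shows "srun w D 0 (2 + exp_cost e) (While e c) \<sigma> (\<lambda>zs \<sigma>'. \<sigma>' = tick (2 + exp_cost e) \<sigma>)"
proof -
  have *: "run (Suc (Suc 0)) w D (While e c) \<sigma> = return_pmf (Skip, tick (2 + exp_cost e) \<sigma>)"
    unfolding run_While run_If using assms by (simp add: tick_tick)
  then have "run (2 + exp_cost e) w D (While e c) \<sigma> = return_pmf (Skip, tick (2 + exp_cost e) \<sigma>)"
    using run_mono[of "Suc (Suc 0)" w D "While e c" \<sigma> "2 + exp_cost e"] by simp
  then show ?thesis unfolding srun_def by (intro exI[of _ "\<lambda>_. tick (2 + exp_cost e) \<sigma>"]) auto
qed

text \<open>Every index from \<open>n\<close> on reads the label. This makes the function total with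
  values 0 and 1, as \<open>env\<close> demands.\<close>

definition sample_bit :: "nat \<Rightarrow> bit Matrix.vec \<times> bit \<Rightarrow> nat \<Rightarrow> nat" where
  "sample_bit n z i = (if i < n then of_bool (fst z $ i = 1) else of_bool (snd z = 1))"

lemma sample_bit_le1: "sample_bit n z i \<le> 1"
  by (simp add: sample_bit_def)

lemma mem_receive:
  assumes "dim_vec (fst z) = n"
  shows "mem (receive a z \<sigma>) x = (if a \<le> x \<and> x \<le> a + n then sample_bit n z (x - a) else mem \<sigma> x)"
  using assms by (auto simp: receive_def sample_bit_def split: prod.splits)

definition DRAW :: com where "DRAW =
  For 33 (Var 11) (Draw (Var 0 \<^bold>+ Var 33 \<^bold>* (Var 0 \<^bold>+ Lit 1)))"

definition drew :: "nat \<Rightarrow> nat \<Rightarrow> state \<Rightarrow> (bit Matrix.vec \<times> bit) list \<Rightarrow> state \<Rightarrow> bool" where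
  "drew n j \<sigma> zs \<sigma>' \<longleftrightarrow> (\<forall>r. r \<noteq> 33 \<longrightarrow> reg \<sigma>' r = reg \<sigma> r) \<and> reg \<sigma>' 33 = j + length zs \<and>
     drawn \<sigma>' = drawn \<sigma> + length zs \<and>
     (\<forall>l < length zs. \<forall>i \<le> n. mem \<sigma>' (n + (j + l) * (n + 1) + i) = sample_bit n (zs ! l) i) \<and>
     (\<forall>x. x < n + j * (n + 1) \<or> n + (j + length zs) * (n + 1) \<le> x \<longrightarrow> mem \<sigma>' x = mem \<sigma> x)"

text \<open>Drawing has no rule in \<open>ex\<close>, so this loop is handled directly, by induction
  on the number \<open>d\<close> of samples still to be drawn.\<close>

lemma srun_DRAW_loop:
  assumes D: "\<And>z. z \<in> set_pmf D \<Longrightarrow> dim_vec (fst z) = n"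
    and H: "2 \<le> H" "H ^ 5 < 2 ^ w"
  shows "small H (reg \<sigma>) (mem \<sigma>) \<Longrightarrow> reg \<sigma> 0 = n \<Longrightarrow> reg \<sigma> 11 = j + d \<Longrightarrow> reg \<sigma> 33 = j \<Longrightarrow>
    srun w D d (d * (n + 24) + 5)
      (While (Var 33 \<^bold>< Var 11)
         (Seq (Draw (Var 0 \<^bold>+ Var 33 \<^bold>* (Var 0 \<^bold>+ Lit 1))) (Assign 33 (Var 33 \<^bold>+ Lit 1))))
      \<sigma> (drew n j \<sigma>)"
proof (induction d arbitrary: j \<sigma>)
  case 0
  have "exp_val w (tick 1 \<sigma>) (Var 33 \<^bold>< Var 11) = 0" using 0 by simp
  from srun_While_exit[OF this] show ?case
    by (rule srun_mono) (use 0 in \<open>auto simp: drew_def set_replicate_pmf\<close>)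
next
  case (Suc d)
  let ?A = "Var 0 \<^bold>+ Var 33 \<^bold>* (Var 0 \<^bold>+ Lit 1)"
  let ?c = "Seq (Draw ?A) (Assign 33 (Var 33 \<^bold>+ Lit 1))"
  let ?W = "While (Var 33 \<^bold>< Var 11) ?c"
  have jH: "Suc j \<le> H" using Suc.prems(1,3) unfolding small_def
    by (metis Suc_leI add_Suc_right le_add1 le_trans not_less_eq_eq add_Suc)
  have ev: "exp_val w \<sigma>' e = uval (reg \<sigma>') (mem \<sigma>') e"
    if "small H (reg \<sigma>') (mem \<sigma>')" "supported H e" "deg e \<le> 5" for \<sigma>' e
    using exp_val_eq_uval[OF that(1) H that(2,3)] by simp
  have one: "srun w D 1 (n + 16) ?c \<sigma>'
      (\<lambda>zs \<sigma>''. drew n j \<sigma> zs \<sigma>'' \<and> small H (reg \<sigma>'') (mem \<sigma>''))"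
    if \<sigma>': "reg \<sigma>' = reg \<sigma>" "mem \<sigma>' = mem \<sigma>" "drawn \<sigma>' = drawn \<sigma>" for \<sigma>'
  proof -
    have a: "exp_val w \<sigma>' ?A = n + j * (n + 1)"
      using Suc.prems H by (subst ev) (auto simp: \<sigma>')
    have "srun w D (1 + 0) ((7 + n + 1) + 4 + 1) ?c \<sigma>'
      (\<lambda>zs \<sigma>''. drew n j \<sigma> zs \<sigma>'' \<and> small H (reg \<sigma>'') (mem \<sigma>''))"
    proof (rule srun_Seq)
      show "srun w D 1 (7 + n + 1) (Draw ?A) \<sigma>'
          (\<lambda>zs \<sigma>''. \<sigma>'' = tick (exp_cost ?A) (receive (exp_val w \<sigma>' ?A) (hd zs) \<sigma>'))"
        by (rule srun_mono[OF srun_Draw[OF D]]) (simp_all del: exp_val.simps)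
    next
      fix zs \<sigma>1
      assume zs: "zs \<in> set_pmf (replicate_pmf 1 D)"
        and s1: "\<sigma>1 = tick (exp_cost ?A) (receive (exp_val w \<sigma>' ?A) (hd zs) \<sigma>')"
      obtain z where z: "zs = [z]" "dim_vec (fst z) = n"
        using zs D by (auto simp: set_replicate_pmf length_Suc_conv)
      have reg1: "reg \<sigma>1 = reg \<sigma>" "drawn \<sigma>1 = drawn \<sigma> + 1"
        unfolding s1 using \<sigma>' by (auto simp: receive_def split: prod.splits)
      have mem1: "mem \<sigma>1 x = (if n + j * (n + 1) \<le> x \<and> x \<le> n + j * (n + 1) + n
          then sample_bit n z (x - (n + j * (n + 1))) else mem \<sigma> x)" for x
        unfolding s1 a using mem_receive[OF z(2)] \<sigma>' by (simp add: z(1))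
      have sb: "sample_bit n z i \<le> H" for i using sample_bit_le1[of n z i] H(1) by linarith
      have sm: "small H (reg (tick 1 \<sigma>1)) (mem (tick 1 \<sigma>1))"
        using Suc.prems(1) sb
        unfolding small_def tick_simps reg1 mem1 by auto
      have "wp H 4 (Assign 33 (Var 33 \<^bold>+ Lit 1)) (\<lambda>R m. R = (reg \<sigma>)(33 := Suc j) \<and> m = mem \<sigma>1)
          (reg (tick 1 \<sigma>1)) (mem (tick 1 \<sigma>1))"
        using jH Suc.prems by (intro wp_Assign) (auto simp: reg1)
      from srun_wp[OF this sm _ H(1) H(2), of D]
      have "srun w D 0 4 (Assign 33 (Var 33 \<^bold>+ Lit 1)) (tick 1 \<sigma>1) (\<lambda>zs \<sigma>'. (reg \<sigma>' = (reg \<sigma>)(33 := Suc j) \<and> mem \<sigma>' = mem \<sigma>1)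
         \<and> drawn \<sigma>' = drawn (tick 1 \<sigma>1) \<and> small H (reg \<sigma>') (mem \<sigma>'))"
        using H by simp
      then show "srun w D 0 4 (Assign 33 (Var 33 \<^bold>+ Lit 1)) (tick 1 \<sigma>1)
          (\<lambda>zs' \<sigma>''. drew n j \<sigma> (zs @ zs') \<sigma>'' \<and> small H (reg \<sigma>'') (mem \<sigma>''))"
      proof (rule srun_mono, goal_cases)
        case (2 zs2 \<sigma>2)
        then have "zs2 = []" by simp
        then show ?case using 2 mem1 reg1(2) unfolding drew_def by (auto simp: z)
      qed simp
    qed
    then have "srun w D 1 ((7 + n + 1) + 4 + 1) ?c \<sigma>'
      (\<lambda>zs \<sigma>''. drew n j \<sigma> zs \<sigma>'' \<and> small H (reg \<sigma>'') (mem \<sigma>''))"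
      by (simp only: add_0_right)
    then show ?thesis by (rule srun_mono) auto
  qed
  have c: "exp_val w (tick 1 \<sigma>) (Var 33 \<^bold>< Var 11) \<noteq> 0"
    using Suc.prems H by (subst ev) auto
  have seq: "srun w D (1 + d) ((n + 16) + (d * (n + 24) + 5) + 1) (Seq ?c ?W) (tick (2 + 3) \<sigma>) (drew n j \<sigma>)"
  proof (rule srun_Seq[OF one])
    fix zs \<sigma>1
    assume zs: "zs \<in> set_pmf (replicate_pmf 1 D)" and d1: "drew n j \<sigma> zs \<sigma>1 \<and> small H (reg \<sigma>1) (mem \<sigma>1)"
    obtain z where z: "zs = [z]"
      using zs by (auto simp: set_replicate_pmf length_Suc_conv)
    have "srun w D d (d * (n + 24) + 5) ?W (tick 1 \<sigma>1) (drew n (Suc j) (tick 1 \<sigma>1))"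
      by (rule Suc.IH) (use d1 Suc.prems in \<open>auto simp: drew_def z\<close>)
    then show "srun w D d (d * (n + 24) + 5) ?W (tick 1 \<sigma>1) (\<lambda>zs'. drew n j \<sigma> (zs @ zs'))"
    proof (rule srun_mono, goal_cases)
      case (2 zs2 \<sigma>2)
      have "mem \<sigma>2 (n + (j + l) * (n + 1) + i) = sample_bit n ((z # zs2) ! l) i"
        if l: "l < Suc (length zs2)" "i \<le> n" for l i
      proof (cases l)
        case 0
        have "n + j * (n + 1) + i < n + Suc j * (n + 1)" using l by simp
        then have "mem \<sigma>2 (n + j * (n + 1) + i) = mem \<sigma>1 (n + j * (n + 1) + i)"
          using 2(2) unfolding drew_def tick_simps by blast
        then show ?thesis using d1 l 0 by (auto simp: drew_def z)
      next
        case (Suc l')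
        then have "mem \<sigma>2 (n + (Suc j + l') * (n + 1) + i) = sample_bit n (zs2 ! l') i"
          using 2(2) l unfolding drew_def by auto
        then show ?thesis using Suc by simp
      qed
      moreover have "mem \<sigma>2 x = mem \<sigma> x"
        if "x < n + j * (n + 1) \<or> n + (j + Suc (length zs2)) * (n + 1) \<le> x" for x
      proof -
        have "n + Suc j * (n + 1) \<le> x" if "n + (j + Suc (length zs2)) * (n + 1) \<le> x"
          by (rule order.trans[OF _ that]) (intro add_left_mono mult_right_mono, auto)
        then have "x < n + Suc j * (n + 1) \<or> n + (Suc j + length zs2) * (n + 1) \<le> x"
            "x < n + j * (n + 1) \<or> n + (j + length zs) * (n + 1) \<le> x"
          using that by (auto simp: z)
        then show ?thesis using 2(2) d1 unfolding drew_def tick_simps by metis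
      qed
      ultimately show ?case using 2(2) d1 unfolding drew_def by (auto simp: z)
    qed simp
  qed simp_all
  have "srun w D (1 + d) ((n + 16) + (d * (n + 24) + 5) + 1 + 2 + exp_cost (Var 33 \<^bold>< Var 11)) ?W \<sigma> (drew n j \<sigma>)"
    by (rule srun_While[OF c]) (use seq in simp)
  then have "srun w D (Suc d) ((n + 16) + (d * (n + 24) + 5) + 1 + 2 + exp_cost (Var 33 \<^bold>< Var 11)) ?W \<sigma> (drew n j \<sigma>)"
    by (simp only: plus_1_eq_Suc)
  then show ?case by (rule srun_mono) auto
qed

section \<open>Drawing the samples\<close>

text \<open>A loop rule without the frame, for \<open>OUT\<close>: its stores go to the answer cells
  below the arrays and are therefore not \<open>array_only\<close>.\<close>

lemma wp_For_plain:
  assumes I0: "I 0 (R(r := 0)) M"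
    and step: "\<And>i R' M'. i < m \<Longrightarrow> R' r = i \<Longrightarrow> I i R' M' \<Longrightarrow>
      wp H t c (\<lambda>R'' M''. R'' r = i \<and> I (Suc i) (R''(r := Suc i)) M'') R' M'"
    and bd: "\<And>i R' M'. i \<le> m \<Longrightarrow> R' r = i \<Longrightarrow> I i R' M' \<Longrightarrow> uval R' M' e = m"
    and m: "m \<le> H"
    and Q: "\<And>R' M'. R' r = m \<Longrightarrow> I m R' M' \<Longrightarrow> Q R' M'"
    and time: "m * (10 + exp_cost e + t) + 7 + exp_cost e \<le> T"
  shows "wp H T (For r e c) Q R M"
proof -
  define J where "J i R' M' \<longleftrightarrow> R' r = i \<and> I i R' M'" for i R' M'
  have "wp H (t + 5) (Seq c (Assign r (Bin Add (Var r) (Lit 1)))) (J (Suc i)) R' M'"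
    if "i < m" and J: "J i R' M'" for i R' M'
  proof (rule wp_Seq)
    have "wp H t c (\<lambda>R'' M''. R'' r = i \<and> I (Suc i) (R''(r := Suc i)) M'') R' M'"
      using that by (intro step) (auto simp: J_def)
    then show "wp H t c (wp H 4 (Assign r (Bin Add (Var r) (Lit 1))) (J (Suc i))) R' M'"
      by (rule wp_mono) (use that m in \<open>auto simp: J_def intro!: wp_Assign\<close>)
  qed simp
  moreover have "uval R' M' (Bin Less (Var r) e) = of_bool (i < m)" if "J i R' M'" "i \<le> m" for i R' M'
    using bd[of i R' M'] that by (auto simp: J_def)
  moreover have "J 0 (R(r := 0)) M" using I0 by (auto simp: J_def)
  moreover have "m * (3 + exp_cost (Bin Less (Var r) e) + (t + 5)) + 2 + exp_cost (Bin Less (Var r) e)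
      \<le> m * (10 + exp_cost e + t) + 4 + exp_cost e"
    by (simp add: algebra_simps)
  ultimately have "wp H (m * (10 + exp_cost e + t) + 4 + exp_cost e)
      (While (Bin Less (Var r) e) (Seq c (Assign r (Bin Add (Var r) (Lit 1))))) (J m) (R(r := 0)) M"
    by (intro wp_While[where I = J]) (auto simp del: uval.simps)
  then have "wp H (m * (10 + exp_cost e + t) + 4 + exp_cost e)
      (While (Bin Less (Var r) e) (Seq c (Assign r (Bin Add (Var r) (Lit 1))))) Q (R(r := 0)) M"
    by (rule wp_mono) (auto simp: J_def Q)
  then show ?thesis
    unfolding For_def using time
    by (intro wp_Seq[where ?t1.0 = 2] wp_Assign) auto
qed

section \<open>Lookup table, packed columns and output\<close>

definition PC :: com where "PC =
  For 33 (Var 12) (Wr 0 (Var 33) (Rd 0 (Bin Div (Var 33) (Lit 2)) \<^bold>+ Bin Mod (Var 33) (Lit 2)))"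

definition WORD :: com where "WORD =
  (36 \<^bold>:= Lit 0 \<^bold>;
   For 35 (Var 4) (36 \<^bold>:= Var 36 \<^bold>+ Var 36 \<^bold>+
     Mem (Var 0 \<^bold>+ (Var 5 \<^bold>+ (Var 34 \<^bold>* Var 4 \<^bold>+ Var 35)) \<^bold>* (Var 0 \<^bold>+ Lit 1) \<^bold>+ Var 33)))"

definition COLUMNS :: com where "COLUMNS =
  For 33 (Var 0 \<^bold>+ Lit 1)
    (For 34 (Var 8) (WORD \<^bold>; Wr 10 (Var 33 \<^bold>* Var 8 \<^bold>+ Var 34) (Var 36)))"

definition OUT :: com where "OUT =
  (For 33 (Var 0) (Store (Var 33) (Lit 0)) \<^bold>;
   For 33 (Var 1 \<^bold>* Var 2) (If (Rd 5 (Var 33)) (Store (Rd 5 (Var 33) \<^bold>- Lit 1) (Lit 1)) Skip))"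

context lspn
begin

text \<open>Entry \<open>v\<close> is obtained from entry \<open>v div 2\<close>. Entry 0 is
  computed from itself, so its cell has to be 0 beforehand.\<close>

lemma wp_PC:
  assumes e: "env X R m" and 12: "R 12 = 2 ^ q" and z: "m (ad B 0 0) = 0"
  shows "wp H (2 ^ q * 50 + 20) PC (\<lambda>R' m'. \<forall>v < 2 ^ q. m' (ad B 0 v) = popcount v) R m"
  unfolding PC_def
proof (rule wp_For_time[where m = "2 ^ q" and t = 39 and I = "\<lambda>x R' m'. m' (ad B 0 0) = 0 \<and>
    (\<forall>v < x. m' (ad B 0 v) = popcount v)"], goal_cases)
  case (4 x R' m')
  have e': "env X R' m'" by (rule env_frame[OF _ 4(2)]) (use e in auto)
  have rec: "m' (ad B 0 (x div 2)) + x mod 2 = popcount x"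
  proof (cases "x = 0")
    case False
    then have "m' (ad B 0 (x div 2)) = popcount (x div 2)" using 4(4) by simp
    then show ?thesis using False by (subst popcount.simps) simp
  qed (use 4 in \<open>simp add: popcount.simps\<close>)
  have "popcount x \<le> H"
  proof -
    have "popcount x \<le> q" using 4(1) by (rule popcount_le)
    also have "q \<le> 2 ^ q" by simp
    finally show ?thesis using qpH by simp
  qed
  then have "wpc 0 H (Wr 0 (Var 33) (Rd 0 (Bin Div (Var 33) (Lit 2)) \<^bold>+ Bin Mod (Var 33) (Lit 2)))
      (\<lambda>R'' m''. m'' (ad B 0 0) = 0 \<and> (\<forall>v < Suc x. m'' (ad B 0 v) = popcount v)) R' m'"
    using 4 rec by (intro wpc_Wr) (auto simp: env_regs[OF e'] less_Suc_eq popcount.simps[of 0])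
  then show ?case by (rule wp_mono) (auto simp: Wr_def AD_def)
qed (use qpH 12 z in \<open>auto simp: frame_def\<close>)

lemma wp_WORD:
  assumes e: "env X R m" and i: "R 33 = i" "i \<le> n" and a: "R 34 = a" "a < r"
  shows "wp H (q * 40 + 20) WORD (\<lambda>R' m'. R' 36 = col X i a) R m"
proof -
  let ?f = "\<lambda>h. X (M + (a * q + h)) i"
  have lt: "M + (a * q + h) < M + r * q" if "h < q" for h
  proof -
    have "Suc a * q \<le> r * q" using a by (intro mult_right_mono) auto
    then show ?thesis using that by simp
  qed
  have leq: "2 * horner ?f h + ?f h \<le> H" if "h < q" for h
  proof -
    have "horner ?f (Suc h) < 2 ^ Suc h" using env_bit[OF e] by (intro horner_less) auto
    also have "\<dots> \<le> 2 ^ q" using that by (intro power_increasing) auto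
    finally show ?thesis using qpH by simp
  qed
  show ?thesis
    unfolding WORD_def
  proof (rule wp_Seq[where ?t1.0 = 2 and ?t2.0 = "q * 40 + 10"], rule wp_Assign, simp_all,
      rule wp_For_time[where m = q and t = 25 and I = "\<lambda>h R' m'. R' 36 = horner ?f h"], goal_cases)
    case (4 h R' m')
    have e': "env X R' m'" by (rule env_frame[OF _ 4(2)]) (use e in auto)
    have R': "R' 33 = i" "R' 34 = a" using 4(2) i a by (auto simp: frame_def)
    show ?case
      using 4 R' leq[OF 4(1)] env_mem[OF e' lt[OF 4(1)] i(2)]
      by (intro wp_Assign) (auto simp: env_regs[OF e'])
  next
    case 6
    have "q < 2 ^ q" by (rule less_exp)
    then show ?case using qpH by linarith
  qed (use env_regs[OF e] in \<open>auto simp: frame_def col_def\<close>)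
qed

lemma wp_COLUMNS:
  assumes e: "env X R m"
  shows "wp H ((n + 1) * (30 + (r * (q * 40 + 60) + 20)) + 20) COLUMNS
    (\<lambda>R' m'. \<forall>i \<le> n. \<forall>a < r. m' (ad B 10 (i * r + a)) = col X i a) R m"
  unfolding COLUMNS_def
proof (rule wp_For_time[where m = "n + 1" and t = "r * (q * 40 + 60) + 20" and
    I = "\<lambda>x R' m'. \<forall>i < x. \<forall>a < r. m' (ad B 10 (i * r + a)) = col X i a"], goal_cases)
  case (4 i R1 m1)
  have e1: "env X R1 m1" by (rule env_frame[OF _ 4(2)]) (use e in \<open>auto simp: WORD_def\<close>)
  have colH: "col X i a \<le> H" for a
    using col_less[of X i a] env_bit[OF e] qpH by (auto intro: order.trans less_imp_le)
  show ?case
  proof (rule wp_For_time[where m = r and t = "q * 40 + 45" and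
    I = "\<lambda>x R' m'. \<forall>i' \<le> i. \<forall>a < r. i' < i \<or> a < x \<longrightarrow> m' (ad B 10 (i' * r + a)) = col X i' a"], goal_cases)
    case (4 a R2 m2)
    have e2: "env X R2 m2" by (rule env_frame[OF _ 4(2)]) (use e1 in \<open>auto simp: WORD_def\<close>)
    have R2: "R2 33 = i" using 4(2) \<open>R1 33 = i\<close> by (auto simp: frame_def WORD_def)
    have i: "i \<le> n" using \<open>i < n + 1\<close> by simp
    show ?case
    proof (rule wp_Seq[where ?t1.0 = "q * 40 + 20" and ?t2.0 = 20],
        rule wp_mono[OF wp_frame[OF wp_WORD[OF e2 R2 i 4(3,1)]] order_refl], goal_cases)
      case (2 R3 m3)
      have e3: "env X R3 m3" by (rule env_frame[of X R2 m2]) (use e2 2 in \<open>auto simp: WORD_def\<close>)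
      have m3: "m3 = m2" and R3: "R3 33 = i" "R3 34 = a"
        using 2 R2 4(3) by (auto simp: WORD_def frame_def)
      have "wpc 0 H (Wr 10 (Var 33 \<^bold>* Var 8 \<^bold>+ Var 34) (Var 36)) (\<lambda>R' m'. \<forall>i' \<le> i. \<forall>a' < r. i' < i \<or> a' < Suc a \<longrightarrow>
           m' (ad B 10 (i' * r + a')) = col X i' a') R3 m3"
        using 2 4(1,4) colH
        by (intro wpc_Wr) (auto simp: env_regs[OF e3] m3 R3 less_Suc_eq)
      then show ?case by (rule wp_mono) (auto simp: Wr_def AD_def)
    qed (auto simp: WORD_def)
  qed (use 4 env_regs[OF e1] rH in \<open>auto simp: frame_def WORD_def less_Suc_eq algebra_simps\<close>)
qed (use env_regs[OF e] nH in \<open>auto simp: frame_def WORD_def algebra_simps\<close>)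

lemma wp_OUT:
  assumes e: "env X R m" and c: "\<And>y. y < k * b \<Longrightarrow> m (ad B 5 y) = c y \<and> c y \<le> n"
  shows "wp H (n * 15 + k * b * 40 + 50) OUT
    (\<lambda>R' m'. \<forall>i < n. m' i = of_bool (\<exists>y < k * b. c y = Suc i)) R m"
proof -
  define K where "K R' m' \<longleftrightarrow> R' 0 = n \<and> R' 1 = k \<and> R' 2 = b \<and> R' 9 = B \<and>
    (\<forall>y < k * b. m' (ad B 5 y) = c y)" for R' m' :: "nat \<Rightarrow> nat"
  have nB: "n \<le> B" by (simp add: B_def)
  have neq: "i \<noteq> ad B 5 y" if "i < n" for i y using le_ad[of B 5 y] nB that by linarith
  have K_upd: "K R' (m'(i := v)) = K R' m'" if "i < n" for R' m' i v
    unfolding K_def using neq[OF that] by (auto simp: fun_upd_apply)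
  have K_upd': "K (R'(33 := v)) m' = K R' m'" for R' m' v by (simp add: K_def)
  show ?thesis
    unfolding OUT_def
  proof (rule wp_Seq[where ?t1.0 = "n * 15 + 10" and ?t2.0 = "k * b * 40 + 20"],
      rule wp_For_plain[where m = n and t = 3 and I = "\<lambda>x R' m'. K R' m' \<and> (\<forall>i < x. m' i = 0)"], goal_cases)
    case 1
    show ?case using env_regs[OF e] c by (auto simp: K_def)
  next
    case (2 i R' m')
    then show ?case by (intro wp_Store) (auto simp: K_upd K_upd' less_Suc_eq)
  next
    case (5 R1 m1)
    show ?case
    proof (rule wp_For_plain[where m = "k * b" and t = 27 and I = "\<lambda>x R' m'. K R' m' \<and>
        (\<forall>i < n. m' i = of_bool (\<exists>y < x. c y = Suc i))"], goal_cases)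
      case (2 y R' m')
      have cy: "m' (ad B 5 y) = c y" "R' 9 = B" "c y \<le> n" using 2 c by (auto simp: K_def)
      show ?case
      proof (rule wp_If[where ?t1.0 = 18], goal_cases)
        case 1
        then have "c y - 1 < n" "c y \<noteq> 0" using cy 2 by auto
        then show ?case using 2 cy H2
          by (intro wp_Store) (auto simp: K_upd K_upd' less_Suc_eq AD_def ad_def)
      next
        case 2
        then have "c y = 0" using cy \<open>R' 33 = y\<close> by auto
        then show ?case using \<open>K R' m' \<and> _\<close> \<open>R' 33 = y\<close>
          by (intro wp_Skip) (auto simp: K_upd' less_Suc_eq)
      qed (simp add: AD_def)
    qed (use 5 kbH in \<open>auto simp: K_def\<close>)
  qed (use nH in \<open>auto simp: K_def\<close>)
qed

end

section \<open>Computing the parameters and the whole program\<close>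

text \<open>Logarithms are found by guarded loops of \<open>k\<close> and \<open>n\<close> rounds,
  long enough for the powers in variable 12 to overtake \<open>k\<close> and \<open>n\<close>. The
  results are \<open>D = C ^ k\<close>, \<open>M = D ^ 3\<close> and
  \<open>r = k * A\<close>.\<close>

definition SETUP :: "nat \<Rightarrow> nat \<Rightarrow> com" where "SETUP A C =
  (2 \<^bold>:= Lit 1 \<^bold>;
   12 \<^bold>:= Lit 16 \<^bold>;
   For 33 (Var 1) (If (Var 12 \<^bold>< Var 1 \<^bold>+ Lit 1) (12 \<^bold>:= Var 12 \<^bold>* Lit 4 \<^bold>; 2 \<^bold>:= Var 2 \<^bold>+ Lit 1) Skip) \<^bold>;
   3 \<^bold>:= Bin Div (Var 0 \<^bold>+ Var 2 \<^bold>- Lit 1) (Var 2) \<^bold>;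
   4 \<^bold>:= Lit 0 \<^bold>;
   12 \<^bold>:= Lit 1 \<^bold>;
   For 33 (Var 0) (If (Var 12 \<^bold>< Var 0 \<^bold>+ Lit 1) (12 \<^bold>:= Var 12 \<^bold>+ Var 12 \<^bold>; 4 \<^bold>:= Var 4 \<^bold>+ Lit 1) Skip) \<^bold>;
   6 \<^bold>:= Lit 1 \<^bold>;
   7 \<^bold>:= Lit 1 \<^bold>;
   For 33 (Var 1) (6 \<^bold>:= Var 6 \<^bold>* Lit C \<^bold>; 7 \<^bold>:= Var 7 \<^bold>+ Var 7) \<^bold>;
   5 \<^bold>:= Var 6 \<^bold>* Var 6 \<^bold>* Var 6 \<^bold>;
   8 \<^bold>:= Var 1 \<^bold>* Lit A \<^bold>;
   11 \<^bold>:= Var 5 \<^bold>+ Var 8 \<^bold>* Var 4)"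

definition SET_BASE :: com where "SET_BASE = (9 \<^bold>:= Var 0 \<^bold>+ Var 11 \<^bold>* (Var 0 \<^bold>+ Lit 1))"

text \<open>The integer part of the logarithm of \<open>k\<close> to base 4, but at least 1.\<close>

definition block_spec :: "nat \<Rightarrow> nat \<Rightarrow> bool" where
  "block_spec k b \<longleftrightarrow> 1 \<le> b \<and> (b = 1 \<or> 4 ^ b \<le> k) \<and> k < 4 ^ (b + 1)"

definition bits_spec :: "nat \<Rightarrow> nat \<Rightarrow> bool" where
  "bits_spec n q \<longleftrightarrow> n < 2 ^ q \<and> 2 ^ q \<le> 2 * n"

lemma wp_SETUP:
  assumes R: "R 0 = n" "R 1 = k" and n: "1 \<le> n" and k: "1 \<le> k"
    and H: "16 + 4 * k \<le> H" "2 * n \<le> H" "2 ^ k \<le> H" "C ^ k * C ^ k * C ^ k \<le> H" "k * A \<le> H" "1 \<le> C"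
      "\<And>q. bits_spec n q \<Longrightarrow> n + (C ^ k * C ^ k * C ^ k + k * A * q) * (n + 1) \<le> H"
  shows "wp H (cost (n + k) (SETUP A C)) (SETUP A C) (\<lambda>R' m'. \<exists>b q. block_spec k b \<and> bits_spec n q \<and>
     R' 0 = n \<and> R' 1 = k \<and> R' 2 = b \<and> R' 3 = (n + b - 1) div b \<and> R' 4 = q \<and> R' 5 = C ^ k * C ^ k * C ^ k \<and>
     R' 6 = C ^ k \<and> R' 7 = 2 ^ k \<and> R' 8 = k * A \<and> R' 11 = C ^ k * C ^ k * C ^ k + k * A * q \<and> R' 12 = 2 ^ q \<and> m' = m) R m"
proof -
  have CH: "C ^ j \<le> H" if "j \<le> k" for j
  proof -
    have "C ^ j \<le> C ^ k * 1 * 1" using that H(6) by (simp add: power_increasing)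
    also have "\<dots> \<le> C ^ k * C ^ k * C ^ k" using H(6) by (intro mult_mono) auto
    finally show ?thesis using H(4) by linarith
  qed
  have TH: "2 ^ j \<le> H" if "j \<le> k" for j :: nat
    by (rule order.trans[OF power_increasing H(3)]) (use that in auto)
  have kH: "k \<le> H" using H(1) by simp
  \<comment> \<open>The last conjunct says that \<open>b\<close> has grown in every round as long as
    the guard holds. After \<open>k\<close> rounds this would give \<open>b = Suc k\<close>, against
    \<open>b <= k\<close>, so the guard must have failed. The bound on \<open>v\<close> keeps the
    value below \<open>H\<close>.\<close>
  define J1 where "J1 i b v \<longleftrightarrow> 1 \<le> b \<and> v = 4 ^ (b + 1) \<and> v \<le> 16 + 4 * k \<and> (b = 1 \<or> 4 ^ b \<le> k) \<and>
     (k < v \<or> b = Suc i)" for i b v :: nat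
  have J1_Suc: "J1 (Suc i) (if v \<le> k then Suc b else b) (if v \<le> k then v * 4 else v)"
    if "J1 i b v" for i b v
    using that by (auto simp: J1_def)
  have b_le: "b \<le> k" if "J1 i b v" for i b v
  proof -
    have "b < 2 ^ b" by (rule less_exp)
    also have "(2::nat) ^ b \<le> 4 ^ b" by (rule power_mono) auto
    finally have "b \<le> k" if "4 ^ b \<le> k" using that by linarith
    then show ?thesis using that k unfolding J1_def by auto
  qed
  have J1_end: "block_spec k b" if "J1 k b v" for b v
  proof -
    have "k < v" "v = 4 ^ (b + 1)" "1 \<le> b" "b = 1 \<or> 4 ^ b \<le> k"
      using that b_le[OF that] unfolding J1_def by auto
    then show ?thesis unfolding block_spec_def by blast
  qed
  define J2 where "J2 i q v \<longleftrightarrow> v = 2 ^ q \<and> v \<le> 2 * n \<and> (n < v \<or> q = i)" for i q v :: nat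
  have J2_Suc: "J2 (Suc i) (if v \<le> n then Suc q else q) (if v \<le> n then v + v else v)"
    if "J2 i q v" for i q v
    using that by (auto simp: J2_def)
  have J2_end: "bits_spec n q" if "J2 n q v" for q v
  proof -
    have "n < 2 ^ n" by (rule less_exp)
    then show ?thesis using that unfolding J2_def bits_spec_def by metis
  qed
  have q_le: "q \<le> H" "v \<le> H" if "J2 i q v" for i q v
  proof -
    have "q < 2 ^ q" by (rule less_exp)
    then show "q \<le> H" "v \<le> H" using that H(2) unfolding J2_def by linarith+
  qed
  have loop1: "wpc (n + k) H (For 33 (Var 1) (If (Var 12 \<^bold>< Var 1 \<^bold>+ Lit 1)
       (12 \<^bold>:= Var 12 \<^bold>* Lit 4 \<^bold>; 2 \<^bold>:= Var 2 \<^bold>+ Lit 1) Skip)) (\<lambda>R' m'. block_spec k (R' 2)) R m"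
    if "R 1 = k" "R 2 = 1" "R 12 = 16" for R m
  proof (rule wp_For[where m = k and I = "\<lambda>i R' m'. J1 i (R' 2) (R' 12)"], goal_cases)
    case (4 i R' m')
    have 1: "R' (Suc 0) = k" using 4 that by (auto simp: frame_def)
    have "R' 12 * 4 \<le> H" if "R' 12 \<le> k" using that H(1) by simp
    then show ?case using J1_Suc[OF 4(4)] b_le[OF 4(4)] H(1)
      by (intro wpc_rules) (auto simp: 1 less_Suc_eq_le)
  qed (use that J1_end kH k in \<open>auto simp: frame_def J1_def\<close>)
  have loop2: "wpc (n + k) H (For 33 (Var 0) (If (Var 12 \<^bold>< Var 0 \<^bold>+ Lit 1)
       (12 \<^bold>:= Var 12 \<^bold>+ Var 12 \<^bold>; 4 \<^bold>:= Var 4 \<^bold>+ Lit 1) Skip))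
       (\<lambda>R' m'. bits_spec n (R' 4) \<and> R' 12 = 2 ^ R' 4) R m"
    if "R 0 = n" "R 4 = 0" "R 12 = 1" for R m
  proof (rule wp_For[where m = n and I = "\<lambda>i R' m'. J2 i (R' 4) (R' 12)"], goal_cases)
    case (4 i R' m')
    have 1: "R' 0 = n" using 4 that by (auto simp: frame_def)
    have "R' 12 + R' 12 \<le> H" "Suc (R' 4) \<le> H" if "R' 12 \<le> n"
      using q_le[OF J2_Suc[OF 4(4)]] that by auto
    then show ?case using J2_Suc[OF 4(4)]
      by (intro wpc_rules) (auto simp: 1 less_Suc_eq_le)
  next
    case (8 R' m')
    then show ?case using J2_end by (auto simp: J2_def)
  qed (use that H(2) n in \<open>auto simp: frame_def J2_def\<close>)
  have loop3: "wpc (n + k) H (For 33 (Var 1) (6 \<^bold>:= Var 6 \<^bold>* Lit C \<^bold>; 7 \<^bold>:= Var 7 \<^bold>+ Var 7))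
       (\<lambda>R' m'. R' 6 = C ^ k \<and> R' 7 = 2 ^ k) R m"
    if "R 1 = k" "R 6 = 1" "R 7 = 1" for R m
  proof (rule wp_For[where m = k and I = "\<lambda>i R' m'. R' 6 = C ^ i \<and> R' 7 = 2 ^ i"], goal_cases)
    case (4 i R' m')
    then show ?case using CH[of "Suc i"] TH[of "Suc i"]
      by (intro wpc_rules) (auto simp: mult.commute)
  qed (use that kH in \<open>auto simp: frame_def\<close>)
  have H1: "1 \<le> H" "16 \<le> H" using H(1) by auto
  show ?thesis
    unfolding SETUP_def
  proof (rule wpc_Seq, rule wpc_Assign, (use H1 in simp), rule wpc_Seq, rule wpc_Assign, (use H1 in simp),
      rule wpc_Seq, rule wpc_use[OF loop1], goal_cases)
    case (5 R1 m1)
    have R1: "R1 0 = n" "R1 1 = k" "m1 = m" using 5(2) R by (auto simp: frame_def)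
    obtain b where b: "R1 2 = b" "block_spec k b" using 5(1) by simp
    have b1: "1 \<le> b" using b(2) by (simp add: block_spec_def)
    let ?N = "(n + b - 1) div b"
    have N: "?N \<le> H"
    proof (cases "b = 1")
      case False
      have "n + b - 1 \<le> n * b" using b1 n by (cases b; cases n) auto
      then have "?N \<le> n * b div b" by (intro div_le_mono)
      then show ?thesis using b1 H(2) by simp
    qed (use H(2) in simp)
    show ?case
    proof (rule wpc_Seq, rule wpc_Assign, (use R1 b N in simp), rule wpc_Seq, rule wpc_Assign, simp,
        rule wpc_Seq, rule wpc_Assign, (use H1 in simp),
        rule wpc_Seq, rule wpc_use[OF loop2], goal_cases)
      case (5 R2 m2)
      have R2: "R2 0 = n" "R2 1 = k" "R2 2 = b" "R2 3 = ?N" "m2 = m"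
        using 5(2) R1 b by (auto simp: frame_def)
      obtain q where q: "R2 4 = q" "bits_spec n q" "R2 12 = 2 ^ q" using 5(1) by simp
      show ?case
      proof (rule wpc_Seq, rule wpc_Assign, (use H1 in simp), rule wpc_Seq, rule wpc_Assign, (use H1 in simp),
        rule wpc_Seq, rule wpc_use[OF loop3], goal_cases)
        case (5 R3 m3)
        have R3: "R3 0 = n" "R3 (Suc 0) = k" "R3 2 = b" "R3 3 = ?N" "R3 4 = q" "R3 6 = C ^ k" "R3 7 = 2 ^ k"
            "R3 12 = 2 ^ q" "m3 = m"
          using 5 R2 q by (auto simp: frame_def)
        have "C ^ k * C ^ k * C ^ k + k * A * q \<le> H"
        proof -
          have le: "d \<le> n + d * (n + 1)" for d :: nat by simp
          show ?thesis by (rule order.trans[OF le H(7)[OF q(2)]])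
        qed
        then show ?case using b(2) q(2) H(4,5)
          by (intro wpc_rules) (auto simp: R3)
      qed (use R2 in auto)
    qed (use R1 in auto)
  qed (use R in auto)
qed

definition PROG :: "nat \<Rightarrow> nat \<Rightarrow> com" where
  "PROG A C = (SETUP A C \<^bold>; SET_BASE \<^bold>; DRAW \<^bold>; PC \<^bold>; COLUMNS \<^bold>; MAIN \<^bold>; OUT)"

text \<open>The degree 12 found here is the exponent for which the word length has to
  provide.\<close>

lemma fits_parts: "16 \<le> H \<Longrightarrow> A \<le> H \<Longrightarrow> C \<le> H \<Longrightarrow>
    fits H 12 (SETUP A C) \<and> fits H 12 SET_BASE \<and> fits H 12 PC \<and> fits H 12 COLUMNS \<and> fits H 12 MAIN \<and> fits H 12 OUT"
  by (auto simp: SETUP_def SET_BASE_def PC_def COLUMNS_def WORD_def MAIN_def OUT_def BODY_def SCAN_def POS_def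
      SCORE_def NEXT_def ELIM_def LOAD_def PACK_def INSERT_STEP_def For_def Wr_def AD_def)

context lspn
begin

lemma mark_candidate:
  "(\<exists>y < k * b. mark u X (u (y div b) * b + y mod b) = Suc i) \<longleftrightarrow> i \<in> set (candidate u X k)"
proof
  assume "\<exists>y < k * b. mark u X (u (y div b) * b + y mod b) = Suc i"
  then obtain y where y: "y < k * b" "mark u X (u (y div b) * b + y mod b) = Suc i" by blast
  have "y div b < k" "y mod b < b" using y(1) b1 by (auto simp: less_mult_imp_div_less)
  moreover have "i = u (y div b) * b + y mod b" "i < n" "dec u X i"
    using y(2) by (auto simp: mark_def split: if_splits)
  ultimately show "i \<in> set (candidate u X k)"
    unfolding candidate_def chosen_def by (auto intro!: bexI[of _ "y div b"])
next
  assume "i \<in> set (candidate u X k)"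
  then obtain l where "l < k" "i \<in> set (chosen u X l b)"
    by (auto simp: candidate_def)
  moreover from this have "u l * b \<le> i" "i < u l * b + b" "i < n" "dec u X i"
    by (auto simp: chosen_def)
  moreover define h where "h = i - u l * b"
  ultimately have "l < k" "h < b" "i = u l * b + h" "i < n" "dec u X i" by auto
  then show "\<exists>y < k * b. mark u X (u (y div b) * b + y mod b) = Suc i"
    using pos_less[of l h] by (intro exI[of _ "l * b + h"]) (simp add: mark_def)
qed

definition tail_time :: nat where
  "tail_time = (2 ^ q * 50 + 20) + (((n + 1) * (30 + (r * (q * 40 + 60) + 20)) + 20) +
     (((N choose k) * (4 + cost U BODY) + k * 20 + 40) + (n * 15 + k * b * 40 + 50) + 1) + 1) + 1"

text \<open>Any minimiser is allowed: the analysis also counts ties with wrong candidates as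
  failures, so the rule for breaking ties is irrelevant.\<close>

definition argmin_output :: "(nat \<Rightarrow> nat \<Rightarrow> nat) \<Rightarrow> (nat \<Rightarrow> nat) \<Rightarrow> bool" where
  "argmin_output X m \<longleftrightarrow> (\<exists>i0 < N choose k.
     (\<forall>i < N choose k. errors (comb k N i0) X \<le> errors (comb k N i) X) \<and>
     (\<forall>i < n. m i = of_bool (i \<in> set (candidate (comb k N i0) X k))))"

lemma wp_TAIL:
  assumes e: "env X R m" and 12: "R 12 = 2 ^ q" and z: "m (ad B 0 0) = 0" and kN: "k \<le> N"
  shows "wp H tail_time (PC \<^bold>; COLUMNS \<^bold>; MAIN \<^bold>; OUT) (\<lambda>R' m'. argmin_output X m') R m"
  unfolding tail_time_def
proof (rule wp_Seq[OF _ order_refl],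
    rule wp_mono[OF wp_frame[OF wp_PC[OF e 12 z]] order_refl], goal_cases)
  case (2 R1 m1)
  have e1: "env X R1 m1" by (rule env_frame[of X R m]) (use e 2 in \<open>auto simp: PC_def\<close>)
  show ?case
  proof (rule wp_Seq[OF _ order_refl],
      rule wp_mono[OF wp_frame[OF wp_COLUMNS[OF e1]] order_refl], goal_cases)
    case (2 R2 m2)
    have e2: "env X R2 m2" by (rule env_frame[of X R1 m1]) (use e1 2 in \<open>auto simp: COLUMNS_def WORD_def\<close>)
    have "m2 (ad B 0 v) = m1 (ad B 0 v)" for v
      using 2 by (auto simp: COLUMNS_def WORD_def frame_def env_regs[OF e1])
    then have p: "prepared X m2"
      using 2 \<open>(\<forall>v < 2 ^ q. m1 (ad B 0 v) = popcount v) \<and> _\<close> by (simp add: prepared_def)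
    show ?case
    proof (rule wp_Seq[OF _ order_refl], rule wp_mono[OF wp_MAIN[OF e2 p kN] order_refl], goal_cases)
      case (1 R3 m3)
      have "N choose k \<noteq> 0" using kN by simp
      then obtain i0 where i0: "i0 < N choose k"
          "\<forall>i' < N choose k. errors (comb k N i0) X \<le> errors (comb k N i') X"
          "\<forall>l < k. \<forall>h < b. m3 (ad B 5 (l * b + h)) = mark (comb k N i0) X (comb k N i0 l * b + h)"
        using 1 unfolding best_so_far_def by auto
      let ?u = "comb k N i0"
      let ?c = "\<lambda>y. mark ?u X (?u (y div b) * b + y mod b)"
      have c: "m3 (ad B 5 y) = ?c y \<and> ?c y \<le> n" if "y < k * b" for y
      proof -
        have "y div b < k" "y mod b < b" using that b1 by (auto simp: less_mult_imp_div_less)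
        then have "m3 (ad B 5 (y div b * b + y mod b)) = ?c y" using i0(3) by blast
        then show ?thesis by (auto simp: mark_def)
      qed
      show ?case
        by (rule wp_mono[OF wp_OUT[OF conjunct1[OF 1] c] order_refl])
          (use i0 in \<open>auto simp: argmin_output_def mark_candidate\<close>)
    qed
  qed (auto simp: COLUMNS_def WORD_def)
qed (auto simp: PC_def)

end

lemma srun_DRAW:
  assumes D: "\<And>z. z \<in> set_pmf D \<Longrightarrow> dim_vec (fst z) = n"
    and H: "2 \<le> H" "H ^ 12 < 2 ^ w" and s: "small H (reg \<sigma>) (mem \<sigma>)" and R: "reg \<sigma> 0 = n" "reg \<sigma> 11 = d"
  shows "srun w D d (d * (n + 24) + 8) DRAW \<sigma> (\<lambda>zs \<sigma>'. (\<forall>r. r \<noteq> 33 \<longrightarrow> reg \<sigma>' r = reg \<sigma> r) \<and>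
     drawn \<sigma>' = drawn \<sigma> + d \<and> small H (reg \<sigma>') (mem \<sigma>') \<and>
     (\<forall>l < d. \<forall>i \<le> n. mem \<sigma>' (n + l * (n + 1) + i) = sample_bit n (zs ! l) i) \<and>
     (\<forall>x. x < n \<or> n + d * (n + 1) \<le> x \<longrightarrow> mem \<sigma>' x = mem \<sigma> x))"
proof -
  have "H ^ 5 \<le> H ^ 12" using H(1) by (intro power_increasing) auto
  then have H5: "H ^ 5 < 2 ^ w" using H(2) by linarith
  have s': "small H ((reg \<sigma>)(33 := 0)) (mem \<sigma>)" using s by (simp add: small_def)
  let ?W = "While (Var 33 \<^bold>< Var 11)
         (Seq (Draw (Var 0 \<^bold>+ Var 33 \<^bold>* (Var 0 \<^bold>+ Lit 1))) (Assign 33 (Var 33 \<^bold>+ Lit 1)))"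
  have 1: "srun w D 0 2 (33 \<^bold>:= Lit 0) \<sigma> (\<lambda>zs \<sigma>'. (reg \<sigma>' = (reg \<sigma>)(33 := 0) \<and> mem \<sigma>' = mem \<sigma>) \<and>
      drawn \<sigma>' = drawn \<sigma> \<and> small H (reg \<sigma>') (mem \<sigma>'))"
    by (rule srun_wp[OF _ s _ H]) (auto intro!: wp_Assign)
  have "srun w D (0 + d) (2 + (d * (n + 24) + 5) + 1) DRAW \<sigma> (\<lambda>zs \<sigma>'. (\<forall>r. r \<noteq> 33 \<longrightarrow> reg \<sigma>' r = reg \<sigma> r) \<and>
     drawn \<sigma>' = drawn \<sigma> + d \<and> small H (reg \<sigma>') (mem \<sigma>') \<and>
     (\<forall>l < d. \<forall>i \<le> n. mem \<sigma>' (n + l * (n + 1) + i) = sample_bit n (zs ! l) i) \<and>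
     (\<forall>x. x < n \<or> n + d * (n + 1) \<le> x \<longrightarrow> mem \<sigma>' x = mem \<sigma> x))"
    unfolding DRAW_def For_def
  proof (rule srun_Seq[OF 1])
    fix zs and \<sigma>1 :: state
    assume zs: "zs \<in> set_pmf (replicate_pmf 0 D)"
      and s1: "(reg \<sigma>1 = (reg \<sigma>)(33 := 0) \<and> mem \<sigma>1 = mem \<sigma>) \<and> drawn \<sigma>1 = drawn \<sigma> \<and> small H (reg \<sigma>1) (mem \<sigma>1)"
    have "srun w D d (d * (n + 24) + 5) ?W (tick 1 \<sigma>1) (drew n 0 (tick 1 \<sigma>1))"
      by (rule srun_DRAW_loop[OF D H(1) H5]) (use s1 R in auto)
    then show "srun w D d (d * (n + 24) + 5) ?W (tick 1 \<sigma>1) (\<lambda>zs'. \<lambda>\<sigma>'. (\<forall>r. r \<noteq> 33 \<longrightarrow> reg \<sigma>' r = reg \<sigma> r) \<and>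
     drawn \<sigma>' = drawn \<sigma> + d \<and> small H (reg \<sigma>') (mem \<sigma>') \<and>
     (\<forall>l < d. \<forall>i \<le> n. mem \<sigma>' (n + l * (n + 1) + i) = sample_bit n ((zs @ zs') ! l) i) \<and>
     (\<forall>x. x < n \<or> n + d * (n + 1) \<le> x \<longrightarrow> mem \<sigma>' x = mem \<sigma> x))"
    proof (rule srun_mono, goal_cases)
      case (2 zs2 \<sigma>2)
      have len: "length zs2 = d" using 2(1) by (auto simp: set_replicate_pmf)
      have dr: "\<forall>r. r \<noteq> 33 \<longrightarrow> reg \<sigma>2 r = reg \<sigma> r" "reg \<sigma>2 33 = d" "drawn \<sigma>2 = drawn \<sigma> + d"
          "\<And>l i. l < d \<Longrightarrow> i \<le> n \<Longrightarrow> mem \<sigma>2 (n + l * (n + 1) + i) = sample_bit n (zs2 ! l) i"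
          "\<And>x. x < n \<or> n + d * (n + 1) \<le> x \<Longrightarrow> mem \<sigma>2 x = mem \<sigma> x"
        using 2(2) s1 len unfolding drew_def by auto
      have "d \<le> H" using s R(2) by (metis small_def)
      then have "reg \<sigma>2 r \<le> H" for r
        using dr(1,2) s by (cases "r = 33") (auto simp: small_def)
      moreover have "mem \<sigma>2 x \<le> H" for x
      proof (cases "x < n \<or> n + d * (n + 1) \<le> x")
        case True
        then show ?thesis using dr(5) s by (simp add: small_def)
      next
        case False
        define l i where "l = (x - n) div (n + 1)" and "i = (x - n) mod (n + 1)"
        have "x - n = l * (n + 1) + i" by (simp only: l_def i_def div_mult_mod_eq)
        moreover have "n \<le> x" using False by simp
        ultimately have x: "x = n + l * (n + 1) + i" by linarith
        have "l < d" using False unfolding l_def by (intro less_mult_imp_div_less) auto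
        moreover have "i \<le> n" unfolding i_def using mod_less_divisor[of "n + 1" "x - n"] by simp
        ultimately show ?thesis using dr(4)[of l i] sample_bit_le1[of n "zs2 ! l" i] H(1) unfolding x by linarith
      qed
      ultimately show ?case using dr zs by (auto simp: small_def)
    qed simp
  qed
  from this[unfolded add_0] show ?thesis by (rule srun_mono) auto
qed

text \<open>The program itself computes \<open>b\<close> and \<open>q\<close>. Hence the conclusion
  asserts their existence, while \<open>par\<close> must hold for all values that meet the
  specifications.\<close>

lemma srun_PROG:
  assumes D: "\<And>z. z \<in> set_pmf D \<Longrightarrow> dim_vec (fst z) = n"
    and n: "1 \<le> n" and k: "1 \<le> k"
    and H: "16 + 4 * k \<le> H" "2 * n \<le> H" "A \<le> H" "1 \<le> C" "H ^ 12 < 2 ^ w"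
    and par: "\<And>b q. block_spec k b \<Longrightarrow> bits_spec n q \<Longrightarrow>
      lspn n k b ((n + b - 1) div b) q (k * A) (C ^ k) (C ^ k * C ^ k * C ^ k) H U \<and> k \<le> (n + b - 1) div b"
    and bex: "\<exists>b. block_spec k b" and qex: "\<exists>q. bits_spec n q"
  shows "\<exists>b q. block_spec k b \<and> bits_spec n q \<and>
    srun w D (C ^ k * C ^ k * C ^ k + k * A * q)
      (cost (n + k) (SETUP A C) + 20 + (C ^ k * C ^ k * C ^ k + k * A * q) * (n + 24) +
        lspn.tail_time n k b ((n + b - 1) div b) q (k * A) U) (PROG A C) (init_state w n k)
      (\<lambda>zs \<sigma>'. drawn \<sigma>' = C ^ k * C ^ k * C ^ k + k * A * q \<and>
        lspn.argmin_output n k b ((n + b - 1) div b) q (k * A) (C ^ k) (C ^ k * C ^ k * C ^ k)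
          (\<lambda>j. sample_bit n (zs ! j)) (mem \<sigma>'))"
proof -
  let ?M = "C ^ k * C ^ k * C ^ k"
  \<comment> \<open>An arbitrary admissible pair provides the bounds on \<open>H\<close> that are
    needed before the actual values are known.\<close>
  obtain b0 where b0: "block_spec k b0" using bex by blast
  obtain q0 where q0: "bits_spec n q0" using qex by blast
  interpret L0: lspn n k b0 "(n + b0 - 1) div b0" q0 "k * A" "C ^ k" ?M H U
    using par[OF b0 q0] by blast
  have H16: "16 \<le> H" "2 \<le> H" using H(1) by auto
  have "C ^ 1 \<le> C ^ k" using k H(4) by (intro power_increasing) auto
  then have CH: "C \<le> H" using L0.DH by simp
  have "H ^ 1 \<le> H ^ 12" using H16 by (intro power_increasing) auto
  then have Hw: "H < 2 ^ w" using H(5) by simp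
  let ?s = "init_state w n k"
  have nk: "take_bit w n = n" "take_bit w k = k"
    using H Hw by (auto simp: take_bit_nat_eq_self)
  have s0: "small H (reg ?s) (mem ?s)" using H by (auto simp: small_def init_state_def nk)
  have BH: "n + (?M + k * A * q) * (n + 1) \<le> H" if "bits_spec n q" for q
  proof -
    interpret L: lspn n k b0 "(n + b0 - 1) div b0" q "k * A" "C ^ k" ?M H U using par[OF b0 that] by blast
    show ?thesis by (rule L.BH)
  qed
  have "wp H (cost (n + k) (SETUP A C)) (SETUP A C) (\<lambda>R' m'. \<exists>b q. block_spec k b \<and> bits_spec n q \<and>
     R' 0 = n \<and> R' 1 = k \<and> R' 2 = b \<and> R' 3 = (n + b - 1) div b \<and> R' 4 = q \<and> R' 5 = ?M \<and>
     R' 6 = C ^ k \<and> R' 7 = 2 ^ k \<and> R' 8 = k * A \<and> R' 11 = ?M + k * A * q \<and> R' 12 = 2 ^ q \<and> m' = mem ?s) (reg ?s) (mem ?s)"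
    by (rule wp_SETUP) (use n k H L0.kp0H L0.MH L0.rH BH in \<open>auto simp: init_state_def nk\<close>)
  then obtain t R1 b q where t: "ex H (SETUP A C) (reg ?s) (mem ?s) t R1 (mem ?s)" "t \<le> cost (n + k) (SETUP A C)"
      "block_spec k b" "bits_spec n q"
      "R1 0 = n" "R1 1 = k" "R1 2 = b" "R1 3 = (n + b - 1) div b" "R1 4 = q" "R1 5 = ?M"
      "R1 6 = C ^ k" "R1 7 = 2 ^ k" "R1 8 = k * A" "R1 11 = ?M + k * A * q" "R1 12 = 2 ^ q"
    unfolding wp_def by blast
  interpret L: lspn n k b "(n + b - 1) div b" q "k * A" "C ^ k" ?M H U
    using par[OF t(3,4)] by blast
  have kN: "k \<le> (n + b - 1) div b" using par[OF t(3,4)] by blast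
  note fits = fits_parts[OF H16(1) H(3) CH]
  let ?d = "?M + k * A * q"
  have 1: "srun w D 0 (cost (n + k) (SETUP A C)) (SETUP A C) ?s
      (\<lambda>zs \<sigma>'. (reg \<sigma>' = R1 \<and> mem \<sigma>' = (\<lambda>_. 0)) \<and> drawn \<sigma>' = drawn ?s \<and> small H (reg \<sigma>') (mem \<sigma>'))"
    by (rule srun_wp[OF _ s0 _ H16(2) H(5)]) (use t fits in \<open>auto simp: wp_def init_state_def\<close>)
  have tail: "srun w D 0 L.tail_time (PC \<^bold>; COLUMNS \<^bold>; MAIN \<^bold>; OUT) \<sigma>
      (\<lambda>zs' \<sigma>'. L.argmin_output (\<lambda>j. sample_bit n (zs ! j)) (mem \<sigma>') \<and> drawn \<sigma>' = drawn \<sigma> \<and> small H (reg \<sigma>') (mem \<sigma>'))"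
    if r: "\<And>r. r \<noteq> 33 \<Longrightarrow> reg \<sigma> r = (R1(9 := L.B)) r" and s: "small H (reg \<sigma>) (mem \<sigma>)"
      and m: "\<And>l i. l < ?d \<Longrightarrow> i \<le> n \<Longrightarrow> mem \<sigma> (n + l * (n + 1) + i) = sample_bit n (zs ! l) i"
      and z: "\<And>x. L.B \<le> x \<Longrightarrow> mem \<sigma> x = 0" for \<sigma> zs
  proof (rule srun_wp[OF _ s _ H16(2) H(5)])
    have e: "L.env (\<lambda>j. sample_bit n (zs ! j)) (reg \<sigma>) (mem \<sigma>)"
    proof -
      have "R1 (Suc 0) = k" using t(6) by simp
      then show ?thesis unfolding L.env_def
        using sample_bit_le1 m by (simp add: r t(5-))
    qed
    show "wp H L.tail_time (PC \<^bold>; COLUMNS \<^bold>; MAIN \<^bold>; OUT)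
        (\<lambda>R' m'. L.argmin_output (\<lambda>j. sample_bit n (zs ! j)) m') (reg \<sigma>) (mem \<sigma>)"
      by (rule L.wp_TAIL[OF e]) (use r t(5-) z le_ad kN in auto)
    show "fits H 12 (PC \<^bold>; COLUMNS \<^bold>; MAIN \<^bold>; OUT)" using fits by simp
  qed
  let ?Q = "\<lambda>zs \<sigma>'. drawn \<sigma>' = ?d \<and> L.argmin_output (\<lambda>j. sample_bit n (zs ! j)) (mem \<sigma>')"
  have "srun w D (0 + (0 + (?d + 0))) (cost (n + k) (SETUP A C) + (8 + ((?d * (n + 24) + 8) + L.tail_time + 1) + 1) + 1)
      (PROG A C) ?s ?Q"
    unfolding PROG_def
  proof (rule srun_Seq[OF 1], goal_cases)
    case (1 zs1 \<sigma>1)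
    have z1: "zs1 = []" using 1(1) by simp
    have 2: "srun w D 0 8 SET_BASE (tick 1 \<sigma>1)
      (\<lambda>zs \<sigma>'. (reg \<sigma>' = R1(9 := L.B) \<and> mem \<sigma>' = (\<lambda>_. 0)) \<and> drawn \<sigma>' = drawn (tick 1 \<sigma>1) \<and> small H (reg \<sigma>') (mem \<sigma>'))"
      by (rule srun_wp[OF _ _ _ H16(2) H(5)])
        (use 1 t(5-) L.BH fits in \<open>auto simp: SET_BASE_def L.B_def intro!: wp_Assign\<close>)
    show ?case
    proof (rule srun_Seq[OF 2], goal_cases)
      case (1 zs2 \<sigma>2)
      have z2: "zs2 = []" using 1(1) by simp
      note d2 = srun_DRAW[OF D H16(2) H(5), where \<sigma> = "tick 1 \<sigma>2" and d = ?d]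
      show ?case
      proof (rule srun_Seq[OF d2], goal_cases)
        case (5 zs3 \<sigma>3)
        have "srun w D 0 L.tail_time (PC \<^bold>; COLUMNS \<^bold>; MAIN \<^bold>; OUT) (tick 1 \<sigma>3)
            (\<lambda>zs' \<sigma>'. L.argmin_output (\<lambda>j. sample_bit n (zs3 ! j)) (mem \<sigma>') \<and> drawn \<sigma>' = drawn (tick 1 \<sigma>3) \<and>
              small H (reg \<sigma>') (mem \<sigma>'))"
          by (rule tail) (use 5(2) 1(2) in \<open>auto simp: L.B_def\<close>)
        then show ?case
          by (rule srun_mono) (use 5(2) 1(2) \<open>_ \<and> drawn \<sigma>1 = _ \<and> _\<close> in \<open>auto simp: z1 z2 init_state_def\<close>)
      qed (use 1(2) t(5-) in auto)
    qed
  qed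
  then have "srun w D ?d (cost (n + k) (SETUP A C) + (8 + ((?d * (n + 24) + 8) + L.tail_time + 1) + 1) + 1)
      (PROG A C) ?s ?Q"
    by (simp only: add_0 add_0_right)
  then have "srun w D ?d (cost (n + k) (SETUP A C) + 20 + ?d * (n + 24) + L.tail_time) (PROG A C) ?s ?Q"
    by (rule srun_mono) auto
  then show ?thesis using t(3,4) by blast
qed

section \<open>Elimination produces disjoint sums of samples\<close>

definition bucket_sum :: "nat \<Rightarrow> nat \<Rightarrow> buckets \<Rightarrow> nat multiset" where
  "bucket_sum b K t = (\<Sum>(g, v) \<in> {..<b} \<times> {..<K}. mset (t g v))"

lemma bucket_sum_upd:
  assumes "g < b" "v < K"
  shows "bucket_sum b K (t(g := (t g)(v := c))) + mset (t g v) = bucket_sum b K t + mset c"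
proof -
  let ?A = "{..<b} \<times> {..<K}" and ?t = "t(g := (t g)(v := c))"
  have A: "finite ?A" "(g, v) \<in> ?A" using assms by auto
  have "(\<Sum>(g, v) \<in> ?A - {(g, v)}. mset (?t g v)) = (\<Sum>(g, v) \<in> ?A - {(g, v)}. mset (t g v))"
    by (intro sum.cong) (auto split: if_splits)
  then show ?thesis
    unfolding bucket_sum_def by (simp add: sum.remove[OF A] ac_simps)
qed

definition good_buckets :: "nat \<Rightarrow> (nat \<Rightarrow> nat \<Rightarrow> nat) \<Rightarrow> buckets \<Rightarrow> bool" where
  "good_buckets K val t \<longleftrightarrow> (\<forall>g v. t g v \<noteq> [] \<longrightarrow> v < K \<and> length (t g v) = 2 ^ g \<and>
     (\<forall>h < g. xor_list (\<lambda>j. val j h) (t g v) = 0) \<and> xor_list (\<lambda>j. val j g) (t g v) = v)"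

text \<open>The third conclusion is conservation of samples, counted with multiplicity. Disjointness
  of all lists follows from it by counting, without comparing lists pairwise.\<close>

lemma insert_step_invariant:
  assumes val: "\<And>j g. val j g < 2 ^ k" and t: "good_buckets (2 ^ k) val t" and g: "g < b"
    and c: "c \<noteq> []" "fl \<Longrightarrow> length c = 2 ^ g \<and> (\<forall>h < g. xor_list (\<lambda>j. val j h) c = 0)"
    and st: "insert_step val g (t, c, fl) = (t', c', fl')"
  shows "good_buckets (2 ^ k) val t'"
    and "fl' \<Longrightarrow> length c' = 2 ^ Suc g \<and> (\<forall>h < Suc g. xor_list (\<lambda>j. val j h) c' = 0)"
    and "bucket_sum b (2 ^ k) t' + (if fl' then mset c' else {#}) =
      bucket_sum b (2 ^ k) t + (if fl then mset c else {#})"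
proof -
  define v where "v = xor_list (\<lambda>j. val j g) c"
  have v: "v < 2 ^ k" unfolding v_def using val by (rule xor_list_less_power)
  have "good_buckets (2 ^ k) val t' \<and>
    (fl' \<longrightarrow> length c' = 2 ^ Suc g \<and> (\<forall>h < Suc g. xor_list (\<lambda>j. val j h) c' = 0)) \<and>
    bucket_sum b (2 ^ k) t' + (if fl' then mset c' else {#}) =
      bucket_sum b (2 ^ k) t + (if fl then mset c else {#})"
  proof (cases fl)
    case False
    then show ?thesis using st t by (auto simp: insert_step_def)
  next
    case fl: True
    note c2 = c(2)[OF fl]
    show ?thesis
    proof (cases "t g v = []")
      case True
      then have s: "t' = t(g := (t g)(v := c))" "fl' = False"
        using st fl by (auto simp: insert_step_def Let_def v_def)
      have "good_buckets (2 ^ k) val t'"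
        using t c c2 v unfolding s good_buckets_def by (auto simp: v_def)
      then show ?thesis
        using bucket_sum_upd[OF g v, of t c] True fl s(2) unfolding s(1) by simp
    next
      case False
      then have s: "t' = t(g := (t g)(v := []))" "c' = t g v @ c" "fl' = True"
        using st fl by (auto simp: insert_step_def Let_def v_def)
      have tg: "length (t g v) = 2 ^ g" "\<And>h. h < g \<Longrightarrow> xor_list (\<lambda>j. val j h) (t g v) = 0"
          "xor_list (\<lambda>j. val j g) (t g v) = v"
        using t False by (auto simp: good_buckets_def)
      have "good_buckets (2 ^ k) val t'"
        using t unfolding s good_buckets_def by auto
      moreover have "length c' = 2 ^ Suc g" using tg c2 by (simp add: s)
      moreover have "xor_list (\<lambda>j. val j h) c' = 0" if "h < Suc g" for h
        using tg c2 that by (cases "h = g") (auto simp: s v_def)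
      ultimately show ?thesis
        using bucket_sum_upd[OF g v, of t "[]"] fl s(2,3) unfolding s(1) by (simp add: ac_simps)
    qed
  qed
  then show "good_buckets (2 ^ k) val t'"
    and "fl' \<Longrightarrow> length c' = 2 ^ Suc g \<and> (\<forall>h < Suc g. xor_list (\<lambda>j. val j h) c' = 0)"
    and "bucket_sum b (2 ^ k) t' + (if fl' then mset c' else {#}) =
      bucket_sum b (2 ^ k) t + (if fl then mset c else {#})" by auto
qed

lemma inserted_invariant:
  assumes val: "\<And>j g. val j g < 2 ^ k" and t: "good_buckets (2 ^ k) val t"
    and st: "inserted val g (t, [j], True) = (t', c', fl')" and g: "g \<le> b"
  shows "good_buckets (2 ^ k) val t' \<and> c' \<noteq> [] \<and>
    (fl' \<longrightarrow> length c' = 2 ^ g \<and> (\<forall>h < g. xor_list (\<lambda>j. val j h) c' = 0)) \<and>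
    bucket_sum b (2 ^ k) t' + (if fl' then mset c' else {#}) = bucket_sum b (2 ^ k) t + {#j#}"
  using st g
proof (induction g arbitrary: t' c' fl')
  case 0
  then show ?case using t by auto
next
  case (Suc g)
  obtain t1 c1 fl1 where 1: "inserted val g (t, [j], True) = (t1, c1, fl1)" by (metis prod_cases3)
  have st: "insert_step val g (t1, c1, fl1) = (t', c', fl')" using Suc.prems 1 by simp
  have IH: "good_buckets (2 ^ k) val t1" "c1 \<noteq> []"
      "fl1 \<Longrightarrow> length c1 = 2 ^ g \<and> (\<forall>h < g. xor_list (\<lambda>j. val j h) c1 = 0)"
      "bucket_sum b (2 ^ k) t1 + (if fl1 then mset c1 else {#}) = bucket_sum b (2 ^ k) t + {#j#}"
    using Suc.IH[OF 1 Suc_leD[OF Suc.prems(2)]] by blast+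
  have "g < b" using Suc.prems(2) by simp
  note inv = insert_step_invariant[OF val IH(1) this IH(2,3) st]
  have "c' \<noteq> []" using inserted_nonempty[of "(t, [j], True)" val "Suc g"] Suc.prems(1) by simp
  moreover note trans[OF inv(3) IH(4)]
  ultimately show ?case using inv(1,2) by blast
qed

lemma eliminated_invariant:
  assumes val: "\<And>j g. val j g < 2 ^ k"
  shows "good_buckets (2 ^ k) val (fst (eliminated b val j)) \<and>
    (\<forall>c \<in> set (snd (eliminated b val j)). length c = 2 ^ b \<and> (\<forall>h < b. xor_list (\<lambda>j. val j h) c = 0)) \<and>
    bucket_sum b (2 ^ k) (fst (eliminated b val j)) + mset (concat (snd (eliminated b val j))) = mset [0..<j]"
proof (induction j)
  case 0
  have "good_buckets (2 ^ k) val (\<lambda>_ _. [])" by (simp add: good_buckets_def)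
  moreover have "bucket_sum b (2 ^ k) (\<lambda>_ _. []) = {#}" by (simp add: bucket_sum_def)
  ultimately show ?case by simp
next
  case (Suc j)
  let ?ok = "\<lambda>c. length c = 2 ^ b \<and> (\<forall>h < b. xor_list (\<lambda>j. val j h) c = 0)"
  obtain t os where to: "eliminated b val j = (t, os)" by fastforce
  obtain t1 c1 fl1 where 1: "inserted val b (t, [j], True) = (t1, c1, fl1)" by (metis prod_cases3)
  note IH = Suc.IH[unfolded to fst_conv snd_conv]
  note inv = inserted_invariant[OF val conjunct1[OF IH] 1 order_refl]
  have ok1: "fl1 \<longrightarrow> ?ok c1" using inv by (rule conjunct1[OF conjunct2[OF conjunct2]])
  have sum1: "bucket_sum b (2 ^ k) t1 + (if fl1 then mset c1 else {#}) = bucket_sum b (2 ^ k) t + {#j#}"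
    using inv by (rule conjunct2[OF conjunct2[OF conjunct2]])
  have el: "eliminated b val (Suc j) = (t1, if fl1 then c1 # os else os)" using to 1 by simp
  have "mset (concat (if fl1 then c1 # os else os)) = (if fl1 then mset c1 else {#}) + mset (concat os)"
    by simp
  then have "bucket_sum b (2 ^ k) t1 + mset (concat (if fl1 then c1 # os else os)) =
      bucket_sum b (2 ^ k) t + {#j#} + mset (concat os)"
    by (simp only: sum1[symmetric] add.assoc)
  also have "\<dots> = (bucket_sum b (2 ^ k) t + mset (concat os)) + {#j#}"
    by (simp only: add.assoc add.commute[of "{#j#}"])
  also have "\<dots> = mset [0..<Suc j]"
    using conjunct2[OF conjunct2[OF IH]] by simp
  finally have sum2: "bucket_sum b (2 ^ k) t1 + mset (concat (if fl1 then c1 # os else os)) = mset [0..<Suc j]" .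
  have "\<forall>c \<in> set (if fl1 then c1 # os else os). ?ok c"
  proof
    fix c assume "c \<in> set (if fl1 then c1 # os else os)"
    then consider "c = c1" "fl1" | "c \<in> set os" by (cases fl1) auto
    then show "?ok c"
    proof cases
      case 1
      show ?thesis unfolding 1(1) using ok1 1(2) by (rule mp)
    next
      case 2
      show ?thesis by (rule bspec[OF conjunct1[OF conjunct2[OF IH]] 2])
    qed
  qed
  then show ?case unfolding el fst_conv snd_conv using sum2 conjunct1[OF inv] by (intro conjI)
qed

lemma distinct_mset_le:
  assumes "mset xs \<subseteq># mset ys" "distinct ys"
  shows "distinct xs"
  unfolding distinct_count_atmost_1
proof
  fix a
  have "count (mset xs) a \<le> count (mset ys) a" using assms(1) by (rule mset_subset_eq_count)
  also have "\<dots> \<le> 1" using assms(2) by (simp add: distinct_count_atmost_1)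
  finally have "count (mset xs) a \<le> 1" .
  moreover have "count (mset xs) a = 0 \<longleftrightarrow> a \<notin> set xs" by (simp add: count_eq_zero_iff)
  ultimately show "count (mset xs) a = (if a \<in> set xs then 1 else 0)" by (cases "a \<in> set xs") (auto simp: le_Suc_eq)
qed

lemma length_concat_const: "(\<And>c. c \<in> set os \<Longrightarrow> length c = l) \<Longrightarrow> length (concat os) = length os * l"
  by (induction os) simp_all

text \<open>Buckets and finished lists together contain each index below \<open>m\<close> exactly
  once. What is lost in the buckets is at most one list of length \<open>2 ^ g\<close> for each of
  the \<open>2 ^ k\<close> values in round \<open>g\<close>, and these lengths sum to less than
  \<open>2 ^ k * 2 ^ b\<close>.\<close>

lemma eliminated_props:
  fixes b k m :: nat and val :: "nat \<Rightarrow> nat \<Rightarrow> nat"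
  assumes val: "\<And>j g. val j g < 2 ^ k"
  defines "os \<equiv> snd (eliminated b val m)"
  shows "distinct (concat os)" "set (concat os) \<subseteq> {..<m}"
    and "\<And>c. c \<in> set os \<Longrightarrow> length c = 2 ^ b"
    and "\<And>c h. c \<in> set os \<Longrightarrow> h < b \<Longrightarrow> xor_list (\<lambda>j. val j h) c = 0"
    and "m \<le> (length os + 2 ^ k) * 2 ^ b"
proof -
  let ?t = "fst (eliminated b val m)"
  note inv = eliminated_invariant[where val = val and k = k and b = b and j = m, OF val, folded os_def]
  note tot = conjunct2[OF conjunct2[OF inv]]
  have sub: "mset (concat os) \<subseteq># mset [0..<m]" unfolding tot[symmetric] by (rule mset_subset_eq_add_right)
  show "distinct (concat os)" using distinct_mset_le[OF sub] by simp
  show "set (concat os) \<subseteq> {..<m}" using set_mset_mono[OF sub] by (simp only: set_mset_mset set_upt atLeast0LessThan)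
  show len: "\<And>c. c \<in> set os \<Longrightarrow> length c = 2 ^ b"
    and "\<And>c h. c \<in> set os \<Longrightarrow> h < b \<Longrightarrow> xor_list (\<lambda>j. val j h) c = 0"
    using bspec[OF conjunct1[OF conjunct2[OF inv]]] by simp_all
  have "size (bucket_sum b (2 ^ k) ?t) = (\<Sum>(g, v) \<in> {..<b} \<times> {..<2 ^ k}. length (?t g v))"
    unfolding bucket_sum_def
    by (subst sum_comp_morphism[where h = size, symmetric]) (auto intro!: sum.cong)
  also have "\<dots> \<le> (\<Sum>(g, v) \<in> {..<b} \<times> {..<2 ^ k :: nat}. 2 ^ g)"
  proof (rule sum_mono)
    fix x :: "nat \<times> nat"
    obtain g v where x: "x = (g, v)" by fastforce
    have "length (?t g v) \<le> 2 ^ g"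
      using conjunct1[OF inv] unfolding good_buckets_def by (cases "?t g v = []") auto
    then show "(case x of (g, v) \<Rightarrow> length (?t g v)) \<le> (case x of (g, v) \<Rightarrow> 2 ^ g)" by (simp add: x)
  qed
  also have "\<dots> = 2 ^ k * (\<Sum>g<b. 2 ^ g)"
    by (simp add: sum.cartesian_product[symmetric] sum_distrib_left)
  also have "(\<Sum>g<b. (2::nat) ^ g) \<le> 2 ^ b" using sum_power2[of b] by (simp add: atLeast0LessThan)
  finally have s: "size (bucket_sum b (2 ^ k) ?t) \<le> 2 ^ k * 2 ^ b" by simp
  have "m = size (mset [0..<m])" by simp
  also have "\<dots> = size (bucket_sum b (2 ^ k) ?t) + length (concat os)"
    unfolding tot[symmetric] by (simp only: size_union size_mset)
  also have "length (concat os) = length os * 2 ^ b"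
    using len by (rule length_concat_const)
  finally show "m \<le> (length os + 2 ^ k) * 2 ^ b" using s by (simp add: algebra_simps)
qed

lemma xor_list_cong: "(\<And>j. j \<in> set js \<Longrightarrow> f j = g j) \<Longrightarrow> xor_list f js = xor_list g js"
  by (induction js) auto

text \<open>All lists consist of indices below \<open>m\<close>, so \<open>val\<close> is consulted
  nowhere else. This makes the elimination a function of the first \<open>m\<close> samples.\<close>

lemma eliminated_cong:
  assumes val: "\<And>j g. val j g < 2 ^ k" and eq: "\<And>j. j < m \<Longrightarrow> val j = val' j"
  shows "eliminated b val m = eliminated b val' m"
proof -
  have step: "insert_step val g (t, c, fl) = insert_step val' g (t, c, fl)" if "set c \<subseteq> {..<m}" for t c fl g
  proof -
    have "xor_list (\<lambda>j. val j g) c = xor_list (\<lambda>j. val' j g) c"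
      using that eq by (intro xor_list_cong) auto
    then show ?thesis by (simp add: insert_step_def)
  qed
  have ins: "inserted val g (t, [j], True) = inserted val' g (t, [j], True) \<and>
      (case inserted val g (t, [j], True) of (t', c', fl') \<Rightarrow>
        set c' \<subseteq> {..<m} \<and> (\<forall>g v. set (t' g v) \<subseteq> {..<m}))"
    if "\<And>g v. set (t g v) \<subseteq> {..<m}" "j < m" for g t j
  proof (induction g)
    case 0
    then show ?case using that by auto
  next
    case (Suc g)
    obtain t1 c1 fl1 where 1: "inserted val g (t, [j], True) = (t1, c1, fl1)" by (metis prod_cases3)
    have c1: "set c1 \<subseteq> {..<m}" "\<And>g v. set (t1 g v) \<subseteq> {..<m}" using Suc.IH 1 by auto
    have "inserted val' g (t, [j], True) = (t1, c1, fl1)" using Suc.IH 1 by simp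
    moreover have "case insert_step val g (t1, c1, fl1) of (t', c', fl') \<Rightarrow>
        set c' \<subseteq> {..<m} \<and> (\<forall>g v. set (t' g v) \<subseteq> {..<m})"
      using c1 by (auto simp: insert_step_def Let_def)
    ultimately show ?case using step[OF c1(1)] 1 by simp
  qed
  have "eliminated b val j = eliminated b val' j \<and> (\<forall>g v. set (fst (eliminated b val j) g v) \<subseteq> {..<m})"
    if "j \<le> m" for j
    using that
  proof (induction j)
    case (Suc j)
    let ?t = "fst (eliminated b val j)"
    have IH0: "eliminated b val j = eliminated b val' j \<and> (\<forall>g v. set (?t g v) \<subseteq> {..<m})"
      using Suc.prems by (intro Suc.IH) simp
    have IH: "eliminated b val j = eliminated b val' j" "\<And>g v. set (?t g v) \<subseteq> {..<m}" "j < m"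
      using conjunct1[OF IH0] conjunct2[OF IH0, rule_format] Suc.prems by (blast, blast, simp)
    obtain t1 c1 fl1 where 1: "inserted val b (?t, [j], True) = (t1, c1, fl1)" by (metis prod_cases3)
    note i = ins[where t = ?t and g = b, OF IH(2,3), unfolded 1]
    have e1: "inserted val' b (fst (eliminated b val' j), [j], True) = (t1, c1, fl1)"
      using conjunct1[OF i] by (simp only: IH(1)[symmetric])
    have "eliminated b val (Suc j) = (t1, if fl1 then c1 # snd (eliminated b val j) else snd (eliminated b val j))"
      by (simp add: 1)
    moreover have "eliminated b val' (Suc j) = (t1, if fl1 then c1 # snd (eliminated b val j) else snd (eliminated b val j))"
      by (simp add: e1 IH(1))
    ultimately show ?case using conjunct2[OF i] by simp
  qed simp
  then show ?thesis by simp
qed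

section \<open>Packed words and the number of errors of a candidate\<close>

lemma xor_horner: "(\<And>l. f l \<le> 1) \<Longrightarrow> (\<And>l. g l \<le> 1) \<Longrightarrow>
  xor (horner f q) (horner g q) = horner (\<lambda>l. xor (f l) (g l)) q"
proof (induction q)
  case (Suc q)
  have "xor (2 * a + x) (2 * c + y) = 2 * xor a c + xor x y" if "x \<le> 1" "y \<le> 1" for a c x y :: nat
    using that by (subst xor_rec) (auto simp: le_Suc_eq)
  then show ?case using Suc by simp
qed simp

lemma xor_le1: "a \<le> 1 \<Longrightarrow> b \<le> 1 \<Longrightarrow> xor a b \<le> (1::nat)"
  by (auto simp: le_Suc_eq)

lemma xor_list_horner:
  "(\<And>j l. f j l \<le> 1) \<Longrightarrow> xor_list (\<lambda>j. horner (f j) q) js = horner (\<lambda>l. xor_list (\<lambda>j. f j l) js) q"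
proof (induction js)
  case Nil
  have "horner (\<lambda>_. 0) q = 0" by (induction q) auto
  then show ?case by simp
next
  case (Cons j js)
  then show ?case by (simp add: xor_horner xor_list_le1[simplified])
qed

lemma horner_eq_0: "horner f q = 0 \<longleftrightarrow> (\<forall>l < q. f l = 0)"
  by (induction q) (auto simp: less_Suc_eq)

lemma popcount_horner: "(\<And>l. f l \<le> 1) \<Longrightarrow> popcount (horner f q) = (\<Sum>l<q. f l)"
proof (induction q)
  case (Suc q)
  have "popcount (2 * v + x) = popcount v + x" if "x \<le> 1" for v x :: nat
    using that by (subst popcount.simps) (auto simp: le_Suc_eq popcount.simps[of 0])
  then show ?case using Suc by simp
qed (simp add: popcount.simps)

lemma xor_list_parity: "(\<And>i. f i \<le> 1) \<Longrightarrow> xor_list f js = (\<Sum>i\<leftarrow>js. f i) mod 2"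
proof (induction js)
  case (Cons j js)
  have x: "xor a c = (a + c) mod 2" if "a \<le> 1" "c \<le> 1" for a c :: nat
    using that by (auto simp: le_Suc_eq)
  have "xor_list f (j # js) = (f j + (\<Sum>i\<leftarrow>js. f i) mod 2) mod 2"
    using Cons by (subst xor_list_simps, subst Cons.IH) (auto intro!: x)
  then show ?case by (simp add: mod_add_right_eq)
qed simp

context lspn
begin

text \<open>A coordinate listed twice would cancel in \<open>xor_list\<close>, whereas the analysis
  speaks of the set of coordinates. The blocks are disjoint because \<open>u\<close> increases
  strictly.\<close>

lemma candidate_distinct:
  assumes "increasing k N u"
  shows "distinct (candidate u X k)"
proof -
  have mono: "u l < u l'" if "l < l'" "l' < k" for l l'
    using that
  proof (induction l')
    case (Suc l')
    then have "u l' < u (Suc l')" using assms by (simp add: increasing_def)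
    then show ?case using Suc by (cases "l = l'") auto
  qed simp
  have "distinct (candidate u X x)" if "x \<le> k" for x
    using that
  proof (induction x)
    case (Suc x)
    have "distinct (chosen u X x b)" by (simp add: chosen_def distinct_map)
    moreover have "i < u x * b" if i: "i \<in> set (candidate u X x)" for i
    proof -
      obtain l where l: "l < x" "i \<in> set (chosen u X l b)" using i by (auto simp: candidate_def)
      then have "i < Suc (u l) * b" by (auto simp: chosen_def)
      also have "\<dots> \<le> u x * b" using mono[OF l(1)] Suc.prems by (intro mult_right_mono) auto
      finally show ?thesis .
    qed
    moreover have "u x * b \<le> i" if "i \<in> set (chosen u X x b)" for i
      using that by (auto simp: chosen_def)
    ultimately show ?case using Suc by (fastforce simp: candidate_def)
  qed (simp add: candidate_def)
  then show ?thesis by simp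
qed

definition errors_of :: "nat set \<Rightarrow> (nat \<Rightarrow> nat \<Rightarrow> nat) \<Rightarrow> nat" where
  "errors_of S X = (\<Sum>t < r * q. of_bool ((\<Sum>i\<in>S. X (M + t) i) mod 2 \<noteq> X (M + t) n))"

text \<open>Bit \<open>h\<close> of word \<open>a\<close> belongs to scoring sample
  \<open>a * q + h\<close>, and \<open>xor\<close> acts bit by bit. Hence the population counts of
  the words, regrouped, count the samples on which the candidate errs.\<close>

lemma errors_eq:
  assumes u: "increasing k N u" and X: "\<And>j i. X j i \<le> 1"
  shows "errors u X = errors_of (set (candidate u X k)) X"
proof -
  let ?c = "candidate u X k"
  let ?f = "\<lambda>t. xor (X (M + t) n) (xor_list (X (M + t)) ?c)"
  have f1: "?f t \<le> 1" for t using X by (intro xor_le1 xor_list_le1) auto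
  have f: "?f t = of_bool ((\<Sum>i\<in>set ?c. X (M + t) i) mod 2 \<noteq> X (M + t) n)" for t
  proof -
    have "xor_list (X (M + t)) ?c = (\<Sum>i\<in>set ?c. X (M + t) i) mod 2"
      using X by (simp add: xor_list_parity sum_list_distinct_conv_sum_set[OF candidate_distinct[OF u]])
    moreover have "xor a c = of_bool (c \<noteq> a)" if "a \<le> 1" "c \<le> 1" for a c :: nat
      using that by (auto simp: le_Suc_eq)
    ultimately show ?thesis using X[of "M + t" n] by (metis (no_types, lifting) less_Suc_eq_le mod_less_divisor One_nat_def Suc_1 pos2)
  qed
  have "popcount (xor (col X n a) (xor_list (\<lambda>i. col X i a) ?c)) = (\<Sum>t\<in>{a * q..<a * q + q}. ?f t)" for a
  proof -
    have "xor (col X n a) (xor_list (\<lambda>i. col X i a) ?c) = horner (\<lambda>h. ?f (a * q + h)) q"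
      unfolding col_def using X by (simp add: xor_list_horner xor_horner xor_list_le1[simplified])
    then have "popcount (xor (col X n a) (xor_list (\<lambda>i. col X i a) ?c)) = (\<Sum>h<q. ?f (a * q + h))"
      using f1 by (simp add: popcount_horner)
    also have "\<dots> = (\<Sum>t\<in>{a * q..<a * q + q}. ?f t)"
      using sum.shift_bounds_nat_ivl[of ?f 0 "a * q" q] by (simp add: atLeast0LessThan add.commute)
    finally show ?thesis .
  qed
  then have "errors u X = (\<Sum>a<r. \<Sum>t\<in>{a * q..<a * q + q}. ?f t)"
    unfolding errors_def by simp
  also have "\<dots> = (\<Sum>t < r * q. ?f t)" by (rule sum.nat_group)
  finally show ?thesis by (simp add: errors_of_def f)
qed

end

section \<open>Noisy samples and their biases\<close>

lemma prob_bind_le: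
  assumes "\<And>x. x \<in> set_pmf p \<Longrightarrow> measure_pmf.prob (f x) E \<le> e" "0 \<le> e"
  shows "measure_pmf.prob (bind_pmf p f) E \<le> e"
proof -
  have "emeasure (bind_pmf p f) E = (\<integral>\<^sup>+x. emeasure (f x) E \<partial>p)" by simp
  also have "\<dots> \<le> (\<integral>\<^sup>+x. ennreal e \<partial>p)"
    using assms by (intro nn_integral_mono_AE) (auto simp: AE_measure_pmf_iff measure_pmf.emeasure_eq_measure ennreal_leI)
  also have "\<dots> = ennreal e" by simp
  finally show ?thesis using assms(2) by (simp add: measure_pmf.emeasure_eq_measure)
qed

lemma prob_le_expectation:
  fixes f :: "'a \<Rightarrow> real"
  assumes "finite (set_pmf p)" "\<And>x. x \<in> set_pmf p \<Longrightarrow> x \<in> E \<Longrightarrow> 1 \<le> f x"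
    and "\<And>x. x \<in> set_pmf p \<Longrightarrow> 0 \<le> f x"
  shows "measure_pmf.prob p E \<le> measure_pmf.expectation p f"
proof -
  have "measure_pmf.prob p E = measure_pmf.expectation p (indicator E)" by simp
  also have "\<dots> \<le> measure_pmf.expectation p f"
    using assms by (intro integral_mono_AE integrable_measure_pmf_finite)
      (auto simp: AE_measure_pmf_iff indicator_def)
  finally show ?thesis .
qed

lemma expectation_pair_prod:
  fixes f :: "'a \<Rightarrow> real" and g :: "'b \<Rightarrow> real"
  assumes "finite (set_pmf A)" "finite (set_pmf B)"
  shows "measure_pmf.expectation (pair_pmf A B) (\<lambda>(a, b). f a * g b) =
    measure_pmf.expectation A f * measure_pmf.expectation B g"
proof -
  have "measure_pmf.expectation (pair_pmf A B) (\<lambda>(a, b). f a * g b) =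
      (\<Sum>(a, b) \<in> set_pmf A \<times> set_pmf B. pmf A a * pmf B b * (f a * g b))"
    using assms by (subst integral_measure_pmf[of "set_pmf A \<times> set_pmf B"])
      (auto simp: pmf_pair intro!: sum.cong)
  also have "\<dots> = (\<Sum>a\<in>set_pmf A. pmf A a * f a) * (\<Sum>b\<in>set_pmf B. pmf B b * g b)"
    by (simp add: sum_product sum.cartesian_product[symmetric] ac_simps)
  also have "\<dots> = measure_pmf.expectation A f * measure_pmf.expectation B g"
    using assms by (simp add: integral_measure_pmf[of "set_pmf A"] integral_measure_pmf[of "set_pmf B"])
  finally show ?thesis .
qed

lemma replicate_pmf_Suc_pair: "replicate_pmf (Suc m) D = map_pmf (\<lambda>(x, xs). x # xs) (pair_pmf D (replicate_pmf m D))"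
  by (simp add: pair_pmf_def map_bind_pmf map_pmf_def bind_assoc_pmf bind_return_pmf)

lemma finite_replicate_pmf: "finite (set_pmf D) \<Longrightarrow> finite (set_pmf (replicate_pmf m D))"
  by (auto simp: set_replicate_pmf in_lists_conv_set intro: finite_subset[OF _ finite_lists_length_eq[of "set_pmf D" m]])

lemma expectation_replicate_prod:
  fixes f :: "nat \<Rightarrow> 'a \<Rightarrow> real"
  assumes "finite (set_pmf D)"
  shows "measure_pmf.expectation (replicate_pmf m D) (\<lambda>zs. \<Prod>t<m. f t (zs ! t)) =
    (\<Prod>t<m. measure_pmf.expectation D (f t))"
proof (induction m arbitrary: f)
  case (Suc m)
  have "measure_pmf.expectation (replicate_pmf (Suc m) D) (\<lambda>zs. \<Prod>t<Suc m. f t (zs ! t)) =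
      measure_pmf.expectation (pair_pmf D (replicate_pmf m D)) (\<lambda>(x, xs). f 0 x * (\<Prod>t<m. f (Suc t) (xs ! t)))"
    unfolding replicate_pmf_Suc_pair integral_map_pmf
    by (simp add: case_prod_beta' prod.lessThan_Suc_shift del: prod.lessThan_Suc)
  also have "\<dots> = measure_pmf.expectation D (f 0) * (\<Prod>t<m. measure_pmf.expectation D (f (Suc t)))"
    using expectation_pair_prod[OF assms finite_replicate_pmf[OF assms, of m],
        where f = "f 0" and g = "\<lambda>xs. \<Prod>t<m. f (Suc t) (xs ! t)"] Suc.IH[of "\<lambda>t. f (Suc t)"] by simp
  also have "\<dots> = (\<Prod>t<Suc m. measure_pmf.expectation D (f t))"
    by (simp add: prod.lessThan_Suc_shift del: prod.lessThan_Suc)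
  finally show ?case .
qed simp

text \<open>Independence inside one sample lifts to independence of two lists. It allows everything
  that the elimination sees to be fixed while the other bits remain fresh.\<close>

lemma map_replicate_pair:
  assumes "map_pmf (\<lambda>z. (v z, w z)) D = pair_pmf V W"
  shows "map_pmf (\<lambda>zs. (map v zs, map w zs)) (replicate_pmf m D) = pair_pmf (replicate_pmf m V) (replicate_pmf m W)"
proof (induction m)
  case 0
  then show ?case by (simp add: pair_return_pmf1)
next
  case (Suc m)
  have "map_pmf (\<lambda>zs. (map v zs, map w zs)) (replicate_pmf (Suc m) D) =
      map_pmf (\<lambda>((a, b), (as, bs)). (a # as, b # bs))
        (pair_pmf (map_pmf (\<lambda>z. (v z, w z)) D) (map_pmf (\<lambda>zs. (map v zs, map w zs)) (replicate_pmf m D)))"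
    by (simp add: replicate_pmf_Suc_pair map_pair[symmetric] map_pmf_comp case_prod_beta' del: replicate_pmf.simps)
  also have "\<dots> = map_pmf (\<lambda>((a, b), (as, bs)). (a # as, b # bs))
        (pair_pmf (pair_pmf V W) (pair_pmf (replicate_pmf m V) (replicate_pmf m W)))"
    by (simp only: assms Suc)
  also have "\<dots> = pair_pmf (replicate_pmf (Suc m) V) (replicate_pmf (Suc m) W)"
    by (simp add: pair_pmf_def map_pmf_def bind_assoc_pmf bind_return_pmf bind_commute_pmf[of W "replicate_pmf m V"])
  finally show ?case .
qed

definition sg :: "bool \<Rightarrow> real" where "sg b = (if b then -1 else 1)"

lemma sg_sq: "sg b * sg b = 1"
  by (simp add: sg_def)

text \<open>The piling-up lemma: by independence each index in \<open>A\<close> contributes a factor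
  \<open>1 - 2 * p\<close>, every other index a factor 1.\<close>

lemma expectation_sg_prod:
  assumes "0 \<le> p" "p \<le> 1" "A \<subseteq> {..<m}"
  shows "measure_pmf.expectation (replicate_pmf m (bernoulli_pmf p)) (\<lambda>bs. \<Prod>j\<in>A. sg (bs ! j)) = (1 - 2 * p) ^ card A"
proof -
  have fin: "finite (set_pmf (bernoulli_pmf p))" by simp
  have "(\<Prod>j\<in>A. sg (bs ! j)) = (\<Prod>j<m. if j \<in> A then sg (bs ! j) else 1)" for bs
    using assms(3) by (simp add: prod.If_cases Int_absorb1)
  then have "measure_pmf.expectation (replicate_pmf m (bernoulli_pmf p)) (\<lambda>bs. \<Prod>j\<in>A. sg (bs ! j)) =
      (\<Prod>j<m. measure_pmf.expectation (bernoulli_pmf p) (\<lambda>x. if j \<in> A then sg x else 1))"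
    using expectation_replicate_prod[OF fin, of m "\<lambda>j x. if j \<in> A then sg x else 1"] by simp
  also have "\<dots> = (\<Prod>j<m. if j \<in> A then 1 - 2 * p else 1)"
    using assms by (intro prod.cong) (auto simp: sg_def)
  also have "\<dots> = (1 - 2 * p) ^ card A"
    using assms(3) by (simp add: prod.If_cases Int_absorb1)
  finally show ?thesis .
qed

definition signed_sum :: "nat list list \<Rightarrow> bool list \<Rightarrow> real" where
  "signed_sum os bs = (\<Sum>S\<leftarrow>os. \<Prod>j\<in>set S. sg (bs ! j))"

text \<open>Products over disjoint sets of bits are uncorrelated and have square 1, so the variance
  is at most the number of lists.\<close>

lemma signed_sum_second_moment:
  assumes p: "0 \<le> p" "p \<le> 1" and d: "distinct (concat os)" "set (concat os) \<subseteq> {..<m}"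
    and len: "\<And>S. S \<in> set os \<Longrightarrow> length S = c" and c: "0 < c"
  shows "measure_pmf.expectation (replicate_pmf m (bernoulli_pmf p))
     (\<lambda>bs. (signed_sum os bs - real (length os) * (1 - 2 * p) ^ c)\<^sup>2) \<le> real (length os)"
proof -
  let ?E = "measure_pmf.expectation (replicate_pmf m (bernoulli_pmf p))"
  let ?\<mu> = "(1 - 2 * p) ^ c" and ?K = "real (length os)"
  define Y where "Y S bs = (\<Prod>j\<in>set S. sg (bs ! j))" for S :: "nat list" and bs
  have int: "integrable (measure_pmf (replicate_pmf m (bernoulli_pmf p))) f" for f :: "bool list \<Rightarrow> real"
    by (intro integrable_measure_pmf_finite finite_replicate_pmf) simp
  have ne: "S \<noteq> []" if "S \<in> set os" for S using len[OF that] c by auto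
  \<comment> \<open>Only the empty list could occur twice in a distinct concatenation, and
    \<open>c > 0\<close> excludes it. So the sum over the list is a sum over a set.\<close>
  have "removeAll [] os = os" using ne by (intro removeAll_id) auto
  then have dos: "distinct os" using d(1) by (simp add: distinct_concat_iff)
  have dS: "distinct S" if "S \<in> set os" for S using d(1) that by (auto simp: distinct_concat_iff)
  have disj: "set S \<inter> set S' = {}" if "S \<in> set os" "S' \<in> set os" "S \<noteq> S'" for S S'
    using d(1) that by (auto simp: distinct_concat_iff)
  have sub: "set S \<subseteq> {..<m}" if "S \<in> set os" for S using d(2) that by auto
  have card: "card (set S) = c" if "S \<in> set os" for S using len dS that by (simp add: distinct_card)
  have EY: "?E (Y S) = ?\<mu>" if "S \<in> set os" for S
    unfolding Y_def using expectation_sg_prod[OF p sub[OF that]] card[OF that] by simp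
  have EYY: "?E (\<lambda>bs. Y S bs * Y S' bs) = (if S = S' then 1 else ?\<mu>\<^sup>2)" if S: "S \<in> set os" "S' \<in> set os" for S S'
  proof (cases "S = S'")
    case True
    then show ?thesis by (simp add: Y_def prod.distrib[symmetric] sg_sq)
  next
    case False
    have "Y S bs * Y S' bs = (\<Prod>j\<in>set S \<union> set S'. sg (bs ! j))" for bs
      unfolding Y_def using disj[OF S False] by (intro prod.union_disjoint[symmetric]) auto
    moreover have "card (set S \<union> set S') = c + c"
      using disj[OF S False] card S by (subst card_Un_disjoint) auto
    ultimately show ?thesis
      using False expectation_sg_prod[OF p, of "set S \<union> set S'" m] sub S
      by (simp add: power2_eq_square power_add)
  qed
  have Z: "signed_sum os bs = (\<Sum>S\<in>set os. Y S bs)" for bs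
    unfolding signed_sum_def Y_def using dos by (simp add: sum_list_distinct_conv_sum_set)
  have K: "?K = card (set os)" using dos by (simp add: distinct_card)
  have EZ: "?E (signed_sum os) = ?K * ?\<mu>"
    unfolding Z K using int EY by (simp add: Bochner_Integration.integral_sum)
  have "?E (\<lambda>bs. (signed_sum os bs)\<^sup>2) = (\<Sum>S\<in>set os. \<Sum>S'\<in>set os. ?E (\<lambda>bs. Y S bs * Y S' bs))"
    unfolding Z power2_eq_square sum_product using int by (simp add: Bochner_Integration.integral_sum)
  also have "\<dots> = (\<Sum>S\<in>set os. \<Sum>S'\<in>set os. ?\<mu>\<^sup>2 + (if S = S' then 1 - ?\<mu>\<^sup>2 else 0))"
    using EYY by (intro sum.cong refl) auto
  also have "\<dots> = ?K * (?K * ?\<mu>\<^sup>2) + ?K * (1 - ?\<mu>\<^sup>2)"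
    by (simp add: sum.distrib K algebra_simps)
  finally have EZ2: "?E (\<lambda>bs. (signed_sum os bs)\<^sup>2) = ?K * (?K * ?\<mu>\<^sup>2) + ?K * (1 - ?\<mu>\<^sup>2)" .
  have "?E (\<lambda>bs. (signed_sum os bs - ?K * ?\<mu>)\<^sup>2) =
      ?E (\<lambda>bs. (signed_sum os bs)\<^sup>2 - 2 * (?K * ?\<mu>) * signed_sum os bs + (?K * ?\<mu>)\<^sup>2)"
    by (intro Bochner_Integration.integral_cong refl) (simp add: power2_diff)
  also have "\<dots> = ?E (\<lambda>bs. (signed_sum os bs)\<^sup>2) - 2 * (?K * ?\<mu>) * ?E (signed_sum os) + (?K * ?\<mu>)\<^sup>2"
    using int by (simp add: Bochner_Integration.integral_add Bochner_Integration.integral_diff)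
  also have "\<dots> = ?K * (1 - ?\<mu>\<^sup>2)"
    unfolding EZ EZ2 by (simp add: power2_eq_square algebra_simps)
  also have "\<dots> \<le> ?K" by (simp add: algebra_simps)
  finally show ?thesis .
qed

text \<open>Chebyshev's inequality, with a fixed lower bound \<open>L\<close> in place of the number
  of lists, which will depend on the samples.\<close>

lemma signed_sum_chebyshev:
  fixes \<tau> :: real and L :: nat
  assumes p: "0 \<le> p" "p \<le> 1" and d: "distinct (concat os)" "set (concat os) \<subseteq> {..<m}"
    and len: "\<And>S. S \<in> set os \<Longrightarrow> length S = c" and c: "0 < c"
    and L: "0 < L" "L \<le> length os" and \<tau>: "0 < \<tau>"
  shows "measure_pmf.prob (replicate_pmf m (bernoulli_pmf p))
     {bs. \<tau> * length os \<le> \<bar>signed_sum os bs - real (length os) * (1 - 2 * p) ^ c\<bar>} \<le> 1 / (\<tau>\<^sup>2 * L)"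
proof -
  let ?E = "measure_pmf.expectation (replicate_pmf m (bernoulli_pmf p))"
  let ?\<mu> = "(1 - 2 * p) ^ c" and ?K = "real (length os)"
  have K: "0 < ?K" using L by linarith
  have a: "0 < (\<tau> * ?K)\<^sup>2" using \<tau> K by simp
  have "measure_pmf.prob (replicate_pmf m (bernoulli_pmf p))
     {bs. \<tau> * length os \<le> \<bar>signed_sum os bs - ?K * ?\<mu>\<bar>} \<le> ?E (\<lambda>bs. (signed_sum os bs - ?K * ?\<mu>)\<^sup>2 / (\<tau> * ?K)\<^sup>2)"
  proof (rule prob_le_expectation, goal_cases)
    case 1
    show ?case by (intro finite_replicate_pmf) simp
  next
    case (2 bs)
    then have "(\<tau> * ?K)\<^sup>2 \<le> (signed_sum os bs - ?K * ?\<mu>)\<^sup>2"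
      using \<tau> K by (intro abs_le_square_iff[THEN iffD1]) auto
    then show ?case using a by simp
  qed simp
  also have "\<dots> = ?E (\<lambda>bs. (signed_sum os bs - ?K * ?\<mu>)\<^sup>2) / (\<tau> * ?K)\<^sup>2" by simp
  also have "\<dots> \<le> ?K / (\<tau> * ?K)\<^sup>2"
    using signed_sum_second_moment[OF p d len c] a by (intro divide_right_mono) auto
  also have "\<dots> = 1 / (\<tau>\<^sup>2 * ?K)" using K by (simp add: power2_eq_square)
  also have "\<dots> \<le> 1 / (\<tau>\<^sup>2 * L)" using L \<tau> K by (intro divide_left_mono mult_left_mono) auto
  finally show ?thesis .
qed

lemma map_coin_neq: "map_pmf (\<lambda>c. a \<noteq> c) (bernoulli_pmf (1 / 2)) = bernoulli_pmf (1 / 2)"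
proof -
  have "bij_betw (\<lambda>c. a \<noteq> c) UNIV (UNIV :: bool set)"
    by (rule bij_betwI[where g = "\<lambda>c. a \<noteq> c"]) auto
  then show ?thesis unfolding bernoulli_pmf_half_conv_pmf_of_set
    by (intro map_pmf_of_set_bij_betw) auto
qed

text \<open>Applying \<open>f\<close> with probability 1/2 does not change \<open>U\<close>. It
  leaves \<open>g\<close> alone and adds an independent fair coin to \<open>\<phi>\<close>.\<close>

lemma flip_invariant_pair:
  assumes inv: "map_pmf f U = U" and g: "\<And>x. x \<in> set_pmf U \<Longrightarrow> g (f x) = g x"
    and \<phi>: "\<And>x. x \<in> set_pmf U \<Longrightarrow> \<phi> (f x) \<longleftrightarrow> \<not> \<phi> x"
  shows "map_pmf (\<lambda>x. (g x, \<phi> x)) U = pair_pmf (map_pmf g U) (bernoulli_pmf (1 / 2))"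
proof -
  have "U = bind_pmf (bernoulli_pmf (1 / 2)) (\<lambda>c. map_pmf (if c then f else id) U)"
    using inv by (subst bind_pmf_cong[OF refl, where g = "\<lambda>_. U"]) (auto simp: pmf.map_id)
  then have "map_pmf (\<lambda>x. (g x, \<phi> x)) U =
      map_pmf (\<lambda>x. (g x, \<phi> x)) (bind_pmf (bernoulli_pmf (1 / 2)) (\<lambda>c. map_pmf (if c then f else id) U))"
    by simp
  also have "\<dots> = bind_pmf (bernoulli_pmf (1 / 2)) (\<lambda>c. map_pmf (\<lambda>x. (g x, \<phi> x \<noteq> c)) U)"
    using g \<phi> by (auto simp: map_bind_pmf map_pmf_comp intro!: bind_pmf_cong map_pmf_cong)
  also have "\<dots> = bind_pmf U (\<lambda>x. map_pmf (\<lambda>c. (g x, \<phi> x \<noteq> c)) (bernoulli_pmf (1 / 2)))"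
    unfolding map_pmf_def by (rule bind_commute_pmf)
  also have "\<dots> = bind_pmf U (\<lambda>x. map_pmf (Pair (g x)) (bernoulli_pmf (1 / 2)))"
    by (intro bind_pmf_cong refl) (subst (2) map_coin_neq[symmetric], simp add: map_pmf_comp)
  also have "\<dots> = pair_pmf (map_pmf g U) (bernoulli_pmf (1 / 2))"
    by (simp add: pair_pmf_def map_pmf_def bind_assoc_pmf bind_return_pmf)
  finally show ?thesis .
qed

section \<open>Uniform bit vectors and the flip of one coordinate\<close>

lemma UNIV_bit: "UNIV = {0, 1 :: bit}"
  using bit_not_one_iff by auto

lemma finite_carrier_vec_bit: "finite (carrier_vec n :: bit Matrix.vec set)"
proof -
  have sub: "(carrier_vec n :: bit Matrix.vec set) \<subseteq> (\<lambda>l. vec_of_list l) ` {l. set l \<subseteq> UNIV \<and> length l = n}"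
  proof
    fix x :: "bit Matrix.vec" assume "x \<in> carrier_vec n"
    then show "x \<in> vec_of_list ` {l. set l \<subseteq> UNIV \<and> length l = n}"
      by (intro image_eqI[of _ _ "list_of_vec x"]) (auto simp: vec_list)
  qed
  have fin: "finite {l :: bit list. set l \<subseteq> UNIV \<and> length l = n}" by (rule finite_lists_length_eq) (simp add: UNIV_bit)
  show ?thesis by (rule finite_surj[OF fin sub])
qed

definition flip :: "nat \<Rightarrow> bit Matrix.vec \<Rightarrow> bit Matrix.vec" where
  "flip i x = Matrix.vec (dim_vec x) (\<lambda>j. if j = i then x $ j + 1 else x $ j)"

lemma flip_carrier: "x \<in> carrier_vec n \<Longrightarrow> flip i x \<in> carrier_vec n"
  by (auto simp: flip_def)

lemma flip_nth: "j < dim_vec x \<Longrightarrow> flip i x $ j = (if j = i then x $ j + 1 else x $ j)"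
  by (simp add: flip_def)

lemma flip_flip: "flip i (flip i x) = x"
  by (rule eq_vecI) (auto simp: flip_def add.assoc)

lemma map_flip_uniform: "map_pmf (flip i) (pmf_of_set (carrier_vec n)) = pmf_of_set (carrier_vec n)"
proof (rule map_pmf_of_set_bij_betw)
  show "bij_betw (flip i) (carrier_vec n) (carrier_vec n)"
    by (rule bij_betwI[where g = "flip i"]) (auto simp: flip_flip flip_carrier)
  show "carrier_vec n \<noteq> ({} :: bit Matrix.vec set)" by (metis empty_iff zero_carrier_vec)
qed (rule finite_carrier_vec_bit)

lemma set_uniform: "set_pmf (pmf_of_set (carrier_vec n)) = (carrier_vec n :: bit Matrix.vec set)"
  using finite_carrier_vec_bit[of n] by (intro set_pmf_of_set) (auto intro: zero_carrier_vec)

section \<open>Failure probability\<close>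

definition support :: "bit Matrix.vec \<Rightarrow> nat set" where
  "support s = {i. i < dim_vec s \<and> s $ i = 1}"

definition odd_on :: "nat set \<Rightarrow> bit Matrix.vec \<Rightarrow> bool" where
  "odd_on S x \<longleftrightarrow> odd (\<Sum>i\<in>S. of_bool (x $ i = 1) :: nat)"

lemma bit_add_eq_1: "(a + b = (1 :: bit)) \<longleftrightarrow> (a = 1) \<noteq> (b = 1)"
  by (cases a; cases b) auto

lemma sum_bit_eq_1: "finite A \<Longrightarrow> (\<Sum>i\<in>A. f i) = (1 :: bit) \<longleftrightarrow> odd (\<Sum>i\<in>A. of_bool (f i = 1) :: nat)"
proof (induction A rule: finite_induct)
  case (insert x F)
  show ?case unfolding sum.insert[OF insert(1,2)] bit_add_eq_1 insert.IH
    by (cases "f x = 1") simp_all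
qed simp

lemma scalar_prod_eq_1:
  assumes "x \<in> carrier_vec n" "s \<in> carrier_vec n"
  shows "scalar_prod x s = 1 \<longleftrightarrow> odd_on (support s) x"
proof -
  have "scalar_prod x s = (\<Sum>i\<in>{0..<n}. x $ i * s $ i)" using assms by (simp add: scalar_prod_def)
  then have "scalar_prod x s = 1 \<longleftrightarrow> odd (\<Sum>i\<in>{0..<n}. of_bool (x $ i * s $ i = 1) :: nat)"
    by (simp only: sum_bit_eq_1 finite_atLeastLessThan)
  also have "(\<Sum>i\<in>{0..<n}. of_bool (x $ i * s $ i = 1) :: nat) = (\<Sum>i\<in>support s. of_bool (x $ i = 1))"
    using assms by (intro sum.mono_neutral_cong_right) (auto simp: support_def)
  finally show ?thesis by (simp add: odd_on_def)
qed

lemma odd_on_flip: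
  assumes "S \<subseteq> {..<n}" "x \<in> carrier_vec n"
  shows "odd_on S (flip i x) \<longleftrightarrow> (odd_on S x \<noteq> (i \<in> S))"
proof -
  have fin: "finite S" using assms finite_subset by blast
  have d: "j < dim_vec x" if "j \<in> S" for j using that assms by auto
  have eq: "flip i x $ j = x $ j" if "j \<in> S - {i}" for j using that d by (simp add: flip_nth)
  show ?thesis
  proof (cases "i \<in> S")
    case True
    have "(\<Sum>j\<in>S. of_bool (flip i x $ j = 1) :: nat) = of_bool (x $ i \<noteq> 1) + (\<Sum>j\<in>S - {i}. of_bool (x $ j = 1))"
      using True d eq by (subst sum.remove[OF fin True]) (auto simp: flip_nth bit_add_eq_1 intro!: sum.cong)
    moreover have "(\<Sum>j\<in>S. of_bool (x $ j = 1) :: nat) = of_bool (x $ i = 1) + (\<Sum>j\<in>S - {i}. of_bool (x $ j = 1))"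
      by (rule sum.remove[OF fin True])
    ultimately show ?thesis using True by (simp add: odd_on_def)
  next
    case False
    then have "(\<Sum>j\<in>S. of_bool (flip i x $ j = 1) :: nat) = (\<Sum>j\<in>S. of_bool (x $ j = 1))"
      using eq by (intro sum.cong) auto
    then show ?thesis using False by (simp add: odd_on_def)
  qed
qed

lemma scalar_prod_eq_0:
  assumes "x \<in> carrier_vec n" "s \<in> carrier_vec n"
  shows "scalar_prod x s = 0 \<longleftrightarrow> \<not> odd_on (support s) x"
  using scalar_prod_eq_1[OF assms] by (cases "scalar_prod x s") auto

text \<open>The noise bit is recovered from the sample by means of \<open>s\<close>, so no larger
  probability space is needed.\<close>

definition noise :: "bit Matrix.vec \<Rightarrow> bit Matrix.vec \<times> bit \<Rightarrow> bool" where
  "noise s z \<longleftrightarrow> (snd z = 1) \<noteq> odd_on (support s) (fst z)"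

lemma support_subset: "s \<in> carrier_vec n \<Longrightarrow> support s \<subseteq> {..<n}"
  by (auto simp: support_def)

lemma lspn_sample_bind:
  "lspn_sample \<eta> n s = bind_pmf (bernoulli_pmf \<eta>) (\<lambda>e.
     map_pmf (\<lambda>x. (x, scalar_prod x s + of_bool e)) (pmf_of_set (carrier_vec n)))"
  unfolding lspn_sample_def pair_pmf_def map_bind_pmf map_return_pmf
  by (subst bind_commute_pmf) (simp add: map_pmf_def bind_assoc_pmf bind_return_pmf)

lemma set_lspn_sample: "z \<in> set_pmf (lspn_sample \<eta> n s) \<Longrightarrow> fst z \<in> carrier_vec n"
  by (auto simp: lspn_sample_bind set_uniform)

lemma finite_lspn_sample: "finite (set_pmf (lspn_sample \<eta> n s))"
  by (auto simp: lspn_sample_bind set_uniform finite_carrier_vec_bit)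

lemma noise_independent:
  assumes s: "s \<in> carrier_vec n"
  shows "map_pmf (\<lambda>z. (g (fst z), noise s z)) (lspn_sample \<eta> n s) =
    pair_pmf (map_pmf g (pmf_of_set (carrier_vec n))) (bernoulli_pmf \<eta>)"
proof -
  have "map_pmf (\<lambda>z. (g (fst z), noise s z)) (lspn_sample \<eta> n s) =
      map_pmf (apfst g) (pair_pmf (pmf_of_set (carrier_vec n)) (bernoulli_pmf \<eta>))"
    unfolding lspn_sample_def map_pmf_comp
    by (intro map_pmf_cong refl) (auto simp: noise_def set_uniform scalar_prod_eq_1[OF _ s] scalar_prod_eq_0[OF _ s])
  then show ?thesis by (simp add: pair_map_pmf1)
qed

text \<open>For \<open>i\<close> in the support, flipping coordinate \<open>i\<close> changes the
  label and nothing that \<open>g\<close> sees. Hence the label is a fair coin whatever the noise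
  is.\<close>

lemma label_independent:
  assumes s: "s \<in> carrier_vec n" and i: "i \<in> support s"
    and g: "\<And>x. x \<in> carrier_vec n \<Longrightarrow> g (flip i x) = g x"
  shows "map_pmf (\<lambda>z. (g (fst z), snd z = 1)) (lspn_sample \<eta> n s) =
    pair_pmf (map_pmf g (pmf_of_set (carrier_vec n))) (bernoulli_pmf (1 / 2))"
proof -
  let ?U = "pmf_of_set (carrier_vec n) :: bit Matrix.vec pmf"
  have "map_pmf (\<lambda>z. (g (fst z), snd z = 1)) (lspn_sample \<eta> n s) =
      bind_pmf (bernoulli_pmf \<eta>) (\<lambda>e. map_pmf (\<lambda>x. (g x, odd_on (support s) x \<noteq> e)) ?U)"
    unfolding lspn_sample_bind map_bind_pmf map_pmf_comp
    by (intro bind_pmf_cong map_pmf_cong refl) (auto simp: set_uniform scalar_prod_eq_1[OF _ s] scalar_prod_eq_0[OF _ s])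
  also have "\<dots> = bind_pmf (bernoulli_pmf \<eta>) (\<lambda>e. pair_pmf (map_pmf g ?U) (bernoulli_pmf (1 / 2)))"
    using g i odd_on_flip[OF support_subset[OF s]]
    by (intro bind_pmf_cong refl flip_invariant_pair[OF map_flip_uniform[of i]]) (auto simp: set_uniform)
  finally show ?thesis by simp
qed

definition disagrees :: "nat set \<Rightarrow> bit Matrix.vec \<times> bit \<Rightarrow> bool" where
  "disagrees S z \<longleftrightarrow> (snd z = 1) \<noteq> odd_on S (fst z)"

lemma disagrees_support: "disagrees (support s) z = noise s z"
  by (simp add: disagrees_def noise_def)

text \<open>Some coordinate \<open>i\<close> lies in exactly one of \<open>S\<close> and the
  support. For fixed noise, flipping it toggles exactly one of the two parities and so the
  disagreement.\<close>

lemma disagrees_independent: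
  assumes s: "s \<in> carrier_vec n" and S: "S \<subseteq> {..<n}" "S \<noteq> support s"
  shows "map_pmf (\<lambda>z. (noise s z, disagrees S z)) (lspn_sample \<eta> n s) =
    pair_pmf (bernoulli_pmf \<eta>) (bernoulli_pmf (1 / 2))"
proof -
  obtain i where i: "(i \<in> S) \<noteq> (i \<in> support s)" using S(2) by blast
  let ?U = "pmf_of_set (carrier_vec n) :: bit Matrix.vec pmf"
  have "map_pmf (\<lambda>z. (noise s z, disagrees S z)) (lspn_sample \<eta> n s) =
      bind_pmf (bernoulli_pmf \<eta>) (\<lambda>e. map_pmf (\<lambda>x. (e, (odd_on (support s) x \<noteq> e) \<noteq> odd_on S x)) ?U)"
    unfolding lspn_sample_bind map_bind_pmf map_pmf_comp
    by (intro bind_pmf_cong map_pmf_cong refl) (auto simp: noise_def disagrees_def set_uniform scalar_prod_eq_1[OF _ s] scalar_prod_eq_0[OF _ s])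
  also have "\<dots> = bind_pmf (bernoulli_pmf \<eta>) (\<lambda>e. pair_pmf (map_pmf (\<lambda>_. e) ?U) (bernoulli_pmf (1 / 2)))"
  proof (intro bind_pmf_cong refl)
    fix e
    show "map_pmf (\<lambda>x. (e, (odd_on (support s) x \<noteq> e) \<noteq> odd_on S x)) ?U =
        pair_pmf (map_pmf (\<lambda>_. e) ?U) (bernoulli_pmf (1 / 2))"
      by (rule flip_invariant_pair[OF map_flip_uniform[of i]])
        (use i in \<open>auto simp: set_uniform odd_on_flip[OF support_subset[OF s]] odd_on_flip[OF S(1)]\<close>)
  qed
  also have "\<dots> = pair_pmf (bernoulli_pmf \<eta>) (bernoulli_pmf (1 / 2))"
    by (simp add: map_pmf_const pair_pmf_def bind_return_pmf)
  finally show ?thesis .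
qed

text \<open>An exponential moment: whenever \<open>S\<close> errs no more often than the support,
  the product of the weights \<open>f\<close> over the samples is at least 1, and its expectation is
  the power on the right-hand side.\<close>

lemma test_prob:
  assumes \<eta>: "0 \<le> \<eta>" "\<eta> < 1 / 2" and s: "s \<in> carrier_vec n" and S: "S \<subseteq> {..<n}" "S \<noteq> support s"
  shows "measure_pmf.prob (replicate_pmf m (lspn_sample \<eta> n s))
      {zs. (\<Sum>t<m. of_bool (disagrees S (zs ! t)) :: nat) \<le> (\<Sum>t<m. of_bool (noise s (zs ! t)))}
    \<le> (3 / 4 + \<eta> * (1 - \<eta>)) ^ m"
proof -
  \<comment> \<open>The best weight would be the square root of
    \<open>\<eta> / (1 - \<eta>)\<close>, which degenerates at \<open>\<eta> = 0\<close>. This one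
    is positive throughout and turns the expectation of \<open>f\<close> into the polynomial
    \<open>3 / 4 + \<eta> * (1 - \<eta>)\<close>.\<close>
  define l where "l = 1 / (2 * (1 - \<eta>))"
  have l: "0 < l" "l < 1" "1 \<le> 1 / l" using \<eta> by (auto simp: l_def field_simps)
  define f where "f z = (if noise s z then 1 / l else 1) * (if disagrees S z then l else 1)" for z
  let ?D = "lspn_sample \<eta> n s" and ?\<beta> = "3 / 4 + \<eta> * (1 - \<eta>)"
  have Ef: "measure_pmf.expectation ?D f = ?\<beta>"
  proof -
    have "measure_pmf.expectation ?D f = measure_pmf.expectation (map_pmf (\<lambda>z. (noise s z, disagrees S z)) ?D)
        (\<lambda>(e, d). (if e then 1 / l else 1) * (if d then l else 1))"
      by (simp add: f_def[abs_def])
    also have "\<dots> = measure_pmf.expectation (bernoulli_pmf \<eta>) (\<lambda>e. if e then 1 / l else 1) *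
        measure_pmf.expectation (bernoulli_pmf (1 / 2)) (\<lambda>d. if d then l else 1)"
      unfolding disagrees_independent[OF s S] by (rule expectation_pair_prod) auto
    also have "\<dots> = (\<eta> / l + (1 - \<eta>)) * (l / 2 + 1 / 2)"
      using \<eta> by simp
    also have "\<dots> = ?\<beta>" using \<eta> by (simp add: l_def field_simps power2_eq_square)
    finally show ?thesis .
  qed
  have "measure_pmf.prob (replicate_pmf m ?D)
      {zs. (\<Sum>t<m. of_bool (disagrees S (zs ! t)) :: nat) \<le> (\<Sum>t<m. of_bool (noise s (zs ! t)))}
    \<le> measure_pmf.expectation (replicate_pmf m ?D) (\<lambda>zs. \<Prod>t<m. f (zs ! t))"
  proof (rule prob_le_expectation, goal_cases)
    case (2 zs)
    let ?a = "\<Sum>t<m. of_bool (noise s (zs ! t)) :: nat" and ?d = "\<Sum>t<m. of_bool (disagrees S (zs ! t)) :: nat"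
    have "(\<Prod>t<m. f (zs ! t)) = (\<Prod>t<m. (1 / l) ^ of_bool (noise s (zs ! t))) * (\<Prod>t<m. l ^ of_bool (disagrees S (zs ! t)))"
      unfolding f_def prod.distrib by (intro arg_cong2[where f = "(*)"] prod.cong) auto
    also have "\<dots> = (1 / l) ^ ?a * l ^ ?d" by (simp only: power_sum)
    also have "\<dots> = (1 / l) ^ (?a - ?d) * ((1 / l) ^ ?d * l ^ ?d)"
      using 2 by (simp add: power_add[symmetric] mult.assoc[symmetric])
    also have "(1 / l) ^ ?d * l ^ ?d = 1" using l by (simp add: power_mult_distrib[symmetric])
    finally show ?case using l by simp
  next
    case (3 zs)
    show ?case using l by (intro prod_nonneg) (auto simp: f_def)
  qed (rule finite_replicate_pmf[OF finite_lspn_sample])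
  also have "\<dots> = ?\<beta> ^ m"
    using expectation_replicate_prod[OF finite_lspn_sample, where m = m and f = "\<lambda>_. f"] by (simp add: Ef)
  finally show ?thesis .
qed

lemma sg_odd_on: "finite S \<Longrightarrow> sg (odd_on S x) = (\<Prod>c\<in>S. sg (x $ c = 1))"
  unfolding odd_on_def by (induction S rule: finite_induct) (auto simp: sg_def)

lemma sg_xor_list:
  assumes "\<And>j. f j \<le> 1" "distinct js"
  shows "1 - 2 * real (xor_list f js) = (\<Prod>j\<in>set js. sg (f j = 1))"
  using assms(2)
proof (induction js)
  case (Cons j js)
  have x: "1 - 2 * real (xor a c) = sg (a = 1) * (1 - 2 * real c)" if "a \<le> 1" "c \<le> 1" for a c :: nat
    using that by (auto simp: le_Suc_eq sg_def)
  have "1 - 2 * real (xor_list f (j # js)) = sg (f j = 1) * (1 - 2 * real (xor_list f js))"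
    unfolding xor_list_simps by (rule x[OF assms(1) xor_list_le1[OF assms(1)]])
  then show ?case using Cons by simp
qed simp

text \<open>Truncated subtraction does no harm: for a negative bias the left product is 0 and the
  right one is not positive, so both comparisons fail.\<close>

lemma threshold_iff:
  "cnt < (cnt - (z + z)) * D \<longleftrightarrow> real cnt < (real cnt - 2 * real z) * real D"
proof (cases "z + z \<le> cnt")
  case True
  then have "real ((cnt - (z + z)) * D) = (real cnt - 2 * real z) * real D" by (simp add: of_nat_diff)
  then show ?thesis by (metis of_nat_less_iff)
next
  case False
  then have "(real cnt - 2 * real z) * real D \<le> 0" by (intro mult_nonpos_nonneg) auto
  then show ?thesis using False by (simp add: not_less order.trans[of _ 0])
qed

lemma prob_pair_le:
  assumes "\<And>x. x \<in> set_pmf A \<Longrightarrow> measure_pmf.prob B {y. (x, y) \<in> E} \<le> e" "0 \<le> e"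
  shows "measure_pmf.prob (pair_pmf A B) E \<le> e"
proof -
  have "pair_pmf A B = bind_pmf A (\<lambda>x. map_pmf (Pair x) B)" by (simp add: pair_pmf_def map_pmf_def)
  then show ?thesis using assms by (auto intro!: prob_bind_le simp: vimage_def)
qed

section \<open>Decisions about coordinates and success of the search\<close>

context lspn
begin

lemma pk_cong: "(\<And>c. c < n \<Longrightarrow> c \<noteq> i \<Longrightarrow> x c = x' c) \<Longrightarrow> pk u i x = pk u i x'"
  unfolding pk_def by (intro ext arg_cong2[where f = horner]) auto

text \<open>The digits of a sum of packed words are the sums of the digits, and a packed word
  vanishes only if all its digits do.\<close>

lemma zero_sum_coordinate:
  assumes X: "\<And>j c. X j c \<le> 1" and z: "xor_list (\<lambda>j. pk u i (X j) h) S = 0"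
    and c: "l < k" "c = u l * b + h" "c < n" "c \<noteq> i"
  shows "xor_list (\<lambda>j. X j c) S = 0"
proof -
  let ?f = "\<lambda>j l. if u l * b + h < n \<and> u l * b + h \<noteq> i then X j (u l * b + h) else 0"
  have "xor_list (\<lambda>j. horner (?f j) k) S = horner (\<lambda>l. xor_list (\<lambda>j. ?f j l) S) k"
    by (rule xor_list_horner) (simp add: X[simplified])
  then have "horner (\<lambda>l. xor_list (\<lambda>j. ?f j l) S) k = 0" using z by (simp only: pk_def)
  then have "xor_list (\<lambda>j. ?f j l) S = 0" using c(1) by (simp only: horner_eq_0)
  then show ?thesis using c by simp
qed

text \<open>The common core of both cases of a decision, where \<open>w\<close> is the label or the
  noise. Since the groups are independent of \<open>w\<close>, they may be fixed first; this fixes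
  the lists, and Chebyshev's inequality applies to fresh bits \<open>w\<close>.\<close>

lemma dec_prob_aux:
  fixes V :: "(nat \<Rightarrow> nat) pmf"
  assumes ind: "map_pmf (\<lambda>z. (pk u i (sample_bit n z), w z)) P = pair_pmf V (bernoulli_pmf p)"
    and p: "0 \<le> p" "p \<le> 1" and L: "0 < L" "(L + 2 ^ k) * 2 ^ b \<le> M" and \<tau>: "0 < \<tau>"
    and E: "\<And>zs os. length zs = M \<Longrightarrow> set zs \<subseteq> set_pmf P \<Longrightarrow> zs \<in> E \<Longrightarrow>
       os = snd (eliminated b (\<lambda>j. pk u i (sample_bit n (zs ! j))) M) \<Longrightarrow>
       \<tau> * real (length os) \<le> \<bar>signed_sum os (map w zs) - real (length os) * (1 - 2 * p) ^ (2 ^ b)\<bar>"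
  shows "measure_pmf.prob (replicate_pmf M P) E \<le> 1 / (\<tau>\<^sup>2 * L)"
proof -
  let ?v = "\<lambda>z. pk u i (sample_bit n z)"
  \<comment> \<open>From index \<open>M\<close> on any small value would do; 0 respects the bound
    \<open>2 ^ k\<close>.\<close>
  define os where "os vs = snd (eliminated b (\<lambda>j. if j < M then vs ! j else (\<lambda>_. 0)) M)" for vs :: "(nat \<Rightarrow> nat) list"
  define F where "F = {(vs, bs). \<tau> * real (length (os vs)) \<le>
    \<bar>signed_sum (os vs) bs - real (length (os vs)) * (1 - 2 * p) ^ (2 ^ b)\<bar>}"
  have v_less: "?v z g < 2 ^ k" for z g
    by (rule pk_less) (rule sample_bit_le1)
  have "measure_pmf.prob (replicate_pmf M P) E \<le>
      measure_pmf.prob (replicate_pmf M P) ((\<lambda>zs. (map ?v zs, map w zs)) -` F)"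
  proof -
    have "measure_pmf.prob (replicate_pmf M P) E = measure_pmf.prob (replicate_pmf M P) (E \<inter> set_pmf (replicate_pmf M P))"
      by (simp add: measure_Int_set_pmf)
    also have "\<dots> \<le> measure_pmf.prob (replicate_pmf M P) ((\<lambda>zs. (map ?v zs, map w zs)) -` F)"
    proof (rule measure_pmf.finite_measure_mono, rule subsetI, goal_cases)
      case (1 zs)
      then have zs: "length zs = M" "set zs \<subseteq> set_pmf P" "zs \<in> E" by (auto simp: set_replicate_pmf)
      have "eliminated b (\<lambda>j. if j < M then map ?v zs ! j else (\<lambda>_. 0)) M = eliminated b (\<lambda>j. ?v (zs ! j)) M"
        by (rule eliminated_cong[where k = k]) (use zs(1) v_less in auto)
      then have "os (map ?v zs) = snd (eliminated b (\<lambda>j. ?v (zs ! j)) M)" by (simp add: os_def)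
      from E[OF zs this] show ?case by (simp add: F_def)
    qed simp
    finally show ?thesis .
  qed
  also have "\<dots> = measure_pmf.prob (pair_pmf (replicate_pmf M V) (replicate_pmf M (bernoulli_pmf p))) F"
    unfolding map_replicate_pair[OF ind, symmetric] by simp
  also have "\<dots> \<le> 1 / (\<tau>\<^sup>2 * L)"
  proof (rule prob_pair_le)
    fix vs assume vs: "vs \<in> set_pmf (replicate_pmf M V)"
    have "set_pmf V = (\<lambda>z. ?v z) ` set_pmf P"
    proof -
      have "V = map_pmf fst (map_pmf (\<lambda>z. (?v z, w z)) P)" unfolding ind by (simp add: map_fst_pair_pmf)
      then show ?thesis by (simp add: map_pmf_comp)
    qed
    then have less: "(if j < M then vs ! j else (\<lambda>_. 0)) g < 2 ^ k" for j g
    proof (cases "j < M")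
      case True
      then have "vs ! j \<in> set_pmf V" using vs by (auto simp: set_replicate_pmf in_lists_conv_set)
      then obtain z where "vs ! j = ?v z" using \<open>set_pmf V = _\<close> by blast
      then show ?thesis using True v_less by simp
    qed simp
    note el = eliminated_props[where b = b and k = k and m = M and val = "\<lambda>j. if j < M then vs ! j else (\<lambda>_. 0)",
        OF less, folded os_def]
    have "(L + 2 ^ k) * 2 ^ b \<le> (length (os vs) + 2 ^ k) * 2 ^ b" using el(5) L(2) by linarith
    then have "L \<le> length (os vs)" by simp
    then have "measure_pmf.prob (replicate_pmf M (bernoulli_pmf p)) {bs. \<tau> * length (os vs) \<le>
         \<bar>signed_sum (os vs) bs - real (length (os vs)) * (1 - 2 * p) ^ (2 ^ b)\<bar>} \<le> 1 / (\<tau>\<^sup>2 * L)"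
      by (intro signed_sum_chebyshev p el(1,2,3) L(1) \<tau>) auto
    then show "measure_pmf.prob (replicate_pmf M (bernoulli_pmf p)) {y. (vs, y) \<in> F} \<le> 1 / (\<tau>\<^sup>2 * L)"
      by (simp add: F_def)
  qed (use \<tau> L in auto)
  finally show ?thesis .
qed

text \<open>The mean bias is 0 for \<open>i\<close> in the support and at least \<open>2 / D\<close>
  otherwise. The threshold \<open>1 / D\<close> separates them, so a wrong decision is a deviation
  by at least \<open>1 / D\<close>.\<close>

lemma dec_prob:
  assumes \<eta>: "0 \<le> \<eta>" "\<eta> < 1 / 2" and s: "s \<in> carrier_vec n"
    and sup: "\<And>c. c \<in> support s \<Longrightarrow> \<exists>l < k. \<exists>h < b. c = u l * b + h"
    and L: "0 < L" "(L + 2 ^ k) * 2 ^ b \<le> M"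
    and D: "0 < D" "2 \<le> real D * (1 - 2 * \<eta>) ^ (2 ^ b)"
  shows "measure_pmf.prob (replicate_pmf M (lspn_sample \<eta> n s))
    {zs. dec u (\<lambda>j. sample_bit n (zs ! j)) i \<noteq> (i \<in> support s)} \<le> (real D)\<^sup>2 / L"
proof -
  let ?P = "lspn_sample \<eta> n s"
  let ?os = "\<lambda>zs. snd (eliminated b (\<lambda>j. pk u i (sample_bit n (zs ! j))) M)"
  define g where "g x = pk u i (\<lambda>c. of_bool (x $ c = 1))" for x :: "bit Matrix.vec"
  have g: "pk u i (sample_bit n z) = g (fst z)" for z
    unfolding g_def by (rule pk_cong) (simp add: sample_bit_def)
  have X: "sample_bit n z c \<le> 1" for z c by (rule sample_bit_le1)
  define lab where "lab zs j = sample_bit n (zs ! j) n" for zs :: "(bit Matrix.vec \<times> bit) list" and j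
  have lab1: "lab zs j \<le> 1" for zs j by (simp only: lab_def X)
  have labv: "(lab zs j = Suc 0) \<longleftrightarrow> snd (zs ! j) = 1" for zs j by (simp add: lab_def sample_bit_def)
  have el: "distinct (concat (?os zs))" "set (concat (?os zs)) \<subseteq> {..<M}"
      "\<And>c h. c \<in> set (?os zs) \<Longrightarrow> h < b \<Longrightarrow> xor_list (\<lambda>j. pk u i (sample_bit n (zs ! j)) h) c = 0" for zs
  proof -
    have "pk u i (sample_bit n (zs ! j)) h < 2 ^ k" for j h by (rule pk_less[OF X])
    note p = eliminated_props[where k = k and b = b and m = M and val = "\<lambda>j. pk u i (sample_bit n (zs ! j))", OF this]
    show "distinct (concat (?os zs))" "set (concat (?os zs)) \<subseteq> {..<M}" by (rule p(1), rule p(2))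
    show "xor_list (\<lambda>j. pk u i (sample_bit n (zs ! j)) h) c = 0" if "c \<in> set (?os zs)" "h < b" for c h
      by (rule p(4)[OF that])
  qed
  have dS: "distinct S" "set S \<subseteq> {..<M}" if "S \<in> set (?os zs)" for S zs
    using el(1,2)[of zs] that by (auto simp: distinct_concat_iff)
  have dec: "dec u (\<lambda>j. sample_bit n (zs ! j)) i \<longleftrightarrow>
      \<not> real (length (?os zs)) < signed_sum (?os zs) (map (\<lambda>z. snd z = 1) zs) * real D" if "length zs = M" for zs
  proof -
    have "1 - 2 * real (xor_list (lab zs) S) = (\<Prod>j\<in>set S. sg (map (\<lambda>z. snd z = 1) zs ! j))" if "S \<in> set (?os zs)" for S
      using sg_xor_list[of "lab zs" S, OF lab1 dS(1)[OF that]] dS(2)[OF that] \<open>length zs = M\<close>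
      by (auto simp: labv intro!: prod.cong)
    then have "signed_sum (?os zs) (map (\<lambda>z. snd z = 1) zs) = (\<Sum>S\<leftarrow>?os zs. 1 - 2 * real (xor_list (lab zs) S))"
      unfolding signed_sum_def by (intro arg_cong[where f = sum_list] map_cong) auto
    also have "\<dots> = real (length (?os zs)) - 2 * real (sum_list (map (xor_list (lab zs)) (?os zs)))"
    proof -
      have "(\<Sum>S\<leftarrow>xs. 1 - 2 * real (f S)) = real (length xs) - 2 * real (sum_list (map f xs))"
        for xs and f :: "nat list \<Rightarrow> nat" by (induction xs) simp_all
      then show ?thesis .
    qed
    finally show ?thesis unfolding dec_def Let_def threshold_iff lab_def[abs_def] by simp
  qed
  have fin: "finite (support s)" using support_subset[OF s] finite_subset by blast
  let ?\<tau> = "1 / real D"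
  have "measure_pmf.prob (replicate_pmf M ?P) {zs. dec u (\<lambda>j. sample_bit n (zs ! j)) i \<noteq> (i \<in> support s)}
      \<le> 1 / (?\<tau>\<^sup>2 * L)"
  proof (cases "i \<in> support s")
    case True
    \<comment> \<open>Coordinate \<open>i\<close> is hidden from the groups, so the labels are fair
      coins even after the elimination.\<close>
    have "map_pmf (\<lambda>z. (pk u i (sample_bit n z), snd z = 1)) ?P =
        pair_pmf (map_pmf g (pmf_of_set (carrier_vec n))) (bernoulli_pmf (1 / 2))"
      unfolding g
    proof (rule label_independent[OF s True])
      fix x :: "bit Matrix.vec" assume "x \<in> carrier_vec n"
      then show "g (flip i x) = g x" unfolding g_def by (intro pk_cong) (auto simp: flip_nth)
    qed
    then show ?thesis
    proof (rule dec_prob_aux[OF _ _ _ L])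
      fix zs os assume zs: "length zs = M" "zs \<in> {zs. dec u (\<lambda>j. sample_bit n (zs ! j)) i \<noteq> (i \<in> support s)}"
        "os = ?os zs"
      then have "real (length os) < signed_sum os (map (\<lambda>z. snd z = 1) zs) * real D"
        using True dec[OF zs(1)] by simp
      then show "?\<tau> * real (length os) \<le> \<bar>signed_sum os (map (\<lambda>z. snd z = 1) zs) - real (length os) * (1 - 2 * (1 / 2)) ^ 2 ^ b\<bar>"
      proof -
        have "0 < signed_sum os (map (\<lambda>z. snd z = 1) zs) * real D"
          using \<open>real (length os) < _\<close> of_nat_0_le_iff[of "length os"] by linarith
        then have "0 < signed_sum os (map (\<lambda>z. snd z = 1) zs)" using D(1) by (simp add: zero_less_mult_iff)
        then show ?thesis using \<open>real (length os) < _\<close> D(1) by (simp add: field_simps power_0_left)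
      qed
    qed (use D in auto)
  next
    case False
    have "map_pmf (\<lambda>z. (pk u i (sample_bit n z), noise s z)) ?P =
        pair_pmf (map_pmf g (pmf_of_set (carrier_vec n))) (bernoulli_pmf \<eta>)"
      unfolding g by (rule noise_independent[OF s])
    then show ?thesis
    proof (rule dec_prob_aux[OF _ _ _ L])
      fix zs os assume zs: "length zs = M" "set zs \<subseteq> set_pmf ?P"
        "zs \<in> {zs. dec u (\<lambda>j. sample_bit n (zs ! j)) i \<noteq> (i \<in> support s)}" "os = ?os zs"
      \<comment> \<open>All coordinates of the support lie in the union and differ from
        \<open>i\<close>, so they cancel in the sum; its label is the sum of the noise bits.\<close>
      have "(\<Prod>j\<in>set S. sg (map (\<lambda>z. snd z = 1) zs ! j)) = (\<Prod>j\<in>set S. sg (map (noise s) zs ! j))"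
        if S: "S \<in> set os" for S
      proof -
        have "(\<Prod>j\<in>set S. sg (odd_on (support s) (fst (zs ! j)))) = (\<Prod>c\<in>support s. \<Prod>j\<in>set S. sg (fst (zs ! j) $ c = 1))"
          using fin by (simp add: sg_odd_on prod.swap[of _ "support s"])
        also have "\<dots> = 1"
        proof (rule prod.neutral, rule ballI)
          fix c assume c: "c \<in> support s"
          then obtain l h where lh: "l < k" "h < b" "c = u l * b + h" using sup by blast
          have cn: "c < n" "c \<noteq> i" using c False support_subset[OF s] by auto
          have "xor_list (\<lambda>j. sample_bit n (zs ! j) c) S = 0"
            by (rule zero_sum_coordinate[OF X el(3)[OF S[unfolded zs(4)] lh(2)] lh(1,3) cn])
          then have "(\<Prod>j\<in>set S. sg (sample_bit n (zs ! j) c = 1)) = 1"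
            using sg_xor_list[of "\<lambda>j. sample_bit n (zs ! j) c" S, OF X dS(1)[OF S[unfolded zs(4)]]] by simp
          moreover have "(sample_bit n (zs ! j) c = 1) = (fst (zs ! j) $ c = 1)" for j
            using cn by (simp add: sample_bit_def)
          ultimately show "(\<Prod>j\<in>set S. sg (fst (zs ! j) $ c = 1)) = 1" by (simp only:)
        qed
        finally have one: "(\<Prod>j\<in>set S. sg (odd_on (support s) (fst (zs ! j)))) = 1" .
        have "sg (map (\<lambda>z. snd z = 1) zs ! j) = sg (map (noise s) zs ! j) * sg (odd_on (support s) (fst (zs ! j)))"
          if "j \<in> set S" for j
          using that dS(2)[OF S[unfolded zs(4)]] zs(1) by (auto simp: noise_def sg_def)
        then show ?thesis using one by (simp add: prod.distrib)
      qed
      then have eq: "signed_sum os (map (\<lambda>z. snd z = 1) zs) = signed_sum os (map (noise s) zs)"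
        unfolding signed_sum_def by (intro arg_cong[where f = sum_list] map_cong) auto
      have "signed_sum os (map (noise s) zs) * real D \<le> real (length os)"
        using False dec[OF zs(1)] zs(3,4) by (simp add: eq[unfolded zs(4)])
      then have "signed_sum os (map (noise s) zs) \<le> ?\<tau> * real (length os)"
        using D(1) by (simp add: field_simps)
      moreover have "2 * ?\<tau> \<le> (1 - 2 * \<eta>) ^ 2 ^ b" using D by (simp add: field_simps)
      then have "(2 * ?\<tau>) * real (length os) \<le> (1 - 2 * \<eta>) ^ 2 ^ b * real (length os)"
        by (intro mult_right_mono) auto
      ultimately show "?\<tau> * real (length os) \<le> \<bar>signed_sum os (map (noise s) zs) - real (length os) * (1 - 2 * \<eta>) ^ 2 ^ b\<bar>"
        by (simp add: mult.commute)
    qed (use D \<eta> in auto)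
  qed
  also have "1 / (?\<tau>\<^sup>2 * L) = (real D)\<^sup>2 / L" using D by (simp add: power_divide)
  finally show ?thesis .
qed

lemma dec_cong:
  assumes X: "\<And>j c. X j c \<le> 1" and eq: "\<And>j. j < M \<Longrightarrow> X j = X' j"
  shows "dec u X i = dec u X' i"
proof -
  let ?val = "\<lambda>j. pk u i (X j)"
  have less: "?val j h < 2 ^ k" for j h by (rule pk_less[OF X])
  have e1: "eliminated b ?val M = eliminated b (\<lambda>j. pk u i (X' j)) M"
    by (rule eliminated_cong[where k = k]) (use less eq in auto)
  have "xor_list (\<lambda>j. X j n) S = xor_list (\<lambda>j. X' j n) S" if "S \<in> set (snd (eliminated b ?val M))" for S
  proof (rule xor_list_cong)
    fix j assume "j \<in> set S"
    then have "j \<in> set (concat (snd (eliminated b ?val M)))" using that by auto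
    also have "\<dots> \<subseteq> {..<M}" by (rule eliminated_props(2)[where k = k]) (rule less)
    finally show "X j n = X' j n" using eq by simp
  qed
  then have e2: "map (xor_list (\<lambda>j. X j n)) (snd (eliminated b ?val M)) = map (xor_list (\<lambda>j. X' j n)) (snd (eliminated b ?val M))"
    by (intro map_cong) auto
  show ?thesis by (simp only: dec_def Let_def e1 e2[unfolded e1])
qed

lemma set_candidate: "set (candidate u X k) = {i. i < n \<and> (\<exists>l < k. \<exists>h < b. i = u l * b + h) \<and> dec u X i}"
proof -
  have "set (chosen u X l b) = {i. i < n \<and> (\<exists>h < b. i = u l * b + h) \<and> dec u X i}" for l
    unfolding chosen_def set_filter set_map set_upt by fastforce
  then show ?thesis unfolding candidate_def by auto
qed

lemma candidate_cong:
  assumes "\<And>j c. X j c \<le> 1" "\<And>j. j < M \<Longrightarrow> X j = X' j"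
  shows "set (candidate u X k) = set (candidate u X' k)"
  unfolding set_candidate using dec_cong[where X = X and X' = X', OF assms] by simp

abbreviation bits :: "(bit Matrix.vec \<times> bit) list \<Rightarrow> nat \<Rightarrow> nat \<Rightarrow> nat" where
  "bits zs \<equiv> \<lambda>j. sample_bit n (zs ! j)"

lemma errors_of_append:
  assumes "length tr = M" "S \<subseteq> {..<n}"
  shows "errors_of S (bits (tr @ te)) = (\<Sum>t < r * q. of_bool (disagrees S (te ! t)))"
  unfolding errors_of_def
proof (rule sum.cong[OF refl])
  fix t assume "t \<in> {..<r * q}"
  have nth: "(tr @ te) ! (M + t) = te ! t" using assms(1) by (simp add: nth_append)
  have "(\<Sum>i\<in>S. sample_bit n (te ! t) i) = (\<Sum>i\<in>S. of_bool (fst (te ! t) $ i = 1))"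
    using assms(2) by (intro sum.cong) (auto simp: sample_bit_def)
  then show "(of_bool ((\<Sum>i\<in>S. bits (tr @ te) (M + t) i) mod 2 \<noteq> bits (tr @ te) (M + t) n) :: nat) = of_bool (disagrees S (te ! t))"
    unfolding nth disagrees_def odd_on_def
    by (auto simp: sample_bit_def odd_iff_mod_2_eq_one)
qed

lemma map_take_replicate_pmf: "map_pmf (take m) (replicate_pmf (m + l) P) = replicate_pmf m P"
proof -
  have "map_pmf (take m) (replicate_pmf (m + l) P) =
      bind_pmf (replicate_pmf m P) (\<lambda>xs. bind_pmf (replicate_pmf l P) (\<lambda>ys. return_pmf (take m (xs @ ys))))"
    by (simp add: replicate_pmf_distrib map_bind_pmf)
  also have "\<dots> = bind_pmf (replicate_pmf m P) (\<lambda>xs. bind_pmf (replicate_pmf l P) (\<lambda>ys. return_pmf xs))"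
    by (intro bind_pmf_cong refl) (auto simp: set_replicate_pmf)
  also have "\<dots> = replicate_pmf m P" by (simp add: bind_return_pmf')
  finally show ?thesis .
qed

text \<open>There are two ways to fail: a wrong decision within the union \<open>i1\<close> that
  covers the support, which takes \<open>k * b\<close> decisions, or a wrong candidate of some union
  that makes no more errors than the support.\<close>

lemma success_prob:
  assumes \<eta>: "0 \<le> \<eta>" "\<eta> < 1 / 2" and s: "s \<in> carrier_vec n"
    and kN: "k \<le> N" and i1: "i1 < N choose k"
    and sup: "\<And>c. c \<in> support s \<Longrightarrow> \<exists>l < k. \<exists>h < b. c = comb k N i1 l * b + h"
    and L: "0 < L" "(L + 2 ^ k) * 2 ^ b \<le> M"
    and D: "0 < D" "2 \<le> real D * (1 - 2 * \<eta>) ^ (2 ^ b)"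
  shows "measure_pmf.prob (replicate_pmf (M + r * q) (lspn_sample \<eta> n s))
      {zs. \<exists>m. argmin_output (bits zs) m \<and> \<not> (\<forall>i < n. m i = of_bool (s $ i = 1))}
    \<le> real (k * b) * ((real D)\<^sup>2 / L) + real (N choose k) * (3 / 4 + \<eta> * (1 - \<eta>)) ^ (r * q)"
proof -
  let ?P = "lspn_sample \<eta> n s" and ?u = "comb k N" and ?\<beta> = "3 / 4 + \<eta> * (1 - \<eta>)"
  let ?R = "replicate_pmf (M + r * q) ?P"
  have X: "bits zs j c \<le> 1" for zs j c by (rule sample_bit_le1)
  define A where "A = (\<Union>(l, h) \<in> {..<k} \<times> {..<b}. {zs. dec (?u i1) (bits zs) (?u i1 l * b + h) \<noteq> (?u i1 l * b + h \<in> support s)})"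
  define A' where "A' = {zs. take M zs \<in> A}"
  define C where "C i zs = set (candidate (?u i) (bits zs) k)" for i zs
  define Bi where "Bi i = {zs. C i zs \<noteq> support s \<and> errors_of (C i zs) (bits zs) \<le> errors_of (support s) (bits zs)}" for i
  have C_sub: "C i zs \<subseteq> {..<n}" for i zs by (auto simp: C_def set_candidate)
  have C_take: "C i (take M zs) = C i zs" if "M \<le> length zs" for i zs
    unfolding C_def by (rule candidate_cong[OF X]) (use that in simp)
  have cover: "{zs. \<exists>m. argmin_output (bits zs) m \<and> \<not> (\<forall>i < n. m i = of_bool (s $ i = 1))} \<inter> set_pmf ?R
      \<subseteq> A' \<union> (\<Union>i < N choose k. Bi i)"
  proof (rule subsetI, rule ccontr)
    fix zs assume zs: "zs \<in> {zs. \<exists>m. argmin_output (bits zs) m \<and> \<not> (\<forall>i < n. m i = of_bool (s $ i = 1))} \<inter> set_pmf ?R"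
      and out: "zs \<notin> A' \<union> (\<Union>i < N choose k. Bi i)"
    then obtain m where m: "argmin_output (bits zs) m" "\<not> (\<forall>i < n. m i = of_bool (s $ i = 1))" by blast
    have len: "length zs = M + r * q" using zs by (simp add: set_replicate_pmf)
    have "dec (?u i1) (bits (take M zs)) (?u i1 l * b + h) = (?u i1 l * b + h \<in> support s)" if "l < k" "h < b" for l h
      using out that by (auto simp: A_def A'_def)
    then have "C i1 (take M zs) = support s"
      unfolding C_def set_candidate using sup support_subset[OF s] by blast
    then have C1: "C i1 zs = support s" using C_take[of zs i1] len by simp
    obtain i0 where i0: "i0 < N choose k" "\<And>i. i < N choose k \<Longrightarrow> errors (?u i0) (bits zs) \<le> errors (?u i) (bits zs)"
        "\<And>i. i < n \<Longrightarrow> m i = of_bool (i \<in> C i0 zs)"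
      using m(1) unfolding argmin_output_def C_def by blast
    have err: "errors (?u i) (bits zs) = errors_of (C i zs) (bits zs)" if "i < N choose k" for i
      unfolding C_def using comb_rank[OF kN that] by (intro errors_eq X) simp
    have "errors_of (C i0 zs) (bits zs) \<le> errors_of (support s) (bits zs)"
      using i0(2)[OF i1] err[OF i0(1)] err[OF i1] C1 by simp
    then have "C i0 zs = support s" using out i0(1) by (auto simp: Bi_def)
    then have "\<forall>i < n. m i = of_bool (s $ i = 1)" using i0(3) s by (auto simp: support_def)
    then show False using m(2) by blast
  qed
  have pA: "measure_pmf.prob ?R A' \<le> real (k * b) * ((real D)\<^sup>2 / L)"
  proof -
    have "measure_pmf.prob ?R A' = measure_pmf.prob (replicate_pmf M ?P) A"
      unfolding A'_def map_take_replicate_pmf[of M "r * q" ?P, symmetric] by (simp add: vimage_def)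
    also have "\<dots> \<le> (\<Sum>x \<in> {..<k} \<times> {..<b}. measure_pmf.prob (replicate_pmf M ?P)
        (case x of (l, h) \<Rightarrow> {zs. dec (?u i1) (bits zs) (?u i1 l * b + h) \<noteq> (?u i1 l * b + h \<in> support s)}))"
      unfolding A_def by (intro measure_pmf.finite_measure_subadditive_finite) auto
    also have "\<dots> \<le> (\<Sum>x \<in> {..<k} \<times> {..<b}. (real D)\<^sup>2 / L)"
      using dec_prob[OF \<eta> s sup L D] by (intro sum_mono) (auto split: prod.splits)
    finally show ?thesis by simp
  qed
  have pB: "measure_pmf.prob ?R (Bi i) \<le> ?\<beta> ^ (r * q)" for i
    unfolding replicate_pmf_distrib
  proof (rule prob_bind_le)
    show "0 \<le> ?\<beta> ^ (r * q)" using \<eta> by simp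
    fix tr assume "tr \<in> set_pmf (replicate_pmf M ?P)"
    then have tr: "length tr = M" by (simp add: set_replicate_pmf)
    \<comment> \<open>Once the elimination samples \<open>tr\<close> are fixed, the candidate is a
      constant set and \<open>test_prob\<close> applies to the scoring samples alone.\<close>
    define S where "S = C i tr"
    have S: "C i (tr @ te) = S" for te using C_take[of "tr @ te" i] tr by (simp add: S_def)
    have "{te. tr @ te \<in> Bi i} \<subseteq> {te. S \<noteq> support s \<and>
        (\<Sum>t<r * q. of_bool (disagrees S (te ! t)) :: nat) \<le> (\<Sum>t<r * q. of_bool (noise s (te ! t)))}"
    proof
      fix te assume "te \<in> {te. tr @ te \<in> Bi i}"
      then have h: "S \<noteq> support s \<and> errors_of S (bits (tr @ te)) \<le> errors_of (support s) (bits (tr @ te))"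
        by (simp only: Bi_def mem_Collect_eq S simp_thms)
      have "S \<subseteq> {..<n}" unfolding S_def by (rule C_sub)
      with h show "te \<in> {te. S \<noteq> support s \<and>
        (\<Sum>t<r * q. of_bool (disagrees S (te ! t)) :: nat) \<le> (\<Sum>t<r * q. of_bool (noise s (te ! t)))}"
        using errors_of_append[OF tr, of S te] errors_of_append[OF tr support_subset[OF s], of te]
        by (simp only: mem_Collect_eq disagrees_support simp_thms not_False_eq_True)
    qed
    then have "measure_pmf.prob (replicate_pmf (r * q) ?P) {te. tr @ te \<in> Bi i} \<le> measure_pmf.prob (replicate_pmf (r * q) ?P)
        {te. S \<noteq> support s \<and> (\<Sum>t<r * q. of_bool (disagrees S (te ! t)) :: nat) \<le> (\<Sum>t<r * q. of_bool (noise s (te ! t)))}"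
      by (intro measure_pmf.finite_measure_mono) auto
    also have "\<dots> \<le> ?\<beta> ^ (r * q)"
    proof (cases "S = support s")
      case False
      then show ?thesis using test_prob[OF \<eta> s C_sub[of i tr, folded S_def] False, of "r * q"] by simp
    qed (use \<eta> in simp)
    finally show "measure_pmf.prob (bind_pmf (replicate_pmf (r * q) ?P) (\<lambda>ys. return_pmf (tr @ ys))) (Bi i) \<le> ?\<beta> ^ (r * q)"
      by (simp add: map_pmf_def[symmetric] vimage_def)
  qed
  have "measure_pmf.prob ?R {zs. \<exists>m. argmin_output (bits zs) m \<and> \<not> (\<forall>i < n. m i = of_bool (s $ i = 1))} \<le>
      measure_pmf.prob ?R (A' \<union> (\<Union>i < N choose k. Bi i))"
    using cover by (subst measure_Int_set_pmf[symmetric]) (intro measure_pmf.finite_measure_mono, auto)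
  also have "\<dots> \<le> measure_pmf.prob ?R A' + measure_pmf.prob ?R (\<Union>i < N choose k. Bi i)"
    by (rule measure_Un_le) auto
  also have "measure_pmf.prob ?R (\<Union>i < N choose k. Bi i) \<le> (\<Sum>i < N choose k. measure_pmf.prob ?R (Bi i))"
    by (rule measure_pmf.finite_measure_subadditive_finite) auto
  also have "\<dots> \<le> (\<Sum>i < N choose k. ?\<beta> ^ (r * q))" by (intro sum_mono pB)
  finally show ?thesis using pA by simp
qed

end

section \<open>Choice of the parameters\<close>

text \<open>The induction step multiplies by \<open>(1 + 1 / k) ^ k\<close>, which is at most
  \<open>exp 1\<close>, hence at most 3. This is the bound behind
  \<open>binomial_le\<close>.\<close>

lemma power_le_fact: "real k ^ k \<le> 3 ^ k * fact k"
proof (induction k)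
  case (Suc k)
  show ?case
  proof (cases "k = 0")
    case False
    have "real (Suc k) ^ k = (1 + 1 / real k) ^ k * real k ^ k"
      using False by (simp add: power_mult_distrib[symmetric] field_simps)
    also have "\<dots> \<le> exp (1 / real k) ^ k * real k ^ k"
      by (intro mult_right_mono power_mono exp_ge_add_one_self) auto
    also have "exp (1 / real k) ^ k = exp 1" using False by (simp add: exp_of_nat_mult[symmetric])
    also have "exp 1 * real k ^ k \<le> 3 * (3 ^ k * fact k)"
      using Suc exp_le by (intro mult_mono) auto
    finally have "real (Suc k) * real (Suc k) ^ k \<le> real (Suc k) * (3 * (3 ^ k * fact k))"
      by (intro mult_left_mono) auto
    then show ?thesis by (simp add: ac_simps)
  qed simp
qed simp

lemma binomial_le: "0 < k \<Longrightarrow> real (N choose k) \<le> (3 * (real N / real k)) ^ k"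
proof -
  assume k: "0 < k"
  have "real (N choose k) * real k ^ k \<le> real (N choose k) * (3 ^ k * fact k)"
    by (intro mult_left_mono power_le_fact) auto
  also have "\<dots> = 3 ^ k * real ((N choose k) * fact k)" by simp
  also have "\<dots> \<le> 3 ^ k * real (N ^ k)"
  proof (rule mult_left_mono)
    show "real ((N choose k) * fact k) \<le> real (N ^ k)"
      using binomial_fact_pow[of N k] by (simp only: of_nat_le_iff)
  qed simp
  finally show ?thesis using k by (simp add: power_mult_distrib power_divide field_simps)
qed

lemma block_spec_exists: "\<exists>b. block_spec k b"
proof -
  define b where "b = (LEAST b. 1 \<le> b \<and> k < 4 ^ (b + 1))"
  have "k < 2 ^ k" by (rule less_exp)
  also have "(2::nat) ^ k \<le> 4 ^ k" by (rule power_mono) auto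
  also have "(4::nat) ^ k \<le> 4 ^ (k + 1 + 1)" by (rule power_increasing) auto
  finally have "1 \<le> k + 1 \<and> k < 4 ^ (k + 1 + 1)" by simp
  then have b: "1 \<le> b \<and> k < 4 ^ (b + 1)" unfolding b_def by (rule LeastI)
  have "b = 1 \<or> 4 ^ b \<le> k"
  proof (rule disjCI)
    assume "\<not> 4 ^ b \<le> k"
    show "b = 1"
    proof (rule ccontr)
      assume "b \<noteq> 1"
      then have "b - 1 < b" "1 \<le> b - 1" "k < 4 ^ (b - 1 + 1)" using b \<open>\<not> 4 ^ b \<le> k\<close> by auto
      then show False using not_less_Least[of "b - 1" "\<lambda>b. 1 \<le> b \<and> k < 4 ^ (b + 1)"] unfolding b_def[symmetric] by blast
    qed
  qed
  then show ?thesis using b unfolding block_spec_def by blast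
qed

lemma bits_spec_exists: "1 \<le> n \<Longrightarrow> \<exists>q. bits_spec n q"
proof -
  assume n: "1 \<le> n"
  define q where "q = (LEAST q. n < 2 ^ q)"
  have q: "n < 2 ^ q" unfolding q_def by (rule LeastI[of _ n]) (rule less_exp)
  have "q \<noteq> 0" using q n by (cases q) auto
  then have "\<not> n < 2 ^ (q - 1)" using not_less_Least[of "q - 1" "\<lambda>q. n < 2 ^ q"] unfolding q_def[symmetric] by auto
  then have "2 ^ q \<le> 2 * n" using \<open>q \<noteq> 0\<close> by (cases q) auto
  then show ?thesis using q unfolding bits_spec_def by blast
qed

lemma subset_increasing:
  assumes "W \<subseteq> {..<N}" "card W = k"
  obtains u where "increasing k N u" "W = u ` {..<k}"
proof -
  let ?xs = "sorted_list_of_set W"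
  have fin: "finite W" using assms(1) finite_subset by blast
  have len: "length ?xs = k" using assms(2) by simp
  have lt: "?xs ! l < N" if "l < k" for l
  proof -
    have "?xs ! l \<in> set ?xs" using that len by (intro nth_mem) simp
    then show ?thesis using assms(1) fin by auto
  qed
  define u where "u l = (if l < k then ?xs ! l else N)" for l
  have "increasing k N u"
    unfolding increasing_def
  proof (intro conjI allI impI)
    fix l assume "l < k"
    then show "u l < u (Suc l)"
      using lt[of l] len sorted_wrt_nth_less[OF strict_sorted_list_of_set, of l "Suc l" W]
      by (auto simp: u_def)
  qed (simp add: u_def)
  moreover have "W = u ` {..<k}"
  proof -
    have "W = set ?xs" using fin by simp
    also have "\<dots> = u ` {..<k}" using len by (auto simp: set_conv_nth u_def)
    finally show ?thesis .
  qed
  ultimately show thesis by (rule that)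
qed

lemma support_card: "hamming_weight s = card (support s)"
proof -
  have "{i. i < dim_vec s \<and> s $ i \<noteq> 0} = support s" by (auto simp: support_def bit_not_zero_iff)
  then show ?thesis by (simp add: hamming_weight_def)
qed

text \<open>The support may meet fewer than \<open>k\<close> blocks; its blocks are padded to
  exactly \<open>k\<close>, which is possible as \<open>k <= N\<close>.\<close>

lemma cover_support:
  assumes s: "s \<in> carrier_vec n" "hamming_weight s \<le> k" and b: "1 \<le> b" and N: "N = (n + b - 1) div b" and kN: "k \<le> N"
  shows "\<exists>i1 < N choose k. \<forall>c \<in> support s. \<exists>l < k. \<exists>h < b. c = comb k N i1 l * b + h"
proof -
  have blk: "c div b < N" if "c < n" for c
  proof -
    have "c div b * b \<le> c" by simp
    moreover have "Suc (c div b) * b = c div b * b + b" by simp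
    ultimately have "Suc (c div b) * b \<le> n + b - 1" using that b by linarith
    then have "Suc (c div b) \<le> N" unfolding N using b by (simp add: less_eq_div_iff_mult_less_eq)
    then show ?thesis by simp
  qed
  let ?T = "(\<lambda>c. c div b) ` support s"
  have fin: "finite (support s)" using support_subset[OF s(1)] finite_subset by blast
  have "?T \<subseteq> {..<N}" using blk support_subset[OF s(1)] by auto
  moreover have "card ?T \<le> k" using card_image_le[OF fin, of "\<lambda>c. c div b"] s(2) by (simp add: support_card)
  ultimately obtain W where W: "?T \<subseteq> W" "W \<subseteq> {..<N}" "card W = k"
    using exists_subset_between[of ?T k "{..<N}"] kN by auto
  obtain u where u: "increasing k N u" "W = u ` {..<k}" using subset_increasing[OF W(2,3)] by blast
  obtain i1 where i1: "i1 < N choose k" "\<forall>l < k. comb k N i1 l = u l" using comb_surj[OF kN u(1)] by blast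
  have "\<exists>l < k. \<exists>h < b. c = comb k N i1 l * b + h" if "c \<in> support s" for c
  proof -
    have "c div b \<in> u ` {..<k}" using that W(1) u(2) by blast
    then obtain l where "l < k" "c div b = u l" by auto
    moreover have "c = c div b * b + c mod b" by simp
    moreover have "c mod b < b" using b by simp
    ultimately show ?thesis using i1(2) by metis
  qed
  then show ?thesis using i1(1) by blast
qed

lemma admissible:
  fixes n k :: nat
  assumes "2 \<le> k" "real k < real n / ln (real n)"
  shows "2 \<le> n" "k \<le> n" "real k * ln (real k) < real n"
proof -
  have n: "2 \<le> n"
  proof (rule ccontr)
    assume "\<not> 2 \<le> n"
    \<comment> \<open>Here the quotient \<open>n / ln n\<close> is 0, for \<open>n = 1\<close> by
      the convention for division by 0, which contradicts the upper bound on
      \<open>k\<close>.\<close>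
    then have "n = 0 \<or> n = 1" by auto
    then show False using assms by auto
  qed
  then have ln: "0 < ln (real n)" by simp
  then have kn: "real k * ln (real n) < real n" using assms(2) by (simp add: field_simps)
  show "2 \<le> n" by (rule n)
  show kle: "k \<le> n"
  \<comment> \<open>The general argument uses \<open>ln n >= 1\<close>, which fails for
    \<open>n = 2\<close>; there \<open>ln 2 >= 2 / 3\<close> still gives
    \<open>k < 3\<close>.\<close>
  proof (cases "n = 2")
    case True
    have "2 / 3 \<le> ln (2::real)" by (rule ln2_ge_two_thirds)
    then have "real k * (2 / 3) \<le> real k * ln 2" by (intro mult_left_mono) auto
    then have "real k * (2 / 3) < 2" using kn True by simp
    then show ?thesis using True by linarith
  next
    case False
    then have "3 \<le> n" using n by simp
    then have "exp 1 \<le> real n" using exp_le by linarith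
    then have "1 \<le> ln (real n)" using n by (simp add: ln_ge_iff)
    then have "real k * 1 \<le> real k * ln (real n)" by (intro mult_left_mono) auto
    then show ?thesis using kn by simp
  qed
  have "ln (real k) \<le> ln (real n)" using kle assms(1) by simp
  then have "real k * ln (real k) \<le> real k * ln (real n)" by (intro mult_left_mono) auto
  then show "real k * ln (real k) < real n" using kn by simp
qed

lemma nat_sq_le: "k * k \<le> 4 ^ k"
proof -
  have "k \<le> 2 ^ k" by simp
  then have "k * k \<le> 2 ^ k * 2 ^ k" by (intro mult_mono) auto
  also have "\<dots> = (4::nat) ^ k" by (simp add: power_mult_distrib[symmetric])
  finally show ?thesis .
qed

text \<open>Base 4 in \<open>block_spec\<close> pays off in \<open>k * b <= n\<close>: because
  \<open>ln 4 >= 1\<close>, it gives \<open>b <= ln k\<close> for \<open>b > 1\<close>, and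
  \<open>k * ln k < n\<close>. Conversely \<open>ln k <= 4 * b\<close> shows that the blocks are
  long enough for the last bound.\<close>

lemma block_props:
  fixes n k :: nat
  assumes k: "2 \<le> k" "real k < real n / ln (real n)" and b: "block_spec k b"
  defines "N \<equiv> (n + b - 1) div b"
  shows "2 ^ b \<le> k" "b \<le> k" "k * b \<le> n" "k \<le> N" "N \<le> n" "N * b \<le> 2 * n"
    "real N / real k \<le> 8 * (real n / (real k * ln (real k)))"
proof -
  note a = admissible[OF k]
  have b1: "1 \<le> b" and bk: "b = 1 \<or> 4 ^ b \<le> k" and kb: "k < 4 ^ (b + 1)" using b by (auto simp: block_spec_def)
  have "(2::nat) ^ b \<le> 4 ^ b" by (rule power_mono) auto
  then show b2: "2 ^ b \<le> k" using bk k(1) by auto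
  show bk': "b \<le> k" using b2 less_exp[of b] by linarith
  show kbn: "k * b \<le> n"
  proof (cases "b = 1")
    case True
    then show ?thesis using a(2) by simp
  next
    case False
    then have "real 4 ^ b \<le> real k" using bk by (metis of_nat_le_iff of_nat_power)
    then have "ln (real 4 ^ b) \<le> ln (real k)" using k(1) by (subst ln_le_cancel_iff) auto
    then have "real b * ln 4 \<le> ln (real k)" by (simp add: ln_realpow)
    moreover have "1 \<le> ln (4::real)" using exp_le by (simp add: ln_ge_iff)
    then have "real b * 1 \<le> real b * ln 4" by (intro mult_left_mono) auto
    ultimately have "real k * real b \<le> real k * ln (real k)" by (intro mult_left_mono) auto
    then have "real (k * b) < real n" using a(3) by simp
    then show ?thesis by linarith
  qed
  have "k * b \<le> n + b - 1" using kbn b1 by simp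
  then show "k \<le> N" unfolding N_def using b1 by (simp add: less_eq_div_iff_mult_less_eq)
  have bn: "b \<le> n" using bk' a(2) by simp
  have "N * b \<le> n + b - 1" unfolding N_def by (rule div_times_less_eq_dividend)
  then show Nb: "N * b \<le> 2 * n" using bn by simp
  have "n + b - 1 \<le> n * b" using b1 a(1) by (cases b; cases n) auto
  then have "N \<le> n * b div b" unfolding N_def by (intro div_le_mono)
  then show "N \<le> n" using b1 by simp
  have "real k < real 4 ^ (b + 1)" using kb by (metis of_nat_less_iff of_nat_power)
  then have "ln (real k) < ln (real 4 ^ (b + 1))" using k(1) by (subst ln_less_cancel_iff) auto
  also have "\<dots> = real (b + 1) * ln 4" by (subst ln_realpow) auto
  \<comment> \<open>This uses \<open>b + 1 <= 2 * b\<close> and \<open>ln 4 <= 2\<close>.\<close>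
  also have "\<dots> \<le> real (2 * b) * 2"
  proof (rule mult_mono)
    have "(4::real) \<le> exp 1 * exp 1"
    proof -
      have "(2::real) \<le> exp 1" using exp_ge_add_one_self[of 1] by simp
      then have "2 * 2 \<le> exp 1 * (exp 1 :: real)" by (intro mult_mono) auto
      then show ?thesis by simp
    qed
    then have "ln 4 \<le> ln (exp 1 * (exp 1 :: real))" by (subst ln_le_cancel_iff) auto
    then show "ln (4::real) \<le> 2" by (simp add: ln_mult)
  qed (use b1 in auto)
  finally have lnk: "ln (real k) \<le> 4 * real b" by simp
  have lnk0: "0 < ln (real k)" using k(1) by simp
  have "real N * ln (real k) \<le> real N * (4 * real b)" using lnk by (intro mult_left_mono) auto
  also have "\<dots> = 4 * real (N * b)" by simp
  also have "\<dots> \<le> 4 * real (2 * n)" using Nb by (intro mult_left_mono) (auto simp only: of_nat_le_iff)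
  finally have "real N * ln (real k) \<le> 8 * real n" by simp
  then show "real N / real k \<le> 8 * (real n / (real k * ln (real k)))"
    using k(1) lnk0 by (simp add: field_simps)
qed

text \<open>\<open>H\<close> has to cover the address range
  \<open>(D ^ 3 + k * A * q) * (n + 1)\<close>. The crude bound \<open>q <= 2 * n\<close> is the
  source of the square of \<open>n + 1\<close>; it only affects the constant in the word
  length.\<close>

lemma lspn_params:
  fixes n k A C b q :: nat
  assumes k: "2 \<le> k" "real k < real n / ln (real n)" and b: "block_spec k b" and q: "bits_spec n q"
    and A: "1 \<le> A" and C: "64 \<le> C"
  defines "D \<equiv> C ^ k"
  shows "lspn n k b ((n + b - 1) div b) q (k * A) D (D * D * D) (32 * A * (D * D * D) * (n + 1) ^ 2) (A * (D * D * D))"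
proof -
  define N where "N = (n + b - 1) div b"
  note a = admissible[OF k]
  note bp = block_props[OF k b, folded N_def]
  have k2D: "k * k \<le> D" "k * 2 ^ k \<le> D" "k \<le> D" "1 \<le> D" "2 ^ k \<le> D"
  proof -
    have 4: "(4::nat) ^ k \<le> D" unfolding D_def using C by (intro power_mono) auto
    show "k * k \<le> D" using nat_sq_le[of k] 4 by linarith
    have "k * 2 ^ k \<le> 2 ^ k * 2 ^ k" by (intro mult_right_mono) auto
    also have "\<dots> = (4::nat) ^ k" by (simp add: power_mult_distrib[symmetric])
    finally show "k * 2 ^ k \<le> D" using 4 by linarith
    show "k \<le> D" using \<open>k * k \<le> D\<close> k(1) by (metis le_square order.trans)
    show "1 \<le> D" using \<open>k \<le> D\<close> k(1) by simp
    have "1 * 2 ^ k \<le> k * 2 ^ k" using k(1) by (intro mult_right_mono) auto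
    then show "2 ^ k \<le> D" using \<open>k * 2 ^ k \<le> D\<close> by linarith
  qed
  define G where "G = D * D * D"
  define V where "V = A * G"
  define W where "W = V * (n + 1) ^ 2"
  have DG: "D \<le> G" unfolding G_def using k2D(4) by (simp add: mult_le_mono)
  have GV: "G \<le> V" unfolding V_def using A by simp
  have V1: "1 \<le> V" using DG GV k2D(4) by linarith
  have "k \<le> G" using k2D(3) DG by (rule order.trans)
  then have kA: "k * A \<le> V" unfolding mult.commute[of k A] V_def by (rule mult_left_mono) simp
  have "q < 2 ^ q" by (rule less_exp)
  then have q2: "q \<le> 2 * n" "2 ^ q \<le> 2 * n" using q unfolding bits_spec_def by linarith+
  have VW: "V \<le> W" unfolding W_def by simp
  have nW: "n + 1 \<le> W"
  proof -
    have "1 * (n + 1) \<le> V * (n + 1) ^ 2" using V1 by (intro mult_mono) (auto simp: power2_eq_square)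
    then show ?thesis unfolding W_def by simp
  qed
  have X: "(G + k * A * q) * (n + 1) \<le> 2 * W"
  proof -
    have "G + k * A * q \<le> V + V * (2 * n)" by (rule add_mono[OF GV mult_le_mono[OF kA q2(1)]])
    also have "\<dots> = V * (2 * n + 1)" by (simp only: distrib_left mult_1_right add.commute)
    also have "\<dots> \<le> V * (2 * (n + 1))" by (intro mult_left_mono) auto
    finally have "(G + k * A * q) * (n + 1) \<le> V * (2 * (n + 1)) * (n + 1)" by (rule mult_right_mono) simp
    also have "\<dots> = 2 * W" unfolding W_def by (simp only: power2_eq_square mult.commute mult.left_commute mult.assoc)
    finally show ?thesis .
  qed
  have add_le: "m + x \<le> 32 * w" if "x \<le> 2 * w" "m + 1 \<le> w" for m x w :: nat using that by linarith
  have rq1: "k * A * q + 1 \<le> 32 * W"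
  proof -
    have "k * A * q * 1 \<le> (G + k * A * q) * (n + 1)" by (intro mult_mono) auto
    then have "k * A * q \<le> 2 * W" using X by (simp only: mult_1_right)
    moreover have "1 \<le> W" using nW by linarith
    ultimately show ?thesis by linarith
  qed
  have bk: "b * 2 ^ k \<le> k * 2 ^ k" "k * b \<le> k * k" using bp(2) by auto
  have HW: "32 * A * (D * D * D) * (n + 1) ^ 2 = 32 * W"
    by (simp only: W_def V_def G_def mult.assoc)
  show ?thesis
    unfolding N_def[symmetric] HW unfolding G_def[symmetric] unfolding V_def[symmetric]
  proof
    show "1 \<le> b" using b by (simp add: block_spec_def)
    show "2 \<le> 32 * W" using nW by linarith
    show "n + 1 \<le> 32 * W" using nW by linarith
    show "N * b \<le> 32 * W" using bp(6) nW by linarith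
    show "N \<le> 32 * W" using bp(5) nW by linarith
    show "k \<le> 32 * W" using k2D(3) DG GV VW by linarith
    show "b * 2 ^ k \<le> 32 * W" using bk(1) k2D(2) DG GV VW by linarith
    show "k * A * q + 1 \<le> 32 * W" by (rule rq1)
    show "2 ^ q \<le> 32 * W" using q2(2) nW by linarith
    show "k * b \<le> 32 * W" using bp(3) nW by linarith
    show "n + (G + k * A * q) * (n + 1) \<le> 32 * W" using X nW by (rule add_le)
    show "D \<le> 32 * W" using DG GV VW by linarith
    show "k * A \<le> 32 * W" using kA VW by linarith
    show "k \<le> V" using k2D(3) DG GV by linarith
    show "b * 2 ^ k \<le> V" using bk(1) k2D(2) DG GV by linarith
    show "G \<le> V" by (rule GV)
    show "k * A \<le> V" by (rule kA)
    show "k * b \<le> V" using bk(2) k2D(1) DG GV by linarith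
  qed
qed

lemma three_le_power4: "3 * k \<le> 4 ^ k"
proof (induction k)
  case (Suc k)
  have "1 \<le> (4::nat) ^ k" by simp
  then have "3 + 3 * k \<le> 4 * 4 ^ k" using Suc by linarith
  then show ?case by simp
qed simp

text \<open>\<open>D ^ 3\<close> samples leave at least \<open>20 * k ^ 2 * D ^ 2\<close> lists.
  Absorbing \<open>2 ^ k\<close> raises 20 to 21 and \<open>2 ^ b <= k\<close> supplies a third
  factor \<open>k\<close>. The number 64 comes from
  \<open>27 * k ^ 3 <= (4 ^ k) ^ 3 = 64 ^ k\<close>.\<close>

lemma list_bound:
  fixes k b C :: nat
  assumes k: "2 \<le> k" and b: "2 ^ b \<le> k" and C: "64 \<le> C"
  defines "D \<equiv> C ^ k"
  shows "(20 * k * k * D * D + 2 ^ k) * 2 ^ b \<le> D * D * D"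
proof -
  have "(3 * k) ^ 3 \<le> (4 ^ k) ^ 3" using three_le_power4 by (intro power_mono) auto
  also have "(4 ^ k) ^ 3 = ((4::nat) ^ 3) ^ k" by (simp only: power_mult[symmetric] mult.commute)
  also have "(4::nat) ^ 3 = 64" by simp
  also have "(64::nat) ^ k \<le> D" unfolding D_def using C by (intro power_mono) auto
  finally have kD: "27 * (k * k * k) \<le> D" by (simp add: power3_eq_cube)
  have "(2::nat) ^ k \<le> D" unfolding D_def using C by (intro power_mono) auto
  also have "D \<le> k * k * D * D"
  proof -
    have "1 \<le> D" unfolding D_def using C by simp
    then have "1 * 1 * D * 1 \<le> k * k * D * D" using k by (intro mult_mono) auto
    then show ?thesis by simp
  qed
  finally have "2 ^ k \<le> k * k * D * D" .
  moreover have "20 * k * k * D * D = 20 * (k * k * D * D)" by (simp only: mult.assoc)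
  ultimately have "20 * k * k * D * D + 2 ^ k \<le> 21 * (k * k * D * D)" by linarith
  then have "(20 * k * k * D * D + 2 ^ k) * 2 ^ b \<le> 21 * (k * k * D * D) * k"
    using b by (intro mult_mono) auto
  also have "\<dots> \<le> 27 * (k * k * k) * (D * D)" by simp
  also have "\<dots> \<le> D * (D * D)" using kD by (rule mult_right_mono) simp
  finally show ?thesis by (simp add: mult.assoc)
qed

text \<open>Each factor of \<open>H\<close> is bounded by a power of 2 whose exponent is linear in
  \<open>k\<close> plus the rounded logarithm of \<open>n\<close>. The factor 12 is the degree from
  \<open>fits_parts\<close>, and the final \<open>+ 1\<close> makes the inequality strict.\<close>

lemma word_bound:
  fixes n k A C :: nat
  assumes n: "2 \<le> n" and k: "2 \<le> k"
  shows "(32 * A * (C ^ k * C ^ k * C ^ k) * (n + 1) ^ 2) ^ 12 < 2 ^ word_size (12 * (A + 3 * C + 9) + 1) n k"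
proof -
  define lg where "lg = nat \<lceil>log 2 (real n)\<rceil>"
  define e where "e = k + lg"
  have "real n = 2 powr log 2 (real n)" using n by simp
  also have "\<dots> \<le> 2 powr real lg" unfolding lg_def by (intro powr_mono) (auto intro: real_nat_ceiling_ge)
  also have "\<dots> = real (2 ^ lg)" by (simp add: powr_realpow)
  finally have "n \<le> 2 ^ lg" by (simp only: of_nat_le_iff)
  then have n1: "n + 1 \<le> 2 ^ (lg + 1)" using n by simp
  have "C \<le> 2 ^ C" by simp
  then have "C ^ k \<le> (2 ^ C) ^ k" by (intro power_mono) auto
  then have Ck: "C ^ k \<le> 2 ^ (C * k)" by (simp add: power_mult)
  have "32 * A * (C ^ k * C ^ k * C ^ k) * (n + 1) ^ 2 \<le>
      2 ^ 5 * 2 ^ A * (2 ^ (C * k) * 2 ^ (C * k) * 2 ^ (C * k)) * (2 ^ (lg + 1)) ^ 2"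
    using Ck n1 by (intro mult_mono power_mono) auto
  also have "\<dots> = 2 ^ (5 + A + 3 * (C * k) + (lg + 1) * 2)"
    by (simp only: power_add[symmetric] power_mult[symmetric]) (rule arg_cong[where f = "\<lambda>x. 2 ^ x"], simp)
  also have "\<dots> \<le> 2 ^ ((A + 3 * C + 9) * e)"
  proof (rule power_increasing)
    have "A * 1 \<le> A * e" using k by (intro mult_left_mono) (auto simp: e_def)
    moreover have "C * k \<le> C * e" by (simp add: e_def)
    moreover have "7 + 2 * lg \<le> 9 * e" using k by (simp add: e_def)
    ultimately have "A + 3 * (C * k) + (7 + 2 * lg) \<le> A * e + 3 * (C * e) + 9 * e" by linarith
    then show "5 + A + 3 * (C * k) + (lg + 1) * 2 \<le> (A + 3 * C + 9) * e"
      by (simp add: algebra_simps)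
  qed simp
  finally have "(32 * A * (C ^ k * C ^ k * C ^ k) * (n + 1) ^ 2) ^ 12 \<le> (2 ^ ((A + 3 * C + 9) * e)) ^ 12"
    by (rule power_mono) simp
  also have "\<dots> = 2 ^ (12 * (A + 3 * C + 9) * e)" by (simp only: power_mult[symmetric] mult.commute mult.left_commute)
  also have "\<dots> < 2 ^ ((12 * (A + 3 * C + 9) + 1) * e)"
    using k by (intro power_strict_increasing) (auto simp: e_def)
  finally show ?thesis by (simp only: word_size_def e_def lg_def)
qed

text \<open>The number of scoring samples is of order
  \<open>k * ln n = k * ln (n / k) + k * ln k\<close>. The second term is at most
  \<open>k ^ 2\<close>, which the exponential term swallows; that term is \<open>D ^ 3\<close>
  written as a power of 2.\<close>

lemma sample_bound:
  fixes n k A C q :: nat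
  assumes k: "2 \<le> k" "real k < real n / ln (real n)" and q: "bits_spec n q" and A: "1 \<le> A" and C: "64 \<le> C"
  shows "real (C ^ k * C ^ k * C ^ k + k * A * q) \<le>
    4 * real A * (2 powr (3 * log 2 (real C) * real k) + real k * ln (real n / real k))"
proof -
  note a = admissible[OF k]
  have Ck: "2 powr (3 * log 2 (real C) * real k) = real (C ^ k * C ^ k * C ^ k)"
  proof -
    have "2 powr (3 * log 2 (real C) * real k) = (2 powr log 2 (real C)) powr (real (3 * k))"
      by (simp add: powr_powr ac_simps)
    also have "2 powr log 2 (real C) = real C" using C by (intro powr_log_cancel) auto
    also have "real C powr real (3 * k) = real C ^ (3 * k)" using C by (intro powr_realpow) auto
    also have "3 * k = k + k + k" by simp
    finally show ?thesis by (simp only: power_add of_nat_mult of_nat_power)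
  qed
  have "real (2 ^ q) \<le> real (2 * n)" using q by (simp only: bits_spec_def of_nat_le_iff)
  then have "ln (real (2 ^ q)) \<le> ln (real (2 * n))" using a(1) by (subst ln_le_cancel_iff) auto
  then have "real q * ln 2 \<le> ln 2 + ln (real n)" using a(1) by (simp add: ln_realpow ln_mult)
  moreover have ln2: "1 / 2 \<le> ln (2::real)" using ln2_ge_two_thirds by linarith
  moreover have "real q * (1 / 2) \<le> real q * ln 2" using ln2 by (intro mult_left_mono) auto
  moreover have "ln 2 \<le> (1::real)" using ln_le_minus_one[of 2] by simp
  ultimately have "real q \<le> 2 + 2 * ln (real n)" by linarith
  also have "ln (real n) = ln (real n / real k) + ln (real k)" using a(1) k by (simp add: ln_div)
  also have "ln (real k) \<le> real k - 1" using k by (intro ln_le_minus_one) auto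
  finally have "real q \<le> 2 * ln (real n / real k) + 2 * real k" by simp
  then have "real k * real q \<le> real k * (2 * ln (real n / real k) + 2 * real k)" by (intro mult_left_mono) auto
  also have "\<dots> = 2 * (real k * ln (real n / real k)) + 2 * real (k * k)" by (simp add: algebra_simps)
  also have "real (k * k) \<le> real (C ^ k * C ^ k * C ^ k)"
  proof -
    have "k * k \<le> 4 ^ k" by (rule nat_sq_le)
    also have "(4::nat) ^ k \<le> C ^ k" using C by (intro power_mono) auto
    also have "C ^ k = C ^ k * 1 * 1" by simp
    also have "\<dots> \<le> C ^ k * C ^ k * C ^ k" using C by (intro mult_mono) auto
    finally show ?thesis by (simp only: of_nat_le_iff)
  qed
  finally have kq: "real k * real q \<le> 2 * (real k * ln (real n / real k)) + 2 * real (C ^ k * C ^ k * C ^ k)" by simp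
  have lnk: "0 \<le> real k * ln (real n / real k)"
    using a(1,2) k by (intro mult_nonneg_nonneg ln_ge_zero) (auto simp: field_simps)
  let ?G = "real (C ^ k * C ^ k * C ^ k)" and ?l = "real k * ln (real n / real k)"
  have "real A * (real k * real q) \<le> real A * (2 * ?l + 2 * ?G)" using kq by (intro mult_left_mono) auto
  moreover have "1 * ?G \<le> real A * ?G" using A by (intro mult_right_mono) auto
  moreover have "0 \<le> real A * ?l" using lnk by simp
  moreover have "real (C ^ k * C ^ k * C ^ k + k * A * q) = ?G + real A * (real k * real q)" by simp
  moreover have "0 \<le> real A * ?G" by simp
  moreover have "4 * real A * (?G + ?l) = 4 * (real A * ?G) + 4 * (real A * ?l)" by (simp add: algebra_simps)
  moreover have "real A * (2 * ?l + 2 * ?G) = 2 * (real A * ?l) + 2 * (real A * ?G)" by (simp add: algebra_simps)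
  ultimately show ?thesis unfolding Ck by linarith
qed

text \<open>Separates the work outside the search, of order \<open>G * n ^ 2\<close>, from the
  search itself. \<open>G\<close> depends on \<open>k\<close> and the constants only.\<close>

lemma time_nat_bound:
  fixes n k A C b q N :: nat
  assumes k: "2 \<le> k" "real k < real n / ln (real n)" and b: "block_spec k b" and q: "bits_spec n q"
    and A: "1 \<le> A" and C: "64 \<le> C"
  defines "G \<equiv> A * (C ^ k * C ^ k * C ^ k)" and "N \<equiv> (n + b - 1) div b"
  shows "cost (n + k) (SETUP A C) + 20 + (C ^ k * C ^ k * C ^ k + k * A * q) * (n + 24) +
      lspn.tail_time n k b N q (k * A) G \<le>
    (3 * cost 0 (SETUP A C) + 1000) * (G * (n * n)) + (N choose k) * (4 + cost 0 BODY * (G + 1) ^ loop_depth BODY)"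
proof -
  let ?D = "C ^ k"
  interpret lspn n k b N q "k * A" ?D "?D * ?D * ?D" "32 * A * (?D * ?D * ?D) * (n + 1) ^ 2" G
    unfolding G_def N_def by (rule lspn_params[OF k b q A C])
  note a = admissible[OF k] and bp = block_props[OF k b]
  have "q < 2 ^ q" by (rule less_exp)
  then have q2: "2 ^ q \<le> 2 * n" "q \<le> 2 * n" using q unfolding bits_spec_def by linarith+
  have G1: "1 \<le> G" unfolding G_def using A C by (simp add: Suc_le_eq)
  have DG: "?D * ?D * ?D \<le> G" unfolding G_def using A by simp
  define W where "W = G * (n * n)"
  have n1: "1 \<le> n" using a(1) by simp
  have GnW: "G * n \<le> W" unfolding W_def by simp
  have GW: "G \<le> W" unfolding W_def using n1 by simp
  have nGn: "n \<le> G * n" using G1 by simp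
  have nW: "n \<le> W" using nGn GnW by (rule order.trans)
  have W1: "1 \<le> W" using G1 GW by linarith
  have init: "cost (n + k) (SETUP A C) \<le> (3 * cost 0 (SETUP A C)) * W"
  proof -
    have "cost (n + k) (SETUP A C) \<le> cost 0 (SETUP A C) * (n + k + 1) ^ loop_depth (SETUP A C)" by (rule cost_le)
    also have "loop_depth (SETUP A C) = 1" by (simp add: SETUP_def For_def)
    also have "cost 0 (SETUP A C) * (n + k + 1) ^ 1 \<le> cost 0 (SETUP A C) * (3 * W)"
      using a(2) nW W1 by (intro mult_left_mono) auto
    finally show ?thesis by (simp only: mult.commute mult.left_commute mult.assoc)
  qed
  have kA: "k * A \<le> G" using rU .
  have kAq: "k * A * q \<le> 2 * (G * n)"
  proof -
    have "k * A * q \<le> G * (2 * n)" by (rule mult_le_mono[OF kA q2(2)])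
    then show ?thesis by (simp only: mult.commute mult.left_commute mult.assoc)
  qed
  have GGn: "G \<le> G * n" using n1 by simp
  have draws: "(?D * ?D * ?D + k * A * q) * (n + 24) \<le> 75 * W"
  proof -
    have "?D * ?D * ?D + k * A * q \<le> G * n + 2 * (G * n)"
      by (rule add_mono[OF order.trans[OF DG GGn] kAq])
    then have "?D * ?D * ?D + k * A * q \<le> 3 * (G * n)" by simp
    moreover have "n + 24 \<le> 25 * n" using n1 by simp
    ultimately have "(?D * ?D * ?D + k * A * q) * (n + 24) \<le> 3 * (G * n) * (25 * n)" by (rule mult_le_mono)
    also have "\<dots> = 75 * W" unfolding W_def by simp
    finally show ?thesis .
  qed
  have cols: "(n + 1) * (30 + (k * A * (q * 40 + 60) + 20)) \<le> 400 * W"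
  proof -
    have "k * A * (q * 40 + 60) = 40 * (k * A * q) + 60 * (k * A)" by (simp add: algebra_simps)
    moreover have "1 \<le> G * n" using nGn n1 by (rule order.trans[rotated])
    ultimately have "30 + (k * A * (q * 40 + 60) + 20) \<le> 200 * (G * n)" using kA kAq GGn by linarith
    moreover have "n + 1 \<le> 2 * n" using n1 by simp
    ultimately have "(n + 1) * (30 + (k * A * (q * 40 + 60) + 20)) \<le> (2 * n) * (200 * (G * n))"
      using mult_le_mono by blast
    also have "\<dots> = 400 * W" unfolding W_def by simp
    finally show ?thesis .
  qed
  have body: "cost G BODY \<le> cost 0 BODY * (G + 1) ^ loop_depth BODY" by (rule cost_le)
  have main: "(N choose k) * (4 + cost G BODY) \<le> (N choose k) * (4 + cost 0 BODY * (G + 1) ^ loop_depth BODY)"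
    using body by (intro mult_left_mono) auto
  have kb: "k * b \<le> W" "k \<le> W" using bp(3) a(2) nW by linarith+
  define m1 m2 where "m1 = (N choose k) * (4 + cost G BODY)"
    and "m2 = (N choose k) * (4 + cost 0 BODY * (G + 1) ^ loop_depth BODY)"
  define cl where "cl = (n + 1) * (30 + (k * A * (q * 40 + 60) + 20))"
  define kb' where "kb' = k * b"
  have "tail_time = (2 ^ q * 50 + 20) + ((cl + 20) + ((m1 + k * 20 + 40) + (n * 15 + kb' * 40 + 50) + 1) + 1) + 1"
    unfolding tail_time_def cl_def m1_def kb'_def by (simp only: mult.assoc)
  moreover have "m1 \<le> m2" "cl \<le> 400 * W" "kb' \<le> W"
    using main cols kb unfolding m1_def m2_def cl_def kb'_def by auto
  moreover have "2 ^ q \<le> 2 * W" using q2(1) nW by linarith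
  ultimately have "tail_time \<le> 810 * W + m2" using nW kb(2) W1 by linarith
  then have "cost (n + k) (SETUP A C) + 20 + (?D * ?D * ?D + k * A * q) * (n + 24) + tail_time \<le>
      (3 * cost 0 (SETUP A C)) * W + 20 * W + 75 * W + (810 * W + m2)"
    using init draws W1 by (intro add_mono) auto
  also have "\<dots> \<le> (3 * cost 0 (SETUP A C) + 1000) * W + m2" by (simp add: add_mult_distrib)
  finally show ?thesis unfolding W_def m2_def .
qed

text \<open>With \<open>n = k * ln k * x <= 4 ^ k * x\<close>, the work \<open>n ^ 2\<close> outside
  the search is at most \<open>16 ^ k * x ^ 2\<close>, hence at most \<open>16 ^ k * x ^ k\<close>;
  here both \<open>2 <= k\<close> and \<open>x >= 1\<close> are essential. The search contributes
  \<open>(24 * x) ^ k\<close> unions, the 24 being 3 from \<open>binomial_le\<close> times 8 from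
  \<open>block_props\<close>.\<close>

lemma time_bound:
  fixes n k A C b q N :: nat and x :: real
  assumes k: "2 \<le> k" "real k < real n / ln (real n)" and b: "block_spec k b" and q: "bits_spec n q"
    and A: "1 \<le> A" and C: "64 \<le> C"
  defines "G \<equiv> A * (C ^ k * C ^ k * C ^ k)" and "N \<equiv> (n + b - 1) div b" and "x \<equiv> real n / (real k * ln (real k))"
    and "d \<equiv> loop_depth BODY"
  defines "K \<equiv> real ((3 * cost 0 (SETUP A C) + 1000) * A + 4 + cost 0 BODY * (2 * A) ^ d)"
    and "Q \<equiv> real (16 * C ^ 3 + 24 * C ^ (3 * d))"
  shows "real (cost (n + k) (SETUP A C) + 20 + (C ^ k * C ^ k * C ^ k + k * A * q) * (n + 24) +
      lspn.tail_time n k b N q (k * A) G) \<le> (K * Q * x) ^ k"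
proof -
  note a = admissible[OF k] and bp = block_props[OF k b]
  let ?T = "cost (n + k) (SETUP A C) + 20 + (C ^ k * C ^ k * C ^ k + k * A * q) * (n + 24) +
      lspn.tail_time n k b N q (k * A) G"
  define c1 where "c1 = 3 * cost 0 (SETUP A C) + 1000"
  define c2 where "c2 = cost 0 BODY"
  have T: "?T \<le> c1 * (G * (n * n)) + (N choose k) * (4 + c2 * (G + 1) ^ d)"
    using time_nat_bound[OF k b q A C] unfolding G_def N_def c1_def c2_def d_def .
  have lnk: "0 < ln (real k)" using k(1) by simp
  have kl: "0 < real k * ln (real k)" using k(1) lnk by simp
  have x1: "1 \<le> x" unfolding x_def using a(3) kl by (simp add: field_simps)
  have nx: "real n = real k * ln (real k) * x"
    unfolding x_def using kl by (metis less_irrefl nonzero_mult_div_cancel_left times_divide_eq_right)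
  have C3: "C ^ k * C ^ k * C ^ k = (C ^ 3) ^ k"
    by (simp only: power_mult[symmetric] power_add[symmetric]) (rule arg_cong[where f = "\<lambda>m. C ^ m"], simp)
  have n4: "real n \<le> 4 ^ k * x"
  proof -
    have "ln (real k) \<le> real k" using ln_le_minus_one[of "real k"] k(1) by simp
    then have "real k * ln (real k) \<le> real (k * k)" by (simp add: mult_left_mono)
    also have "\<dots> \<le> real (4 ^ k)" using nat_sq_le[of k] by (simp only: of_nat_le_iff)
    finally have "real k * ln (real k) \<le> 4 ^ k" by simp
    then show ?thesis unfolding nx using x1 by (intro mult_right_mono) auto
  qed
  have first: "real (c1 * (G * (n * n))) \<le> real (c1 * A) * (16 * real C ^ 3 * x) ^ k"
  proof -
    have "real n * real n \<le> (4 ^ k * x) * (4 ^ k * x)" using n4 by (intro mult_mono) auto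
    also have "\<dots> = 16 ^ k * x ^ 2" by (simp add: power2_eq_square power_mult_distrib[symmetric])
    also have "\<dots> \<le> 16 ^ k * x ^ k" using x1 k(1) by (intro mult_left_mono power_increasing) auto
    finally have "real (c1 * A) * (real C ^ 3) ^ k * (real n * real n) \<le> real (c1 * A) * (real C ^ 3) ^ k * (16 ^ k * x ^ k)"
      by (intro mult_left_mono) auto
    moreover have "real (c1 * (G * (n * n))) = real (c1 * A) * (real C ^ 3) ^ k * (real n * real n)"
      unfolding G_def C3 by simp
    ultimately show ?thesis by (simp only: power_mult_distrib mult.assoc mult.commute mult.left_commute)
  qed
  have second: "real ((N choose k) * (4 + c2 * (G + 1) ^ d)) \<le> real (4 + c2 * (2 * A) ^ d) * (24 * real C ^ (3 * d) * x) ^ k"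
  proof -
    let ?Y = "(C ^ (3 * d)) ^ k"
    have "1 \<le> G" unfolding G_def using A C by (simp add: Suc_le_eq)
    then have "(G + 1) ^ d \<le> (2 * G) ^ d" by (intro power_mono) auto
    also have "2 * G = 2 * A * (C ^ 3) ^ k" unfolding G_def C3 by simp
    also have "(2 * A * (C ^ 3) ^ k) ^ d = (2 * A) ^ d * ?Y"
      by (simp only: power_mult_distrib power_mult[symmetric] mult.commute mult.left_commute)
    finally have "c2 * (G + 1) ^ d \<le> c2 * ((2 * A) ^ d * ?Y)" by (rule mult_left_mono) simp
    moreover have "4 * 1 \<le> 4 * ?Y" using C by (intro mult_left_mono) (simp_all add: Suc_le_eq)
    ultimately have "4 + c2 * (G + 1) ^ d \<le> (4 + c2 * (2 * A) ^ d) * ?Y"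
      by (simp only: add_mult_distrib mult.assoc)
    then have 1: "real (4 + c2 * (G + 1) ^ d) \<le> real (4 + c2 * (2 * A) ^ d) * real ?Y"
      by (simp only: of_nat_le_iff of_nat_mult[symmetric])
    have "real (N choose k) \<le> (3 * (real N / real k)) ^ k" using k(1) by (intro binomial_le) simp
    also have "\<dots> \<le> (3 * (8 * x)) ^ k"
      using bp(7) unfolding N_def x_def by (intro power_mono mult_left_mono) auto
    finally have 2: "real (N choose k) \<le> (24 * x) ^ k" by simp
    have "real ((N choose k) * (4 + c2 * (G + 1) ^ d)) \<le> (24 * x) ^ k * (real (4 + c2 * (2 * A) ^ d) * real ?Y)"
      unfolding of_nat_mult[of "N choose k"] using 1 2 x1 by (intro mult_mono) auto
    also have "\<dots> = real (4 + c2 * (2 * A) ^ d) * (24 * real C ^ (3 * d) * x) ^ k"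
      by (simp only: power_mult_distrib of_nat_power mult.commute mult.left_commute mult.assoc)
    finally show ?thesis .
  qed
  have Qx: "(16 * real C ^ 3 * x) ^ k \<le> (Q * x) ^ k" "(24 * real C ^ (3 * d) * x) ^ k \<le> (Q * x) ^ k"
    using x1 unfolding Q_def by (intro power_mono mult_right_mono; simp)+
  have Qx0: "0 \<le> (Q * x) ^ k" using x1 unfolding Q_def by simp
  have "real ?T \<le> real (c1 * (G * (n * n)) + (N choose k) * (4 + c2 * (G + 1) ^ d))" using T by (simp only: of_nat_le_iff)
  also have "\<dots> = real (c1 * (G * (n * n))) + real ((N choose k) * (4 + c2 * (G + 1) ^ d))" by (rule of_nat_add)
  also have "\<dots> \<le> real (c1 * A) * (Q * x) ^ k + real (4 + c2 * (2 * A) ^ d) * (Q * x) ^ k"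
    by (intro add_mono order.trans[OF first] order.trans[OF second] mult_left_mono Qx) auto
  also have "\<dots> = K * (Q * x) ^ k" unfolding K_def c1_def c2_def by (simp only: of_nat_add distrib_right add.assoc)
  also have "\<dots> \<le> K ^ k * (Q * x) ^ k"
  proof (rule mult_right_mono[OF _ Qx0])
    \<comment> \<open>A constant factor \<open>K >= 1\<close> can be moved into the base of the
      power.\<close>
    have "1 \<le> K" unfolding K_def by simp
    then have "K ^ 1 \<le> K ^ k" using k(1) by (intro power_increasing) auto
    then show "K \<le> K ^ k" by simp
  qed
  finally show ?thesis by (simp add: power_mult_distrib mult.assoc)
qed

text \<open>The 20 in the number of lists leaves \<open>b / (20 * k) <= 1 / 20\<close> for all wrong
  decisions of one union. The scoring uses \<open>N choose k <= 2 ^ (k * q)\<close>, so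
  \<open>1 / 64\<close> per \<open>k * q\<close> leaves at most \<open>1 / 32\<close>.\<close>

lemma fail_bound:
  fixes n k b q A D :: nat and \<beta> :: real
  assumes k: "2 \<le> k" and b: "b \<le> k" and D: "0 < D" and q: "bits_spec n q" and N: "N \<le> n" "k \<le> N"
    and \<beta>: "0 \<le> \<beta>" "\<beta> ^ A \<le> 1 / 64"
  shows "real (k * b) * ((real D)\<^sup>2 / real (20 * k * k * D * D)) + real (N choose k) * \<beta> ^ (k * A * q) \<le> 1 / 10"
proof -
  have "real (k * b) * ((real D)\<^sup>2 / real (20 * k * k * D * D)) = real b / (20 * real k)"
    using k D by (simp add: power2_eq_square field_simps)
  also have "\<dots> \<le> 1 / 20" using b k by (simp add: field_simps)
  finally have 1: "real (k * b) * ((real D)\<^sup>2 / real (20 * k * k * D * D)) \<le> 1 / 20" .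
  have nq: "n < 2 ^ q" using q by (simp add: bits_spec_def)
  have "q \<noteq> 0" using nq k N by (cases q) auto
  then have kq: "1 \<le> k * q" using k by (simp add: Suc_le_eq)
  have "N choose k \<le> N ^ k" using N(2) by (rule binomial_le_pow)
  also have "\<dots> \<le> (2 ^ q) ^ k" using N(1) nq by (intro power_mono) auto
  finally have "real (N choose k) \<le> real ((2 ^ q) ^ k)" by (simp only: of_nat_le_iff)
  also have "\<dots> = 2 ^ (k * q)" by (simp only: of_nat_power of_nat_numeral power_mult[symmetric] mult.commute)
  finally have c: "real (N choose k) \<le> 2 ^ (k * q)" .
  have "k * A * q = A * (k * q)" by simp
  then have "\<beta> ^ (k * A * q) = (\<beta> ^ A) ^ (k * q)" by (simp only: power_mult)
  also have "\<dots> \<le> (1 / 64) ^ (k * q)" using \<beta> by (intro power_mono) auto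
  finally have "real (N choose k) * \<beta> ^ (k * A * q) \<le> 2 ^ (k * q) * (1 / 64) ^ (k * q)"
    using c \<beta>(1) by (intro mult_mono) auto
  also have "\<dots> = (1 / 32) ^ (k * q)" by (simp add: power_mult_distrib[symmetric])
  also have "\<dots> \<le> (1 / 32) ^ 1" using kq by (intro power_decreasing) auto
  finally show ?thesis using 1 by simp
qed

lemma solves_lspn_PROG:
  fixes n k A C :: nat and \<eta> :: real
  assumes \<eta>: "0 \<le> \<eta>" "\<eta> < 1 / 2" and k: "2 \<le> k" "real k < real n / ln (real n)"
    and A: "1 \<le> A" "(3 / 4 + \<eta> * (1 - \<eta>)) ^ A \<le> 1 / 64" and C: "64 \<le> C" "2 \<le> real C * (1 - 2 * \<eta>)"
  defines "d \<equiv> loop_depth BODY"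
  defines "K \<equiv> real ((3 * cost 0 (SETUP A C) + 1000) * A + 4 + cost 0 BODY * (2 * A) ^ d)"
    and "Q \<equiv> real (16 * C ^ 3 + 24 * C ^ (3 * d))"
  shows "solves_lspn (PROG A C) (word_size (12 * (A + 3 * C + 9) + 1) n k) \<eta> n k (9 / 10)
    ((K * Q * (real n / (real k * ln (real k)))) ^ k)
    (4 * real A * (2 powr (3 * log 2 (real C) * real k) + real k * ln (real n / real k)))"
  unfolding solves_lspn_def
proof (intro ballI impI)
  fix s :: "bit Matrix.vec" assume s: "s \<in> carrier_vec n" "hamming_weight s \<le> k"
  note a = admissible[OF k]
  let ?D = "C ^ k" and ?P = "lspn_sample \<eta> n s"
  let ?M = "?D * ?D * ?D"
  define w where "w = word_size (12 * (A + 3 * C + 9) + 1) n k"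
  define H where "H = 32 * A * ?M * (n + 1) ^ 2"
  have M1: "1 \<le> ?M" using C(1) by (simp add: Suc_le_eq)
  have CM: "C \<le> ?M"
  proof -
    have "C ^ 1 \<le> C ^ k" using C(1) k(1) by (intro power_increasing) auto
    also have "C ^ k = C ^ k * 1 * 1" by simp
    also have "\<dots> \<le> ?M" using C(1) by (intro mult_mono) (auto simp: Suc_le_eq)
    finally show ?thesis by simp
  qed
  have H1: "32 * A * (n + 1) \<le> H"
  proof -
    have "32 * A * 1 * (n + 1) ^ 1 \<le> 32 * A * ?M * (n + 1) ^ 2"
      by (rule mult_le_mono[OF mult_le_mono[OF order_refl M1] power_increasing]) auto
    then show ?thesis unfolding H_def by simp
  qed
  have An: "A \<le> A * (n + 1)" "n + 1 \<le> A * (n + 1)"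
    using mult_le_mono1[OF A(1), of "n + 1"] by (simp_all only: mult_1) simp
  have Hs: "16 + 4 * k \<le> H" "2 * n \<le> H" "A \<le> H"
    using H1 An a(1,2) A(1) unfolding mult.assoc by linarith+
  have prog: "\<exists>b q. block_spec k b \<and> bits_spec n q \<and>
    srun w ?P (?M + k * A * q)
      (cost (n + k) (SETUP A C) + 20 + (?M + k * A * q) * (n + 24) +
        lspn.tail_time n k b ((n + b - 1) div b) q (k * A) (A * ?M)) (PROG A C) (init_state w n k)
      (\<lambda>zs \<sigma>'. drawn \<sigma>' = ?M + k * A * q \<and>
        lspn.argmin_output n k b ((n + b - 1) div b) q (k * A) ?D ?M
          (\<lambda>j. sample_bit n (zs ! j)) (mem \<sigma>'))"
  proof (rule srun_PROG[where H = H])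
    show "dim_vec (fst z) = n" if "z \<in> set_pmf ?P" for z using set_lspn_sample[OF that] by simp
    show "1 \<le> n" "1 \<le> k" "1 \<le> C" using a(1) k(1) C(1) by auto
    show "H ^ 12 < 2 ^ w" unfolding H_def w_def by (rule word_bound[OF a(1) k(1)])
    show "lspn n k b ((n + b - 1) div b) q (k * A) ?D ?M H (A * ?M) \<and> k \<le> (n + b - 1) div b"
      if "block_spec k b" "bits_spec n q" for b q
      unfolding H_def using lspn_params[OF k that A(1) C(1)] block_props(4)[OF k that(1)] by blast
    show "\<exists>b. block_spec k b" by (rule block_spec_exists)
    show "\<exists>q. bits_spec n q" using a(1) by (intro bits_spec_exists) simp
  qed (rule Hs)+
  then obtain b q where b: "block_spec k b" and q: "bits_spec n q" and
    run: "srun w ?P (?M + k * A * q)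
      (cost (n + k) (SETUP A C) + 20 + (?M + k * A * q) * (n + 24) +
        lspn.tail_time n k b ((n + b - 1) div b) q (k * A) (A * ?M)) (PROG A C) (init_state w n k)
      (\<lambda>zs \<sigma>'. drawn \<sigma>' = ?M + k * A * q \<and>
        lspn.argmin_output n k b ((n + b - 1) div b) q (k * A) ?D ?M
          (\<lambda>j. sample_bit n (zs ! j)) (mem \<sigma>'))" by blast
  define N where "N = (n + b - 1) div b"
  note bp = block_props[OF k b, folded N_def]
  interpret L: lspn n k b N q "k * A" ?D ?M H "A * ?M"
    unfolding N_def H_def by (rule lspn_params[OF k b q A(1) C(1)])
  define T where "T = cost (n + k) (SETUP A C) + 20 + (?M + k * A * q) * (n + 24) + L.tail_time"
  obtain F where F: "run T w ?P (PROG A C) (init_state w n k) = map_pmf (\<lambda>zs. (Skip, F zs)) (replicate_pmf (?M + k * A * q) ?P)"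
      "\<And>zs. zs \<in> set_pmf (replicate_pmf (?M + k * A * q) ?P) \<Longrightarrow> time (F zs) \<le> time (init_state w n k) + T"
      "\<And>zs. zs \<in> set_pmf (replicate_pmf (?M + k * A * q) ?P) \<Longrightarrow> drawn (F zs) = ?M + k * A * q"
      "\<And>zs. zs \<in> set_pmf (replicate_pmf (?M + k * A * q) ?P) \<Longrightarrow> L.argmin_output (L.bits zs) (mem (F zs))"
    using run unfolding srun_def N_def[symmetric] T_def[symmetric] by blast
  let ?R = "replicate_pmf (?M + k * A * q) ?P"
  have T: "real T \<le> (K * Q * (real n / (real k * ln (real k)))) ^ k"
    unfolding T_def N_def K_def Q_def d_def by (rule time_bound[OF k b q A(1) C(1)])
  have dr: "real (?M + k * A * q) \<le> 4 * real A * (2 powr (3 * log 2 (real C) * real k) + real k * ln (real n / real k))"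
    by (rule sample_bound[OF k q A(1) C(1)])
  obtain i1 where i1: "i1 < N choose k" "\<And>c. c \<in> support s \<Longrightarrow> \<exists>l < k. \<exists>h < b. c = comb k N i1 l * b + h"
    using cover_support[OF s _ N_def bp(4)] b by (auto simp: block_spec_def)
  have Dpos: "0 < ?D" using C(1) by simp
  \<comment> \<open>The factor \<open>C ^ k\<close> outweighs the bias: each of the at most
    \<open>2 ^ b <= k\<close> factors \<open>1 - 2 * \<eta>\<close> is compensated by one factor
    \<open>C\<close>.\<close>
  have D2: "2 \<le> real ?D * (1 - 2 * \<eta>) ^ (2 ^ b)"
  proof -
    have "2 \<le> (2::real) ^ k" using k(1) self_le_power[of "2::real" k] by simp
    also have "\<dots> \<le> (real C * (1 - 2 * \<eta>)) ^ k" using C(2) by (intro power_mono) auto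
    also have "\<dots> = real ?D * (1 - 2 * \<eta>) ^ k" by (simp add: power_mult_distrib)
    also have "\<dots> \<le> real ?D * (1 - 2 * \<eta>) ^ (2 ^ b)"
      using bp(1) \<eta> by (intro mult_left_mono power_decreasing) auto
    finally show ?thesis .
  qed
  let ?bad = "{zs. \<exists>m. L.argmin_output (L.bits zs) m \<and> \<not> (\<forall>i < n. m i = of_bool (s $ i = 1))}"
  have "measure_pmf.prob ?R ?bad \<le> real (k * b) * ((real ?D)\<^sup>2 / real (20 * k * k * ?D * ?D)) +
      real (N choose k) * (3 / 4 + \<eta> * (1 - \<eta>)) ^ (k * A * q)"
    by (rule L.success_prob[OF \<eta> s(1) bp(4) i1 _ list_bound[OF k(1) bp(1) C(1)] Dpos D2]) (use k(1) Dpos in \<open>simp only: nat_0_less_mult_iff, simp\<close>)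
  also have "\<dots> \<le> 1 / 10"
    using \<eta> by (intro fail_bound[OF k(1) bp(2) Dpos q bp(5,4) _ A(2)]) simp
  finally have bad: "measure_pmf.prob ?R ?bad \<le> 1 / 10" .
  have "measure_pmf.prob ?R (- {zs. outputs n (F zs) s}) \<le> measure_pmf.prob ?R ?bad"
  proof -
    have "measure_pmf.prob ?R (- {zs. outputs n (F zs) s}) = measure_pmf.prob ?R (- {zs. outputs n (F zs) s} \<inter> set_pmf ?R)"
      by (simp only: measure_Int_set_pmf)
    also have "\<dots> \<le> measure_pmf.prob ?R ?bad"
    proof (rule measure_pmf.finite_measure_mono)
      show "- {zs. outputs n (F zs) s} \<inter> set_pmf ?R \<subseteq> ?bad"
        using F(4) unfolding outputs_def by blast
    qed simp
    finally show ?thesis .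
  qed
  then have "9 / 10 \<le> measure_pmf.prob ?R {zs. outputs n (F zs) s}"
    using bad measure_pmf.prob_compl[of "{zs. outputs n (F zs) s}" ?R] by (simp add: Compl_eq_Diff_UNIV)
  also have "\<dots> = measure_pmf.prob (map_pmf (\<lambda>zs. (Skip, F zs)) ?R) {(c, \<sigma>). outputs n \<sigma> s}"
    by (simp add: vimage_def)
  finally have p: "9 / 10 \<le> measure_pmf.prob (map_pmf (\<lambda>zs. (Skip, F zs)) ?R) {(c, \<sigma>). outputs n \<sigma> s}" .
  have t0: "time (init_state w n k) = 0" by (simp add: init_state_def)
  have "real (time (F zs)) \<le> (K * Q * (real n / (real k * ln (real k)))) ^ k" if "zs \<in> set_pmf ?R" for zs
  proof -
    have "real (time (F zs)) \<le> real T" using F(2)[OF that] t0 by simp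
    then show ?thesis using T by linarith
  qed
  then show "\<exists>N. let R = run N (word_size (12 * (A + 3 * C + 9) + 1) n k) ?P (PROG A C)
            (init_state (word_size (12 * (A + 3 * C + 9) + 1) n k) n k)
          in (\<forall>(c, \<sigma>) \<in> set_pmf R. c = Skip \<and> real (time \<sigma>) \<le> (K * Q * (real n / (real k * ln (real k)))) ^ k \<and>
             real (drawn \<sigma>) \<le> 4 * real A * (2 powr (3 * log 2 (real C) * real k) + real k * ln (real n / real k))) \<and>
             9 / 10 \<le> measure_pmf.prob R {(c, \<sigma>). outputs n \<sigma> s}"
    unfolding w_def[symmetric] using p dr F(3)
    by (intro exI[of _ T]) (auto simp: F(1) Let_def)
qed

theorem theorem9:
  fixes \<eta> :: real
  assumes "0 \<le> \<eta>" and "\<eta> < 1 / 2"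
  shows "\<exists>P c C A B. C > 0 \<and> A > 0 \<and> B > 0 \<and>
    (\<forall>n k :: nat. 2 \<le> k \<and> real k < real n / ln (real n) \<longrightarrow>
      solves_lspn P (word_size c n k) \<eta> n k (9 / 10)
        ((C * (real n / (real k * ln (real k)))) ^ k)
        (A * (2 powr (B * real k) + real k * ln (real n / real k))))"
proof -
  let ?\<beta> = "3 / 4 + \<eta> * (1 - \<eta>)"
  \<comment> \<open>64 is what \<open>list_bound\<close> needs; the other value ensures
    \<open>C * (1 - 2 * \<eta>) >= 2\<close>, so that \<open>D\<close> exceeds twice the inverse of
    the bias.\<close>
  define C :: nat where "C = max 64 (nat \<lceil>2 / (1 - 2 * \<eta>)\<rceil>)"
  have C64: "64 \<le> C" by (simp add: C_def)
  have "2 / (1 - 2 * \<eta>) \<le> real C"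
    unfolding C_def by (rule order.trans[OF real_nat_ceiling_ge]) (simp only: of_nat_le_iff max.cobounded2)
  then have C2: "2 \<le> real C * (1 - 2 * \<eta>)" using assms by (simp add: field_simps)
  have \<beta>0: "0 \<le> ?\<beta>" using assms by simp
  \<comment> \<open>Positivity of this square is the same as
    \<open>\<eta> * (1 - \<eta>) < 1 / 4\<close>, that is \<open>?\<beta> < 1\<close>.\<close>
  have "0 < (1 - 2 * \<eta>)\<^sup>2" using assms by simp
  then have "\<eta> * (1 - \<eta>) < 1 / 4" by (simp add: power2_eq_square algebra_simps)
  then have \<beta>1: "?\<beta> < 1" by simp
  obtain a where a: "?\<beta> ^ a < 1 / 64" using real_arch_pow_inv[OF _ \<beta>1, of "1 / 64"] by auto
  define A where "A = Suc a"
  have A1: "1 \<le> A" by (simp add: A_def)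
  have "?\<beta> ^ A \<le> ?\<beta> ^ a" unfolding A_def using \<beta>0 \<beta>1 by (intro power_decreasing) auto
  then have A64: "?\<beta> ^ A \<le> 1 / 64" using a by linarith
  define d where "d = loop_depth BODY"
  define K where "K = real ((3 * cost 0 (SETUP A C) + 1000) * A + 4 + cost 0 BODY * (2 * A) ^ d)"
  define Q where "Q = real (16 * C ^ 3 + 24 * C ^ (3 * d))"
  have "0 < (3 * cost 0 (SETUP A C) + 1000) * A + 4 + cost 0 BODY * (2 * A) ^ d" by simp
  then have "0 < K" unfolding K_def by (simp only: of_nat_0_less_iff)
  have "0 < 16 * C ^ 3" using C64 by simp
  then have "0 < Q" unfolding Q_def by (simp only: of_nat_0_less_iff add_gr_0 simp_thms)
  with \<open>0 < K\<close> have "0 < K * Q" by simp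
  moreover have "0 < 4 * real A" using A1 by simp
  moreover have "0 < 3 * log 2 (real C)" using C64 by simp
  moreover have "\<forall>n k :: nat. 2 \<le> k \<and> real k < real n / ln (real n) \<longrightarrow>
      solves_lspn (PROG A C) (word_size (12 * (A + 3 * C + 9) + 1) n k) \<eta> n k (9 / 10)
        ((K * Q * (real n / (real k * ln (real k)))) ^ k)
        (4 * real A * (2 powr (3 * log 2 (real C) * real k) + real k * ln (real n / real k)))"
    using solves_lspn_PROG[OF assms _ _ A1 A64 C64 C2] unfolding K_def Q_def d_def by blast
  ultimately show ?thesis by blast
qed

end
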